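(* Let $v\in\widehat{\mathcal{D}}$ satisfy the two conditions $$\sup_{0<r<1}\left(\int_r^1\frac{\widehat{v}(s)}{(1-s)^2}\,ds\right)^{1/2}\left(\int_0^r\frac{1}{\widehat{v}(s)}\,ds\right)^{1/2}<\infty$$ and $$\sup_{0<r<1}\left(\int_0^r\frac{\widehat{v}(s)}{(1-s)^4}\,ds\right)^{1/2}\left(\int_r^1\frac{(1-s)^2}{\widehat{v}(s)}\,ds\right)^{1/2}<\infty.$$ Then both the Hilbert operator $\mathcal{H}$ and the sublinear Hilbert operator $\widetilde{\mathcal{H}}$ are bounded on $\mathcal{D}_v$.
   Context: $\mathbb{D}$ is the open unit disc and $H(\mathbb{D})$ the space of analytic functions on $\mathbb{D}$; $dA=\frac{dx\,dy}{\pi}$. A weight is a function $v:\mathbb{D}\to(0,\infty)$ integrable over $\mathbb{D}$ with respect to $dA$; it is radial if $v(z)=v(|z|)$ for all $z$. For a radial weight $v$ put $\widehat{v}(r)=\int_r^1 v(s)\,ds$. The class $\widehat{\mathcal{D}}$ consists of the radial weights $v$ with $\sup_{0<r<1}\frac{\widehat v(r)}{\widehat v\left(\frac{1+r}{2}\right)}<\infty$. The weighted Dirichlet space $\mathcal{D}_v$ consists of $f\in H(\mathbb{D})$ with $\|f\|_{\mathcal{D}_v}^2=|f(0)|^2+\int_{\mathbb{D}}|f'(z)|^2v(z)\,dA(z)<\infty$. The Hilbert operator is $\mathcal{H}(f)(z)=\int_0^1\frac{f(t)}{1-tz}\,dt$ and the sublinear Hilbert operator is $\widetilde{\mathcal{H}}(f)(z)=\int_0^1\frac{|f(t)|}{1-tz}\,dt$,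 $z\in\mathbb{D}$. Such an operator $T$ is bounded on $\mathcal{D}_v$ if there is $C>0$ with $\|Tf\|_{\mathcal{D}_v}\le C\|f\|_{\mathcal{D}_v}$ for all $f\in\mathcal{D}_v$. *)

theory Defs
  imports "HOL-Analysis.Analysis"
begin

definition area_measure :: "complex measure" where
  "area_measure = density lebesgue (\<lambda>_. ennreal (1 / pi))"

text \<open>Only the values on the open unit disc matter for weights and for analytic functions below.\<close>

definition weight :: "(complex \<Rightarrow> real) \<Rightarrow> bool" where
  "weight v \<longleftrightarrow> (\<forall>z\<in>ball 0 1. v z > 0) \<and> set_integrable area_measure (ball 0 1) v"

definition radial :: "(complex \<Rightarrow> real) \<Rightarrow> bool" where
  "radial v \<longleftrightarrow> (\<forall>z\<in>ball 0 1. v z = v (of_real (norm z)))"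

text \<open>Integrals of nonnegative functions take values in \<open>[0,\<infinity>]\<close>, so that a divergent
  integral is \<open>\<infinity>\<close> and not a default value.\<close>

definition weight_tail :: "(complex \<Rightarrow> real) \<Rightarrow> real \<Rightarrow> ennreal" where
  "weight_tail v r = (\<integral>\<^sup>+s\<in>{r<..<1}. ennreal (v (of_real s)) \<partial>lebesgue)"

definition doubling_weights :: "(complex \<Rightarrow> real) set" where
  "doubling_weights = {v. weight v \<and> radial v \<and>
     (SUP r\<in>{0<..<1}. weight_tail v r / weight_tail v ((1 + r) / 2)) < \<infinity>}"

definition ennreal_sqrt :: "ennreal \<Rightarrow> ennreal" where
  "ennreal_sqrt x = (if x = \<infinity> then \<infinity> else ennreal (sqrt (enn2real x)))"

definition dirichlet_norm_sq :: "(complex \<Rightarrow> real) \<Rightarrow> (complex \<Rightarrow> complex) \<Rightarrow> ennreal" where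
  "dirichlet_norm_sq v f = ennreal ((norm (f 0))\<^sup>2) +
     (\<integral>\<^sup>+z\<in>ball 0 1. ennreal ((norm (deriv f z))\<^sup>2 * v z) \<partial>area_measure)"

definition dirichlet_space :: "(complex \<Rightarrow> real) \<Rightarrow> (complex \<Rightarrow> complex) set" where
  "dirichlet_space v = {f. f holomorphic_on ball 0 1 \<and> dirichlet_norm_sq v f < \<infinity>}"

definition dirichlet_norm :: "(complex \<Rightarrow> real) \<Rightarrow> (complex \<Rightarrow> complex) \<Rightarrow> real" where
  "dirichlet_norm v f = sqrt (enn2real (dirichlet_norm_sq v f))"

definition hilbert_op :: "(complex \<Rightarrow> complex) \<Rightarrow> complex \<Rightarrow> complex" where
  "hilbert_op f z = (LBINT t:{0..<1}. f (of_real t) / (1 - of_real t * z))"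

definition sublinear_hilbert_op :: "(complex \<Rightarrow> complex) \<Rightarrow> complex \<Rightarrow> complex" where
  "sublinear_hilbert_op f z =
     (LBINT t:{0..<1}. of_real (norm (f (of_real t))) / (1 - of_real t * z))"

text \<open>A non-integrable function has Bochner integral \<open>0\<close>; the next two predicates say that the
  integrals defining the operators converge.\<close>

definition hilbert_op_defined :: "(complex \<Rightarrow> complex) \<Rightarrow> bool" where
  "hilbert_op_defined f \<longleftrightarrow> (\<forall>z\<in>ball 0 1.
     set_integrable lborel {0..<1} (\<lambda>t. f (of_real t) / (1 - of_real t * z)))"

definition sublinear_hilbert_op_defined :: "(complex \<Rightarrow> complex) \<Rightarrow> bool" where
  "sublinear_hilbert_op_defined f \<longleftrightarrow> (\<forall>z\<in>ball 0 1.
     set_integrable lborel {0..<1}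
       (\<lambda>t. complex_of_real (norm (f (of_real t))) / (1 - of_real t * z)))"

definition bounded_on_dirichlet ::
    "(complex \<Rightarrow> real) \<Rightarrow> ((complex \<Rightarrow> complex) \<Rightarrow> complex \<Rightarrow> complex) \<Rightarrow> bool" where
  "bounded_on_dirichlet v T \<longleftrightarrow> (\<exists>C>0. \<forall>f\<in>dirichlet_space v.
     T f \<in> dirichlet_space v \<and> dirichlet_norm v (T f) \<le> C * dirichlet_norm v f)"

end

theory Submission
  imports Defs "HOL-Complex_Analysis.Complex_Analysis"
begin

text \<open>Write \<open>w\<close> for the radial profile of \<open>v\<close>, \<open>W\<close> for its tail integral, \<open>F t = norm (f t)\<close> and
  \<open>T\<close> for either operator applied to \<open>f\<close>. The derivative of \<open>T\<close> at \<open>z\<close> is bounded by the integral of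
  \<open>F t / norm (1 - t z) ^ 2\<close>, so by Cauchy-Schwarz and the Poisson kernel its square mean on the circle
  of radius \<open>r\<close> is at most \<open>(G r) ^ 2\<close>, where \<open>G r\<close> is the integral of \<open>F t * (1 - t r) powr (- 3 / 2)\<close>.
  In turn \<open>G r\<close> is at most the integral of \<open>F\<close> plus the primitive of
  \<open>3 / 2 * (1 - x) powr (- 5 / 2)\<close> times the tail integral of \<open>F\<close>. Three weighted Hardy inequalities,
  whose Muckenhoupt conditions are the two hypotheses and, by doubling, a consequence of the first one,
  reduce the integral of \<open>G ^ 2 * w\<close> successively to those of \<open>F ^ 2 * W / (1 - r) ^ 2\<close> and of
  \<open>norm (f' t) ^ 2 * W\<close> over the radius. The Fejer-Riesz inequality on each circle, integrated against \<open>w\<close>,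
  bounds the latter by the Dirichlet integral of \<open>f\<close>.\<close>

subsection \<open>Polar coordinates and radial weights\<close>

text \<open>The exponent \<open>- 3 / 2\<close> comes from the kernel: on the circle of radius
  \<open>r\<close> the square mean of \<open>1 / norm (1 - t z) ^ 2\<close> is at most
  \<open>(1 - t r) powr (- 3)\<close>. Since \<open>t r\<close> is at most \<open>min t r\<close>,
  the kernel is dominated by a function of \<open>min t r\<close>, and integrating such a function
  against \<open>F\<close> produces a primitive of a tail; hence Hardy inequalities in both
  directions. The obstacle is that the hypotheses speak only of the tail \<open>W\<close>, while the
  norm contains the profile \<open>w\<close>, which is merely measurable and admits no pointwise
  comparison with \<open>W r / (1 - r)\<close>. So \<open>w\<close> enters one Hardy inequality on
  the left, through its tail alone, against the right-hand weight \<open>W s * (1 - s)\<close>. This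
  weight makes the exponents fit: multiplied by the squared kernel derivative, of order
  \<open>(1 - s) powr (- 5)\<close>, it becomes \<open>W s / (1 - s) ^ 4\<close>, the left weight of
  the second condition, whose right weight \<open>W s / (1 - s) ^ 2\<close> is the left weight of
  the first. The terms \<open>f 0\<close> and the plain integral of \<open>F\<close> escape Hardy;
  they are paid for by two weight integrals over the whole radius, finite by the conditions at
  \<open>r = 1/2\<close>.\<close>

lemma lborel_complex_eq: "(lborel :: complex measure) = distr (lborel \<Otimes>\<^sub>M lborel) borel (\<lambda>(x, y). Complex x y)"
proof (rule lborel_eqI)
  have meas: "(\<lambda>(x, y). Complex x y) \<in> lborel \<Otimes>\<^sub>M lborel \<rightarrow>\<^sub>M (borel :: complex measure)"
    unfolding Complex_eq by measurable
  fix l u :: complex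
  assume le: "\<And>b. b \<in> Basis \<Longrightarrow> l \<bullet> b \<le> u \<bullet> b"
  have le': "Re l \<le> Re u" "Im l \<le> Im u"
    using le[of 1] le[of \<i>] by (auto simp: Basis_complex_def)
  have pre: "(\<lambda>(x, y). Complex x y) -` box l u \<inter> space (lborel \<Otimes>\<^sub>M lborel)
      = {Re l<..<Re u} \<times> {Im l<..<Im u}"
    by (auto simp: box_def Basis_complex_def space_pair_measure)
  show "emeasure (distr (lborel \<Otimes>\<^sub>M lborel) borel (\<lambda>(x, y). Complex x y)) (box l u)
      = ennreal (\<Prod>b\<in>Basis. (u - l) \<bullet> b)"
    unfolding emeasure_distr[OF meas, of "box l u", simplified] pre
    by (subst lborel.emeasure_pair_measure_Times)
       (use le' in \<open>auto simp: Basis_complex_def ennreal_mult\<close>)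
qed simp

lemma nn_integral_complex:
  fixes h :: "complex \<Rightarrow> ennreal"
  assumes [measurable]: "h \<in> borel_measurable borel"
  shows "(\<integral>\<^sup>+z. h z \<partial>lborel) = (\<integral>\<^sup>+y. \<integral>\<^sup>+x. h (Complex x y) \<partial>lborel \<partial>lborel)"
    and "(\<integral>\<^sup>+z. h z \<partial>lborel) = (\<integral>\<^sup>+x. \<integral>\<^sup>+y. h (Complex x y) \<partial>lborel \<partial>lborel)"
proof -
  have [measurable]: "(\<lambda>(x, y). Complex x y) \<in> borel \<Otimes>\<^sub>M borel \<rightarrow>\<^sub>M (borel :: complex measure)"
    unfolding Complex_eq by measurable
  show 1: "(\<integral>\<^sup>+z. h z \<partial>lborel) = (\<integral>\<^sup>+x. \<integral>\<^sup>+y. h (Complex x y) \<partial>lborel \<partial>lborel)"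
    by (subst lborel_complex_eq)
       (simp add: nn_integral_distr lborel.nn_integral_fst[symmetric] case_prod_beta)
  have "(\<lambda>(x,y). h (Complex x y)) \<in> borel_measurable (lborel \<Otimes>\<^sub>M lborel)" by measurable
  from lborel_pair.Fubini'[OF this] 1
  show "(\<integral>\<^sup>+z. h z \<partial>lborel) = (\<integral>\<^sup>+y. \<integral>\<^sup>+x. h (Complex x y) \<partial>lborel \<partial>lborel)"
    by simp
qed

lemma nn_integral_real_shift:
  fixes f :: "real \<Rightarrow> ennreal"
  assumes "f \<in> borel_measurable borel"
  shows "(\<integral>\<^sup>+x. f (x + c) \<partial>lborel) = (\<integral>\<^sup>+x. f x \<partial>lborel)"
  using nn_integral_real_affine[OF assms, of 1 c] by (simp add: add.commute)

text \<open>With the moved coordinate as the inner variable of the iterated integral, a shear is a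
  translation by a constant.\<close>

lemma nn_integral_shear:
  fixes h :: "complex \<Rightarrow> ennreal"
  assumes [measurable]: "h \<in> borel_measurable borel"
  shows "(\<integral>\<^sup>+z. h (z + of_real (a * Im z)) \<partial>lborel) = (\<integral>\<^sup>+z. h z \<partial>lborel)"
    and "(\<integral>\<^sup>+z. h (z + \<i> * of_real (a * Re z)) \<partial>lborel) = (\<integral>\<^sup>+z. h z \<partial>lborel)"
proof -
  have [measurable]: "(\<lambda>x. Complex x y) \<in> borel \<rightarrow>\<^sub>M borel" "(\<lambda>y. Complex x y) \<in> borel \<rightarrow>\<^sub>M borel" for x y
    unfolding Complex_eq by measurable
  have "(\<integral>\<^sup>+z. h (z + of_real (a * Im z)) \<partial>lborel)
      = (\<integral>\<^sup>+y. \<integral>\<^sup>+x. h (Complex (x + a * y) y) \<partial>lborel \<partial>lborel)"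
    by (subst nn_integral_complex(1)) (auto intro!: nn_integral_cong arg_cong[of _ _ h] simp: complex_eq_iff)
  also have "\<dots> = (\<integral>\<^sup>+z. h z \<partial>lborel)"
    by (simp add: nn_integral_complex(1) nn_integral_real_shift[where f = "\<lambda>x. h (Complex x _)"])
  finally show "(\<integral>\<^sup>+z. h (z + of_real (a * Im z)) \<partial>lborel) = (\<integral>\<^sup>+z. h z \<partial>lborel)" .
  have "(\<integral>\<^sup>+z. h (z + \<i> * of_real (a * Re z)) \<partial>lborel)
      = (\<integral>\<^sup>+x. \<integral>\<^sup>+y. h (Complex x (y + a * x)) \<partial>lborel \<partial>lborel)"
    by (subst nn_integral_complex(2)) (auto intro!: nn_integral_cong arg_cong[of _ _ h] simp: complex_eq_iff)
  also have "\<dots> = (\<integral>\<^sup>+z. h z \<partial>lborel)"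
    by (simp add: nn_integral_complex(2) nn_integral_real_shift[where f = "\<lambda>y. h (Complex _ y)"])
  finally show "(\<integral>\<^sup>+z. h (z + \<i> * of_real (a * Re z)) \<partial>lborel) = (\<integral>\<^sup>+z. h z \<partial>lborel)" .
qed

lemma nn_integral_rotate:
  fixes h :: "complex \<Rightarrow> ennreal"
  assumes h[measurable]: "h \<in> borel_measurable borel" and u: "norm u = 1"
  shows "(\<integral>\<^sup>+z. h (u * z) \<partial>lborel) = (\<integral>\<^sup>+z. h z \<partial>lborel)"
proof -
  have *: "(\<integral>\<^sup>+z. k (u * z) \<partial>lborel) = (\<integral>\<^sup>+z. k z \<partial>lborel)"
    if k[measurable]: "k \<in> borel_measurable borel" and u: "norm u = 1" "u \<noteq> -1" for u and k :: "complex \<Rightarrow> ennreal"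
  proof -
    define c s where "c = Re u" and "s = Im u"
    have cs: "c\<^sup>2 + s\<^sup>2 = 1"
      using u unfolding c_def s_def cmod_def by simp
    have c: "1 + c \<noteq> 0"
    proof
      assume "1 + c = 0"
      then have "c = -1" by simp
      with cs have "s = 0" by simp
      with \<open>c = -1\<close> u show False by (auto simp: c_def s_def complex_eq_iff)
    qed
    \<comment> \<open>A rotation is a product of three shears.\<close>
    define \<tau> where "\<tau> = - s / (1 + c)"
    have t1: "1 + \<tau> * s = c"
      using c cs by (simp add: \<tau>_def field_simps power2_eq_square)
    have t2: "\<tau> * (1 + c) = - s" using c by (simp add: \<tau>_def)
    define A where "A = (\<lambda>z. z + complex_of_real (\<tau> * Im z))"
    define B where "B = (\<lambda>z. z + \<i> * complex_of_real (s * Re z))"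
    have [measurable]: "A \<in> borel \<rightarrow>\<^sub>M borel" "B \<in> borel \<rightarrow>\<^sub>M borel"
      unfolding A_def B_def by measurable
    have ABA: "A (B (A z)) = u * z" for z
    proof (rule complex_eqI)
      have "Re (A (B (A z))) = (1 + \<tau> * s) * Re z + (\<tau> * (1 + (1 + \<tau> * s))) * Im z"
        by (simp add: A_def B_def algebra_simps)
      also have "\<dots> = Re (u * z)"
        unfolding t1 t2 by (simp add: c_def s_def)
      finally show "Re (A (B (A z))) = Re (u * z)" .
      have "Im (A (B (A z))) = s * Re z + (1 + \<tau> * s) * Im z"
        by (simp add: A_def B_def algebra_simps)
      also have "\<dots> = Im (u * z)"
        unfolding t1 by (simp add: c_def s_def)
      finally show "Im (A (B (A z))) = Im (u * z)" .
    qed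
    have shearA: "(\<integral>\<^sup>+z. g (A z) \<partial>lborel) = (\<integral>\<^sup>+z. g z \<partial>lborel)"
      and shearB: "(\<integral>\<^sup>+z. g (B z) \<partial>lborel) = (\<integral>\<^sup>+z. g z \<partial>lborel)"
      if "g \<in> borel_measurable borel" for g :: "complex \<Rightarrow> ennreal"
      using nn_integral_shear[OF that] by (simp_all only: A_def B_def)
    have "(\<integral>\<^sup>+z. k (u * z) \<partial>lborel) = (\<integral>\<^sup>+z. k (A (B (A z))) \<partial>lborel)"
      by (simp add: ABA)
    also have "\<dots> = (\<integral>\<^sup>+z. k (A (B z)) \<partial>lborel)"
      by (rule shearA) measurable
    also have "\<dots> = (\<integral>\<^sup>+z. k (A z) \<partial>lborel)"
      by (rule shearB) measurable
    also have "\<dots> = (\<integral>\<^sup>+z. k z \<partial>lborel)"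
      by (rule shearA) measurable
    finally show ?thesis .
  qed
  show ?thesis
  proof (cases "u = -1")
    \<comment> \<open>The outer shear coefficient \<open>- s / (1 + c)\<close> is minus the tangent
      of half the angle of rotation, which is infinite for a half turn. The half turn is therefore
      taken as two quarter turns.\<close>
    case True
    have "\<i> \<noteq> -1" by (simp add: complex_eq_iff)
    have "(\<integral>\<^sup>+z. h (u * z) \<partial>lborel) = (\<integral>\<^sup>+z. h (\<i> * (\<i> * z)) \<partial>lborel)"
      using True by (simp flip: mult.assoc)
    also have "\<dots> = (\<integral>\<^sup>+z. h (\<i> * z) \<partial>lborel)"
      by (rule *[of "\<lambda>z. h (\<i> * z)"]) (use \<open>\<i> \<noteq> -1\<close> in auto)
    also have "\<dots> = (\<integral>\<^sup>+z. h z \<partial>lborel)"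
      by (rule *) (use \<open>\<i> \<noteq> -1\<close> in auto)
    finally show ?thesis .
  next
    case False
    then show ?thesis using * h u by blast
  qed
qed

text \<open>Half-lines \<open>{..a}\<close> form an intersection-stable generator, and both sides
  give such a half-line the area of the disc of radius \<open>a\<close>, whose derivative in
  \<open>a\<close> is the circumference. For negative \<open>r\<close> the density is 0 because
  \<open>ennreal\<close> truncates.\<close>

lemma distr_norm_lborel_complex:
  "distr lborel borel (norm :: complex \<Rightarrow> real) = density lborel (\<lambda>r. ennreal (2 * pi * r))"
proof (rule measure_eqI_generator_eq[where E = "range atMost" and \<Omega> = UNIV and A = "\<lambda>n. {..real n}"])
  show "Int_stable (range (atMost :: real \<Rightarrow> real set))"
    by (auto simp: Int_stable_def)
  show "emeasure (distr lborel borel (norm :: complex \<Rightarrow> real)) X =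
         emeasure (density lborel (\<lambda>r. ennreal (2 * pi * r))) X" if "X \<in> range atMost" for X
  proof -
    from that obtain a where X: "X = {..a}" by auto
    have eq: "emeasure (distr lborel borel (norm :: complex \<Rightarrow> real)) X = emeasure lborel (cball (0::complex) a)"
      unfolding X by (subst emeasure_distr) (auto intro!: arg_cong2[where f=emeasure] simp: cball_def)
    have dens: "emeasure (density lborel (\<lambda>r. ennreal (2 * pi * r))) X = (\<integral>\<^sup>+r. ennreal (2 * pi * r) * indicator {..a} r \<partial>lborel)"
      unfolding X by (subst emeasure_density) auto
    show ?thesis
    proof (cases "a \<ge> 0")
      case True
      have "(\<integral>\<^sup>+r. ennreal (2 * pi * r) * indicator {..a} r \<partial>lborel)
          = (\<integral>\<^sup>+r. ennreal (2 * pi * r) * indicator {0..a} r \<partial>lborel)"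
        by (intro nn_integral_cong) (auto simp: indicator_def ennreal_neg mult_nonneg_nonpos)
      also have "\<dots> = ennreal (pi * a^2 - pi * 0^2)"
        by (rule nn_integral_FTC_Icc) (use True in \<open>auto intro!: derivative_eq_intros\<close>)
      finally have "(\<integral>\<^sup>+r. ennreal (2 * pi * r) * indicator {..a} r \<partial>lborel) = ennreal (pi * a^2)"
        by simp
      with True show ?thesis
        unfolding eq dens by (simp add: emeasure_cball unit_ball_vol_2)
    next
      case False
      have "(\<integral>\<^sup>+r. ennreal (2 * pi * r) * indicator {..a} r \<partial>lborel) = (\<integral>\<^sup>+r. 0 \<partial>(lborel :: real measure))"
        using False by (intro nn_integral_cong) (auto simp: indicator_def ennreal_neg mult_nonneg_nonpos)
      with False show ?thesis unfolding eq dens by simp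
    qed
  qed
  show "emeasure (distr lborel borel (norm :: complex \<Rightarrow> real)) {..real i} \<noteq> \<infinity>" for i
  proof -
    have "emeasure (distr lborel borel (norm :: complex \<Rightarrow> real)) {..real i} = emeasure lborel (cball (0::complex) i)"
      by (subst emeasure_distr) (auto intro!: arg_cong2[where f=emeasure] simp: cball_def)
    then show ?thesis by (simp add: emeasure_cball)
  qed
  show "(\<Union>i. {..real i}) = UNIV"
    by (auto intro: real_arch_simple)
  show "sets (distr lborel borel (norm :: complex \<Rightarrow> real)) = sigma_sets UNIV (range atMost)"
    "sets (density lborel (\<lambda>r. ennreal (2 * pi * r))) = sigma_sets UNIV (range atMost)"
    by (simp_all add: borel_eq_atMost)
qed auto

lemma nn_integral_norm:
  fixes \<phi> :: "real \<Rightarrow> ennreal"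
  assumes [measurable]: "\<phi> \<in> borel_measurable borel"
  shows "(\<integral>\<^sup>+z. \<phi> (norm (z :: complex)) \<partial>lborel) = (\<integral>\<^sup>+r. ennreal (2 * pi * r) * \<phi> r \<partial>lborel)"
proof -
  have "(\<integral>\<^sup>+z. \<phi> (norm (z :: complex)) \<partial>lborel) = (\<integral>\<^sup>+r. \<phi> r \<partial>distr lborel borel (norm :: complex \<Rightarrow> real))"
    by (subst nn_integral_distr) auto
  then show ?thesis
    unfolding distr_norm_lborel_complex by (simp add: nn_integral_density)
qed

lemma nn_integral_periodic_shift:
  fixes p :: "real \<Rightarrow> ennreal"
  assumes [measurable]: "p \<in> borel_measurable borel" and per: "\<And>x. p (x + T) = p x"
    and c: "0 \<le> c" "c \<le> T"
  shows "(\<integral>\<^sup>+x\<in>{0<..<T}. p (x + c) \<partial>lborel) = (\<integral>\<^sup>+x\<in>{0<..<T}. p x \<partial>lborel)"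
proof -
  have "(\<integral>\<^sup>+x\<in>{0<..<T}. p (x + c) \<partial>lborel)
      = (\<integral>\<^sup>+x. (\<lambda>y. p y * indicator {c<..<T + c} y) (x + c) \<partial>lborel)"
    by (intro nn_integral_cong) (auto simp: indicator_def)
  also have "\<dots> = (\<integral>\<^sup>+x. p x * indicator {c<..<T + c} x \<partial>lborel)"
    by (rule nn_integral_real_shift) measurable
  also have "\<dots> = (\<integral>\<^sup>+x. p x * indicator {c<..<T} x + p x * indicator {T<..<T + c} x \<partial>lborel)"
    by (intro nn_integral_cong_AE eventually_mono[OF AE_lborel_singleton[of T]])
       (use c in \<open>auto simp: indicator_def\<close>)
  also have "\<dots> = (\<integral>\<^sup>+x. p x * indicator {c<..<T} x \<partial>lborel) + (\<integral>\<^sup>+x. p x * indicator {T<..<T + c} x \<partial>lborel)"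
    by (rule nn_integral_add) auto
  also have "(\<integral>\<^sup>+x. p x * indicator {T<..<T + c} x \<partial>lborel)
      = (\<integral>\<^sup>+x. p (x + T) * indicator {T<..<T + c} (x + T) \<partial>lborel)"
    by (rule nn_integral_real_shift[symmetric]) measurable
  also have "\<dots> = (\<integral>\<^sup>+x. p x * indicator {0<..<c} x \<partial>lborel)"
    by (intro nn_integral_cong) (auto simp: indicator_def per)
  also have "(\<integral>\<^sup>+x. p x * indicator {c<..<T} x \<partial>lborel) + (\<integral>\<^sup>+x. p x * indicator {0<..<c} x \<partial>lborel)
      = (\<integral>\<^sup>+x. p x * indicator {c<..<T} x + p x * indicator {0<..<c} x \<partial>lborel)"
    by (rule nn_integral_add[symmetric]) auto
  also have "\<dots> = (\<integral>\<^sup>+x\<in>{0<..<T}. p x \<partial>lborel)"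
    by (intro nn_integral_cong_AE eventually_mono[OF AE_lborel_singleton[of c]])
       (use c in \<open>auto simp: indicator_def\<close>)
  finally show ?thesis .
qed

text \<open>Averaging over rotations replaces a change of variables. By rotation invariance the
  integral equals its mean over all rotated copies of \<open>h\<close>; after exchanging the
  integrals, the angular integral depends on \<open>norm z\<close> only, by periodicity, and the
  distribution of the norm finishes the computation.\<close>

lemma nn_integral_polar:
  fixes h :: "complex \<Rightarrow> ennreal"
  assumes [measurable]: "h \<in> borel_measurable borel"
  shows "(\<integral>\<^sup>+z. h z \<partial>lborel)
    = (\<integral>\<^sup>+r. ennreal r * (\<integral>\<^sup>+\<theta>\<in>{0<..<2*pi}. h (of_real r * cis \<theta>) \<partial>lborel) \<partial>lborel)"
proof -
  have [measurable]: "cis \<in> borel_measurable borel"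
    by (intro borel_measurable_continuous_onI continuous_intros)
  define \<Phi> where "\<Phi> = (\<lambda>r. \<integral>\<^sup>+\<theta>\<in>{0<..<2*pi}. h (of_real r * cis \<theta>) \<partial>lborel)"
  have [measurable]: "\<Phi> \<in> borel_measurable borel"
    unfolding \<Phi>_def by measurable
  have \<Phi>: "(\<integral>\<^sup>+\<theta>\<in>{0<..<2*pi}. h (cis \<theta> * z) \<partial>lborel) = \<Phi> (norm z)" for z
  proof -
    obtain c where c: "0 \<le> c" "c < 2 * pi" "z = of_real (norm z) * cis c"
      using Arg2pi[of z] unfolding is_Arg_def cis_conv_exp[symmetric] by blast
    have "(\<integral>\<^sup>+\<theta>\<in>{0<..<2*pi}. h (cis \<theta> * z) \<partial>lborel)
        = (\<integral>\<^sup>+\<theta>\<in>{0<..<2*pi}. h (of_real (norm z) * cis (\<theta> + c)) \<partial>lborel)"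
      by (subst c(3)) (simp add: cis_mult[symmetric] mult_ac)
    also have "\<dots> = \<Phi> (norm z)"
      unfolding \<Phi>_def
      by (rule nn_integral_periodic_shift[where p = "\<lambda>\<theta>. h (of_real (norm z) * cis \<theta>)"])
         (use c in \<open>auto simp: cis_mult[symmetric]\<close>)
    finally show ?thesis .
  qed
  have "ennreal (2 * pi) * (\<integral>\<^sup>+z. h z \<partial>lborel) = (\<integral>\<^sup>+\<theta>\<in>{0<..<2*pi}. (\<integral>\<^sup>+z. h z \<partial>lborel) \<partial>lborel)"
    by (simp add: nn_integral_cmult_indicator mult.commute)
  also have "\<dots> = (\<integral>\<^sup>+\<theta>\<in>{0<..<2*pi}. (\<integral>\<^sup>+z. h (cis \<theta> * z) \<partial>lborel) \<partial>lborel)"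
    by (simp add: nn_integral_rotate)
  also have "\<dots> = (\<integral>\<^sup>+\<theta>. (\<integral>\<^sup>+z. h (cis \<theta> * z) * indicator {0<..<2*pi} \<theta> \<partial>lborel) \<partial>lborel)"
    by (simp add: nn_integral_multc)
  also have "\<dots> = (\<integral>\<^sup>+z. (\<integral>\<^sup>+\<theta>. h (cis \<theta> * z) * indicator {0<..<2*pi} \<theta> \<partial>lborel) \<partial>lborel)"
    by (rule lborel_pair.Fubini') measurable
  also have "\<dots> = (\<integral>\<^sup>+z. \<Phi> (norm (z::complex)) \<partial>lborel)"
    using \<Phi> by simp
  also have "\<dots> = (\<integral>\<^sup>+r. ennreal (2 * pi * r) * \<Phi> r \<partial>lborel)"
    by (rule nn_integral_norm) measurable
  also have "\<dots> = (\<integral>\<^sup>+r. ennreal (2 * pi) * (ennreal r * \<Phi> r) \<partial>lborel)"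
    by (intro nn_integral_cong) (simp add: ennreal_mult' mult.assoc)
  also have "\<dots> = ennreal (2 * pi) * (\<integral>\<^sup>+r. ennreal r * \<Phi> r \<partial>lborel)"
    by (rule nn_integral_cmult) measurable
  finally show ?thesis
    unfolding \<Phi>_def by (simp add: ennreal_mult_cancel_left)
qed

text \<open>A null set of radii pulls back to a null set in the plane, because the distribution of
  the norm has a density.\<close>

lemma AE_norm_complex:
  assumes "AE r in lborel. 0 < r \<longrightarrow> P r"
  shows "AE z in lborel. z \<noteq> (0::complex) \<longrightarrow> P (norm z)"
proof -
  from AE_E[OF assms] obtain N where N: "{r. \<not> (0 < r \<longrightarrow> P r)} \<subseteq> N" "emeasure lborel N = 0" "N \<in> sets borel"
    by auto
  have [measurable]: "N \<in> sets borel" by fact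
  have "AE r in lborel. r \<notin> N"
    using N by (auto intro!: AE_not_in null_setsI)
  then have "(\<integral>\<^sup>+r. ennreal (2 * pi * r) * indicator N r \<partial>lborel) = (\<integral>\<^sup>+r. 0 \<partial>(lborel :: real measure))"
    by (intro nn_integral_cong_AE) (auto simp: indicator_def)
  then have "(\<integral>\<^sup>+z. indicator N (norm (z :: complex)) \<partial>lborel) = 0"
    by (simp add: nn_integral_norm)
  then have "AE z in lborel. indicator N (norm (z :: complex)) = (0 :: ennreal)"
    by (subst (asm) nn_integral_0_iff_AE) auto
  then show ?thesis
  proof eventually_elim
    case (elim z)
    then have "norm z \<notin> N" by (auto simp: indicator_def split: if_splits)
    with N(1) have "0 < norm z \<longrightarrow> P (norm z)" by blast
    then show ?case by simp
  qed
qed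

text \<open>By polar coordinates and Tonelli, a planar null set meets almost every ray in a null set
  of radii; an interval of angles is not null, so at least one good ray exists. The restriction to
  \<open>0 < r\<close> is where the Jacobian \<open>r\<close> does not vanish.\<close>

lemma AE_polar:
  assumes "AE z in lborel. P (z :: complex)"
  obtains \<theta> where "AE r in lborel. 0 < r \<longrightarrow> P (of_real r * cis \<theta>)"
proof -
  have [measurable]: "cis \<in> borel_measurable borel"
    by (intro borel_measurable_continuous_onI continuous_intros)
  from AE_E[OF assms] obtain N where N: "{r. \<not> P r} \<subseteq> N" "emeasure lborel N = 0" "N \<in> sets borel"
    by auto
  have [measurable]: "N \<in> sets borel" by fact
  define Z where "Z = (\<lambda>\<theta>. \<integral>\<^sup>+r. ennreal r * (indicator N (of_real r * cis \<theta>) * indicator {0<..<2*pi} \<theta>) \<partial>lborel)"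
  have "0 = (\<integral>\<^sup>+z. indicator N z \<partial>lborel)"
    using N by simp
  also have "\<dots> = (\<integral>\<^sup>+r. ennreal r * (\<integral>\<^sup>+\<theta>\<in>{0<..<2*pi}. indicator N (of_real r * cis \<theta>) \<partial>lborel) \<partial>lborel)"
    by (rule nn_integral_polar) measurable
  also have "\<dots> = (\<integral>\<^sup>+r. (\<integral>\<^sup>+\<theta>. ennreal r * (indicator N (of_real r * cis \<theta>) * indicator {0<..<2*pi} \<theta>) \<partial>lborel) \<partial>lborel)"
    by (simp add: nn_integral_cmult)
  also have "\<dots> = (\<integral>\<^sup>+\<theta>. (\<integral>\<^sup>+r. ennreal r * (indicator N (of_real r * cis \<theta>) * indicator {0<..<2*pi} \<theta>) \<partial>lborel) \<partial>lborel)"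
    by (rule lborel_pair.Fubini') measurable
  finally have "(\<integral>\<^sup>+\<theta>. Z \<theta> \<partial>lborel) = 0"
    unfolding Z_def by (rule sym)
  moreover have "Z \<in> borel_measurable lborel"
    unfolding Z_def by measurable
  ultimately have ae: "AE \<theta> in lborel. Z \<theta> = 0"
    using nn_integral_0_iff_AE by blast
  have "\<exists>\<theta>\<in>{0<..<2*pi}. Z \<theta> = 0"
  proof (rule ccontr)
    assume "\<not> ?thesis"
    with ae have "AE \<theta> in lborel. \<theta> \<notin> {0<..<2*pi}"
      by (metis (mono_tags, lifting) eventually_mono)
    then have "{0<..<2*pi} \<in> null_sets lborel"
      by (subst AE_iff_null_sets) auto
    then show False by (simp add: null_sets_def)
  qed
  then obtain \<theta> where \<theta>: "\<theta> \<in> {0<..<2*pi}" "Z \<theta> = 0"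
    by blast
  from \<theta>(2) have "AE r in lborel. ennreal r * (indicator N (of_real r * cis \<theta>) * indicator {0<..<2*pi} \<theta>) = 0"
    unfolding Z_def by (subst (asm) nn_integral_0_iff_AE) auto
  then have "AE r in lborel. 0 < r \<longrightarrow> P (of_real r * cis \<theta>)"
  proof eventually_elim
    case (elim r)
    show ?case
    proof
      assume "0 < r"
      with elim \<theta>(1) have "of_real r * cis \<theta> \<notin> N"
        by (auto simp: indicator_def split: if_splits)
      with N(1) show "P (of_real r * cis \<theta>)" by blast
    qed
  qed
  then show ?thesis by (rule that)
qed

text \<open>Measurability of a planar set says nothing about a single ray, but for radial functions
  almost every ray carries a Borel version of the profile.\<close>

lemma radial_weight_profile:
  assumes "weight v" "radial v"
  obtains w :: "real \<Rightarrow> real" where "w \<in> borel_measurable borel"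
    "\<And>r. 0 \<le> w r"
    "AE r in lborel. 0 < r \<and> r < 1 \<longrightarrow> w r > 0 \<and> v (of_real r) = w r"
    "AE z in lborel. z \<in> ball 0 1 \<longrightarrow> v z = w (norm z)"
proof -
  have pos: "v z > 0" if "norm z < 1" for z
    using assms(1) that by (auto simp: weight_def)
  have rad: "v z = v (of_real (norm z))" if "norm z < 1" for z
    by (rule bspec[OF assms(2)[unfolded radial_def]]) (use that in simp)
  have "set_integrable area_measure (ball 0 1) v"
    using assms(1) by (auto simp: weight_def)
  then have "(\<lambda>z. indicator (ball 0 1) z *\<^sub>R v z) \<in> borel_measurable area_measure"
    unfolding set_integrable_def by (rule borel_measurable_integrable)
  then have "(\<lambda>z. indicator (ball 0 1) z *\<^sub>R v z) \<in> borel_measurable lebesgue"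
    unfolding area_measure_def by simp
  from completion_ex_borel_measurable_real[OF this]
  obtain v0 where v0[measurable]: "v0 \<in> borel_measurable borel"
    and ae: "AE z in lborel. indicator (ball 0 1) z *\<^sub>R v z = v0 z"
    by auto
  obtain \<theta> where \<theta>: "AE r in lborel. 0 < r \<longrightarrow>
      indicator (ball 0 1) (of_real r * cis \<theta>) *\<^sub>R v (of_real r * cis \<theta>) = v0 (of_real r * cis \<theta>)"
    by (rule AE_polar[OF ae])
  \<comment> \<open>The Borel representative \<open>v0\<close> read along the good ray. Radiality
    makes it agree with \<open>v\<close> almost everywhere on the positive axis; the cut-off and
    \<open>max 0\<close> give nonnegativity at every point and not just almost everywhere.\<close>
  define w where "w = (\<lambda>r. indicator {0<..<1} r * max 0 (v0 (of_real r * cis \<theta>)))"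
  have ae_w: "AE r in lborel. 0 < r \<and> r < 1 \<longrightarrow> w r > 0 \<and> v (of_real r) = w r"
    using \<theta>
  proof eventually_elim
    case (elim r)
    show ?case
    proof
      assume r: "0 < r \<and> r < 1"
      then have nr: "norm (of_real r * cis \<theta>) = r" by (simp add: norm_mult)
      have "v (of_real r * cis \<theta>) = v (of_real r)"
        using rad[of "of_real r * cis \<theta>"] r by (simp only: nr)
      with r elim nr have "v0 (of_real r * cis \<theta>) = v (of_real r)"
        by (simp add: indicator_def)
      with r pos[of "of_real r"] show "w r > 0 \<and> v (of_real r) = w r"
        by (simp add: w_def)
    qed
  qed
  have "AE z in lborel. z \<noteq> (0::complex) \<longrightarrow> norm z < 1 \<longrightarrow> v (of_real (norm z)) = w (norm z)"
    by (rule AE_norm_complex[where P = "\<lambda>r. r < 1 \<longrightarrow> v (of_real r) = w r"]) (use ae_w in \<open>auto elim!: eventually_mono\<close>)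
  with AE_lborel_singleton[of 0]
  have ae_v: "AE z in lborel. z \<in> ball 0 1 \<longrightarrow> v z = w (norm z)"
  proof eventually_elim
    case (elim z)
    show ?case
    proof
      assume "z \<in> ball 0 1"
      then have "norm z < 1" by simp
      with elim show "v z = w (norm z)" by (simp only: rad[of z]) simp
    qed
  qed
  show ?thesis
    by (rule that[OF _ _ ae_w ae_v]) (auto simp: w_def)
qed

subsection \<open>Weighted Hardy inequalities\<close>

text \<open>Lets the measurability prover accept indicators of intervals whose end points depend on
  another integration variable, which occur in every exchange of integrals over a triangle.\<close>

lemma pred_Ioo [measurable]:
  fixes f g h :: "'a \<Rightarrow> real"
  assumes [measurable]: "f \<in> borel_measurable M" "g \<in> borel_measurable M" "h \<in> borel_measurable M"
  shows "Measurable.pred M (\<lambda>x. f x \<in> {g x<..<h x})"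
  unfolding greaterThanLessThan_iff by measurable

text \<open>Integrate the arithmetic-geometric inequality \<open>2 * f x * f y \<le> (f x)^2 * c x /
  c y + (f y)^2 * c y / c x\<close> over both variables. The right-hand side separates, so neither
  finiteness nor an exchange of integrals is involved, and infinite values are allowed
  throughout.\<close>

lemma nn_integral_Cauchy_Schwarz:
  fixes f c :: "'a \<Rightarrow> real"
  assumes [measurable]: "f \<in> borel_measurable M" "c \<in> borel_measurable M" "S \<in> sets M"
    and f: "\<And>x. x \<in> S \<Longrightarrow> 0 \<le> f x" and c: "\<And>x. x \<in> S \<Longrightarrow> 0 < c x"
  shows "(\<integral>\<^sup>+x\<in>S. ennreal (f x) \<partial>M)\<^sup>2
    \<le> (\<integral>\<^sup>+x\<in>S. ennreal ((f x)\<^sup>2 * c x) \<partial>M) * (\<integral>\<^sup>+x\<in>S. ennreal (1 / c x) \<partial>M)"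
proof -
  define g a b where "g = (\<lambda>x. ennreal (f x) * indicator S x)"
    and "a = (\<lambda>x. ennreal ((f x)\<^sup>2 * c x) * indicator S x)"
    and "b = (\<lambda>x. ennreal (1 / c x) * indicator S x)"
  have [measurable]: "g \<in> borel_measurable M" "a \<in> borel_measurable M" "b \<in> borel_measurable M"
    unfolding g_def a_def b_def by measurable
  have pt: "2 * (g x * g y) \<le> a x * b y + a y * b x" for x y
  proof (cases "x \<in> S \<and> y \<in> S")
    case True
    then have pos: "0 \<le> f x" "0 \<le> f y" "0 < c x" "0 < c y"
      using f c by auto
    have "2 * (f x * f y) \<le> (f x)\<^sup>2 * c x * (1 / c y) + (f y)\<^sup>2 * c y * (1 / c x)"
    proof -
      have "0 \<le> (f x * c x - f y * c y)\<^sup>2" by simp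
      then have "2 * (f x * f y) * (c x * c y) \<le> (f x)\<^sup>2 * (c x)\<^sup>2 + (f y)\<^sup>2 * (c y)\<^sup>2"
        by (simp add: power2_eq_square algebra_simps)
      then show ?thesis
        using pos by (simp add: field_simps power2_eq_square)
    qed
    then have "ennreal (2 * (f x * f y)) \<le> ennreal ((f x)\<^sup>2 * c x * (1 / c y) + (f y)\<^sup>2 * c y * (1 / c x))"
      by (rule ennreal_leI)
    also have "\<dots> = ennreal ((f x)\<^sup>2 * c x) * ennreal (1 / c y) + ennreal ((f y)\<^sup>2 * c y) * ennreal (1 / c x)"
      using pos by (simp add: ennreal_plus ennreal_mult'[symmetric] ennreal_mult''[symmetric] del: times_divide_eq_right)
    finally show ?thesis
      using True pos by (simp add: g_def a_def b_def ennreal_mult)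
  next
    case False
    then show ?thesis by (auto simp: g_def a_def b_def)
  qed
  let ?I = "integral\<^sup>N M"
  have "2 * (?I g)\<^sup>2 = (\<integral>\<^sup>+x. \<integral>\<^sup>+y. 2 * (g x * g y) \<partial>M \<partial>M)"
    by (simp add: nn_integral_cmult nn_integral_multc power2_eq_square)
  also have "\<dots> \<le> (\<integral>\<^sup>+x. \<integral>\<^sup>+y. a x * b y + a y * b x \<partial>M \<partial>M)"
    by (intro nn_integral_mono pt)
  also have "\<dots> = 2 * (?I a * ?I b)"
    by (simp add: nn_integral_add nn_integral_cmult nn_integral_multc mult_2 mult.commute)
  finally have "2 * (?I g)\<^sup>2 \<le> 2 * (?I a * ?I b)" .
  then have "(?I g)\<^sup>2 \<le> ?I a * ?I b"
    by (simp add: ennreal_mult_le_mult_iff)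
  then show ?thesis by (simp add: g_def a_def b_def)
qed

lemma nn_integral_le_exhaust:
  fixes f :: "'a \<Rightarrow> ennreal"
  assumes [measurable]: "f \<in> borel_measurable M" "\<And>n. A n \<in> sets M"
    and inc: "incseq A" and le: "\<And>n::nat. (\<integral>\<^sup>+x\<in>A n. f x \<partial>M) \<le> B" and S: "S \<subseteq> (\<Union>n. A n)"
  shows "(\<integral>\<^sup>+x\<in>S. f x \<partial>M) \<le> B"
proof -
  have "(\<integral>\<^sup>+x\<in>S. f x \<partial>M) \<le> (\<integral>\<^sup>+x. (SUP n. f x * indicator (A n) x) \<partial>M)"
  proof (rule nn_integral_mono)
    fix x
    show "f x * indicator S x \<le> (SUP n. f x * indicator (A n) x)"
    proof (cases "x \<in> S")
      case True
      with S obtain n where "x \<in> A n" by auto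
      with True show ?thesis by (auto intro!: SUP_upper2[of n])
    qed simp
  qed
  also have "\<dots> = (SUP n. \<integral>\<^sup>+x. f x * indicator (A n) x \<partial>M)"
  proof (rule nn_integral_monotone_convergence_SUP)
    show "incseq (\<lambda>n x. f x * indicator (A n) x)"
      using inc by (auto simp: incseq_def le_fun_def indicator_def)
  qed auto
  also have "\<dots> \<le> B"
    by (intro SUP_least le)
  finally show ?thesis .
qed

text \<open>Serves integrands known through an antiderivative only inside the open interval: a bound
  uniform in the left end point survives the limit by monotone convergence.\<close>

lemma nn_integral_Ioo_le_left:
  fixes f :: "real \<Rightarrow> ennreal"
  assumes "f \<in> borel_measurable borel"
    and le: "\<And>s. a < s \<Longrightarrow> s < b \<Longrightarrow> (\<integral>\<^sup>+x\<in>{s<..<b}. f x \<partial>lborel) \<le> B"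
  shows "(\<integral>\<^sup>+x\<in>{a<..<b}. f x \<partial>lborel) \<le> B"
proof (cases "a < b")
  case True
  \<comment> \<open>The shift by 2 keeps even the term for \<open>n = 0\<close> strictly below
    \<open>b\<close>; a shift by 1 would put it at \<open>b\<close>.\<close>
  define s where "s = (\<lambda>n::nat. a + (b - a) / (n + 2))"
  have *: "0 < (b - a) / (real n + 2)" "(b - a) / (real n + 2) < (b - a) / 1" for n
    using True by (simp, intro divide_strict_left_mono) auto
  have s: "a < s n" "s n < b" for n
    using *[of n] by (simp_all add: s_def)
  show ?thesis
  proof (rule nn_integral_le_exhaust[where A = "\<lambda>n. {s n<..<b}"])
    have "s n \<le> s m" if "m \<le> n" for m n
      using True that by (auto simp: s_def intro!: divide_left_mono)
    then show "incseq (\<lambda>n. {s n<..<b})"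
      by (intro monoI greaterThanLessThan_subseteq_greaterThanLessThan[THEN iffD2]) auto
    show "{a<..<b} \<subseteq> (\<Union>n. {s n<..<b})"
    proof
      fix x assume x: "x \<in> {a<..<b}"
      obtain n :: nat where "(b - a) / (x - a) < n" using reals_Archimedean2 by blast
      then have "(b - a) / (x - a) < n + 2" by linarith
      with x have "s n < x" by (simp add: s_def field_simps)
      with x show "x \<in> (\<Union>n. {s n<..<b})" by auto
    qed
  qed (use assms s in auto)
qed simp

lemma nn_integral_Ioo_le_right:
  fixes f :: "real \<Rightarrow> ennreal"
  assumes "f \<in> borel_measurable borel"
    and le: "\<And>s. a < s \<Longrightarrow> s < b \<Longrightarrow> (\<integral>\<^sup>+x\<in>{a<..<s}. f x \<partial>lborel) \<le> B"
  shows "(\<integral>\<^sup>+x\<in>{a<..<b}. f x \<partial>lborel) \<le> B"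
proof (cases "a < b")
  case True
  define s where "s = (\<lambda>n::nat. b - (b - a) / (n + 2))"
  have *: "0 < (b - a) / (real n + 2)" "(b - a) / (real n + 2) < (b - a) / 1" for n
    using True by (simp, intro divide_strict_left_mono) auto
  have s: "a < s n" "s n < b" for n
    using *[of n] by (simp_all add: s_def)
  show ?thesis
  proof (rule nn_integral_le_exhaust[where A = "\<lambda>n. {a<..<s n}"])
    have "s m \<le> s n" if "m \<le> n" for m n
      using True that by (auto simp: s_def intro!: divide_left_mono)
    then show "incseq (\<lambda>n. {a<..<s n})"
      by (intro monoI greaterThanLessThan_subseteq_greaterThanLessThan[THEN iffD2]) auto
    show "{a<..<b} \<subseteq> (\<Union>n. {a<..<s n})"
    proof
      fix x assume x: "x \<in> {a<..<b}"
      obtain n :: nat where "(b - a) / (b - x) < n" using reals_Archimedean2 by blast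
      then have "(b - a) / (b - x) < n + 2" by linarith
      with x have "x < s n" by (simp add: s_def field_simps)
      with x show "x \<in> (\<Union>n. {a<..<s n})" by auto
    qed
  qed (use assms s in auto)
qed simp

lemma nn_integral_Ioo_FTC:
  fixes F f :: "real \<Rightarrow> real"
  assumes [measurable]: "f \<in> borel_measurable borel"
    and der: "\<And>x. a \<le> x \<Longrightarrow> x \<le> b \<Longrightarrow> (F has_real_derivative f x) (at x)"
    and nonneg: "\<And>x. a \<le> x \<Longrightarrow> x \<le> b \<Longrightarrow> 0 \<le> f x" and "a \<le> b"
  shows "(\<integral>\<^sup>+x\<in>{a<..<b}. ennreal (f x) \<partial>lborel) = ennreal (F b - F a)"
proof -
  have "(\<integral>\<^sup>+x\<in>{a<..<b}. ennreal (f x) \<partial>lborel) = (\<integral>\<^sup>+x\<in>{a..b}. ennreal (f x) \<partial>lborel)"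
    by (intro nn_integral_cong_AE eventually_mono[OF eventually_conj[OF AE_lborel_singleton[of a] AE_lborel_singleton[of b]]])
       (auto simp: indicator_def)
  also have "\<dots> = ennreal (F b - F a)"
    by (rule nn_integral_FTC_Icc)
       (use assms in \<open>auto simp: has_real_derivative_iff_has_vector_derivative[symmetric]
          intro: has_field_derivative_at_within\<close>)
  finally show ?thesis .
qed

text \<open>The Cauchy-Schwarz step uses the auxiliary weight \<open>sqrt P / p\<close>. Only the antiderivative \<open>P\<close> of
  the reciprocal right-hand weight \<open>p\<close> is differentiated, so \<open>U\<close> may be any Borel function.\<close>

lemma Hardy_Muckenhoupt:
  fixes P p \<psi> :: "real \<Rightarrow> real" and U :: "real \<Rightarrow> ennreal"
  assumes [measurable]: "p \<in> borel_measurable borel" "\<psi> \<in> borel_measurable borel" "U \<in> borel_measurable borel"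
    and \<psi>: "\<And>x. 0 < x \<Longrightarrow> x < 1 \<Longrightarrow> 0 \<le> \<psi> x"
    and P: "\<And>x. 0 < x \<Longrightarrow> x < 1 \<Longrightarrow> 0 < P x"
    and p: "\<And>x. 0 < x \<Longrightarrow> x < 1 \<Longrightarrow> 0 < p x"
    and der: "\<And>x. 0 < x \<Longrightarrow> x < 1 \<Longrightarrow> (P has_real_derivative p x) (at x)"
    and A: "\<And>r. 0 < r \<Longrightarrow> r < 1 \<Longrightarrow> ennreal (P r) * (\<integral>\<^sup>+s\<in>{r<..<1}. U s \<partial>lborel) \<le> ennreal A" "0 \<le> A"
  shows "(\<integral>\<^sup>+r\<in>{0<..<1}. (\<integral>\<^sup>+s\<in>{0<..<r}. ennreal (\<psi> s) \<partial>lborel)\<^sup>2 * U r \<partial>lborel)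
    \<le> ennreal (4 * A) * (\<integral>\<^sup>+s\<in>{0<..<1}. ennreal ((\<psi> s)\<^sup>2 / p s) \<partial>lborel)"
proof -
  \<comment> \<open>\<open>P\<close> is controlled only inside the unit interval; the value 1
    elsewhere makes \<open>Q\<close> positive and Borel on the whole line.\<close>
  define Q where "Q = (\<lambda>x. if x \<in> {0<..<1} then P x else 1)"
  have Qp: "Q x > 0" for x
    using P by (auto simp: Q_def)
  have "continuous_on {0<..<1} P"
    by (intro continuous_at_imp_continuous_on ballI DERIV_isCont[OF der]) auto
  then have [measurable]: "Q \<in> borel_measurable borel"
    unfolding Q_def by (intro borel_measurable_continuous_on_if) auto
  have dQ: "(Q has_real_derivative p x) (at x)" if "0 < x" "x < 1" for x
  proof (rule DERIV_cong_ev[THEN iffD1, OF refl _ refl der[OF that]])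
    have "\<forall>\<^sub>F y in nhds x. y \<in> {0<..<1}"
      using that by (intro eventually_nhds_in_open) auto
    then show "\<forall>\<^sub>F y in nhds x. P y = Q y"
      by eventually_elim (simp add: Q_def)
  qed
  \<comment> \<open>The choice makes \<open>1 / c = 2 * q\<close> with \<open>q\<close> the
    derivative of \<open>sqrt Q\<close>, so the second Cauchy-Schwarz factor is an elementary
    integral.\<close>
  define c q where "c = (\<lambda>x. sqrt (Q x) / p x)" and "q = (\<lambda>x. p x / (2 * sqrt (Q x)))"
  have [measurable]: "c \<in> borel_measurable borel" "q \<in> borel_measurable borel"
    unfolding c_def q_def by measurable
  have cpos: "c x > 0" and qpos: "q x > 0" if "0 < x" "x < 1" for x
    using that p Qp by (auto simp: c_def q_def)
  have dsqrt: "((\<lambda>x. sqrt (Q x)) has_real_derivative q x) (at x)" if "0 < x" "x < 1" for x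
    using dQ[OF that] Qp[of x] by (auto intro!: derivative_eq_intros simp: q_def field_simps)
  have ftc_sqrt: "(\<integral>\<^sup>+x\<in>{s<..<r}. ennreal (q x) \<partial>lborel) = ennreal (sqrt (Q r) - sqrt (Q s))"
    if "0 < s" "s \<le> r" "r < 1" for s r
    by (rule nn_integral_Ioo_FTC) (use that in \<open>auto intro!: dsqrt less_imp_le[OF qpos]\<close>)
  have step1: "(\<integral>\<^sup>+s\<in>{0<..<r}. ennreal (\<psi> s) \<partial>lborel)\<^sup>2
      \<le> (\<integral>\<^sup>+s\<in>{0<..<r}. ennreal ((\<psi> s)\<^sup>2 * c s) \<partial>lborel) * ennreal (2 * sqrt (Q r))" if r: "0 < r" "r < 1" for r
  proof -
    have "(\<integral>\<^sup>+s\<in>{0<..<r}. ennreal (\<psi> s) \<partial>lborel)\<^sup>2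
        \<le> (\<integral>\<^sup>+s\<in>{0<..<r}. ennreal ((\<psi> s)\<^sup>2 * c s) \<partial>lborel) * (\<integral>\<^sup>+s\<in>{0<..<r}. ennreal (1 / c s) \<partial>lborel)"
      by (rule nn_integral_Cauchy_Schwarz) (use r cpos \<psi> in auto)
    also have "(\<integral>\<^sup>+s\<in>{0<..<r}. ennreal (1 / c s) \<partial>lborel) = (\<integral>\<^sup>+s. 2 * (ennreal (q s) * indicator {0<..<r} s) \<partial>lborel)"
    proof (intro nn_integral_cong)
      fix s
      show "ennreal (1 / c s) * indicator {0<..<r} s = 2 * (ennreal (q s) * indicator {0<..<r} s)"
      proof (cases "s \<in> {0<..<r}")
        case True
        have "1 / c s = 2 * q s" by (simp add: c_def q_def)
        with True r qpos[of s] show ?thesis by (simp add: ennreal_mult)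
      qed simp
    qed
    also have "\<dots> = 2 * (\<integral>\<^sup>+s\<in>{0<..<r}. ennreal (q s) \<partial>lborel)"
      by (rule nn_integral_cmult) measurable
    \<comment> \<open>The antiderivative need not extend to 0, so the left end point is approached
      from inside and the term \<open>- sqrt (Q s)\<close> is dropped.\<close>
    also have "(\<integral>\<^sup>+s\<in>{0<..<r}. ennreal (q s) \<partial>lborel) \<le> ennreal (sqrt (Q r))"
    proof (rule nn_integral_Ioo_le_left)
      fix s assume "0 < s" "s < r"
      then have "(\<integral>\<^sup>+x\<in>{s<..<r}. ennreal (q x) \<partial>lborel) = ennreal (sqrt (Q r) - sqrt (Q s))"
        using r by (intro ftc_sqrt) auto
      also have "\<dots> \<le> ennreal (sqrt (Q r))"
        using Qp[of s] by (intro ennreal_leI) simp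
      finally show "(\<integral>\<^sup>+x\<in>{s<..<r}. ennreal (q x) \<partial>lborel) \<le> ennreal (sqrt (Q r))" .
    qed measurable
    finally show ?thesis
      using Qp[of r] by (simp add: ennreal_mult mult_left_mono)
  qed
  have tail: "(\<integral>\<^sup>+s\<in>{r<..<1}. U s \<partial>lborel) \<le> ennreal (A / Q r)" if r: "0 < r" "r < 1" for r
  proof -
    have "(\<integral>\<^sup>+s\<in>{r<..<1}. U s \<partial>lborel) = ennreal (1 / Q r) * (ennreal (Q r) * (\<integral>\<^sup>+s\<in>{r<..<1}. U s \<partial>lborel))"
      using Qp[of r] by (simp add: mult.assoc[symmetric] ennreal_mult[symmetric])
    also have "\<dots> \<le> ennreal (1 / Q r) * ennreal A"
      using A(1)[OF r] r by (intro mult_left_mono) (auto simp: Q_def)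
    also have "\<dots> = ennreal (A / Q r)"
      using Qp[of r] A(2) by (simp add: ennreal_mult[symmetric])
    finally show ?thesis .
  qed
  \<comment> \<open>Integration by parts carried out by Tonelli, so that \<open>U\<close> is never
    differentiated: \<open>sqrt (Q r)\<close> is written as its value at \<open>t\<close> plus the
    integral of \<open>q\<close>, and after the exchange only tails of \<open>U\<close> remain,
    bounded by \<open>A / Q\<close>. As \<open>q * (A / Q)\<close> is the derivative of
    \<open>- A / sqrt Q\<close>, both summands contribute \<open>A / sqrt (Q t)\<close>; with the
    factor 2 from the Cauchy-Schwarz step this gives the 4.\<close>
  have step3: "(\<integral>\<^sup>+r\<in>{t<..<1}. ennreal (2 * sqrt (Q r)) * U r \<partial>lborel) \<le> ennreal (4 * A / sqrt (Q t))"
    if t: "0 < t" "t < 1" for t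
  proof -
    have split: "ennreal (sqrt (Q r)) = ennreal (sqrt (Q t)) + (\<integral>\<^sup>+x\<in>{t<..<r}. ennreal (q x) \<partial>lborel)"
      if "t < r" "r < 1" for r
    proof -
      have "(\<integral>\<^sup>+x\<in>{t<..<r}. ennreal (q x) \<partial>lborel) = ennreal (sqrt (Q r) - sqrt (Q t))"
        using that t by (intro ftc_sqrt) auto
      moreover have "sqrt (Q t) \<le> sqrt (Q r)"
      proof (rule DERIV_nonneg_imp_nondecreasing[where f = "\<lambda>x. sqrt (Q x)"])
        fix x assume "t \<le> x" "x \<le> r"
        with that t have "0 < x" "x < 1" by auto
        then show "\<exists>y. ((\<lambda>x. sqrt (Q x)) has_real_derivative y) (at x) \<and> 0 \<le> y"
          using dsqrt[of x] qpos[of x] by (intro exI[of _ "q x"]) auto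
      qed (use that in auto)
      ultimately show ?thesis
        using Qp[of t] by (simp add: ennreal_plus[symmetric] del: ennreal_plus)
    qed
    have "(\<integral>\<^sup>+r\<in>{t<..<1}. ennreal (sqrt (Q r)) * U r \<partial>lborel)
        = (\<integral>\<^sup>+r. ennreal (sqrt (Q t)) * (U r * indicator {t<..<1} r)
            + (\<integral>\<^sup>+x. (ennreal (q x) * indicator {t<..<1} x) * (U r * indicator {x<..<1} r) \<partial>lborel) \<partial>lborel)"
    proof (intro nn_integral_cong)
      fix r :: real
      show "ennreal (sqrt (Q r)) * U r * indicator {t<..<1} r = ennreal (sqrt (Q t)) * (U r * indicator {t<..<1} r)
            + (\<integral>\<^sup>+x. (ennreal (q x) * indicator {t<..<1} x) * (U r * indicator {x<..<1} r) \<partial>lborel)"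
      proof (cases "t < r \<and> r < 1")
        case True
        then have "(\<integral>\<^sup>+x. (ennreal (q x) * indicator {t<..<1} x) * (U r * indicator {x<..<1} r) \<partial>lborel)
            = (\<integral>\<^sup>+x. (ennreal (q x) * indicator {t<..<r} x) * U r \<partial>lborel)"
          by (intro nn_integral_cong) (auto simp: indicator_def)
        also have "\<dots> = (\<integral>\<^sup>+x\<in>{t<..<r}. ennreal (q x) \<partial>lborel) * U r"
          by (rule nn_integral_multc) measurable
        finally show ?thesis
          using True by (simp add: split distrib_right)
      next
        case False
        then have "(\<integral>\<^sup>+x. (ennreal (q x) * indicator {t<..<1} x) * (U r * indicator {x<..<1} r) \<partial>lborel)
            = (\<integral>\<^sup>+x. 0 \<partial>(lborel :: real measure))"
          by (intro nn_integral_cong) (auto simp: indicator_def)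
        with False show ?thesis by (auto simp: indicator_def)
      qed
    qed
    also have "\<dots> = ennreal (sqrt (Q t)) * (\<integral>\<^sup>+r\<in>{t<..<1}. U r \<partial>lborel)
        + (\<integral>\<^sup>+r. (\<integral>\<^sup>+x. (ennreal (q x) * indicator {t<..<1} x) * (U r * indicator {x<..<1} r) \<partial>lborel) \<partial>lborel)"
      by (simp add: nn_integral_add nn_integral_cmult)
    also have "(\<integral>\<^sup>+r. (\<integral>\<^sup>+x. (ennreal (q x) * indicator {t<..<1} x) * (U r * indicator {x<..<1} r) \<partial>lborel) \<partial>lborel)
        = (\<integral>\<^sup>+x. (\<integral>\<^sup>+r. (ennreal (q x) * indicator {t<..<1} x) * (U r * indicator {x<..<1} r) \<partial>lborel) \<partial>lborel)"
      by (rule lborel_pair.Fubini') measurable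
    also have "\<dots> = (\<integral>\<^sup>+x. (ennreal (q x) * indicator {t<..<1} x) * (\<integral>\<^sup>+r\<in>{x<..<1}. U r \<partial>lborel) \<partial>lborel)"
      by (simp add: nn_integral_cmult)
    also have "\<dots> \<le> (\<integral>\<^sup>+x\<in>{t<..<1}. ennreal (q x * (A / Q x)) \<partial>lborel)"
    proof (intro nn_integral_mono)
      fix x :: real
      show "(ennreal (q x) * indicator {t<..<1} x) * (\<integral>\<^sup>+r\<in>{x<..<1}. U r \<partial>lborel)
        \<le> ennreal (q x * (A / Q x)) * indicator {t<..<1} x"
      proof (cases "x \<in> {t<..<1}")
        case True
        then have "ennreal (q x) * (\<integral>\<^sup>+r\<in>{x<..<1}. U r \<partial>lborel) \<le> ennreal (q x) * ennreal (A / Q x)"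
          using t by (intro mult_left_mono tail) auto
        also have "\<dots> = ennreal (q x * (A / Q x))"
          using True t qpos[of x] Qp[of x] A(2) by (intro ennreal_mult[symmetric]) auto
        finally show ?thesis using True by simp
      qed simp
    qed
    also have "\<dots> \<le> ennreal (A / sqrt (Q t))"
    proof (rule nn_integral_Ioo_le_right)
      fix s assume s: "t < s" "s < 1"
      have "(\<integral>\<^sup>+x\<in>{t<..<s}. ennreal (q x * (A / Q x)) \<partial>lborel) = ennreal (- (A / sqrt (Q s)) - (- (A / sqrt (Q t))))"
      proof (rule nn_integral_Ioo_FTC)
        fix x assume x: "t \<le> x" "x \<le> s"
        show "((\<lambda>x. - (A / sqrt (Q x))) has_real_derivative q x * (A / Q x)) (at x)"
        proof -
          have "((\<lambda>y. - (A / y)) has_real_derivative A / Q x) (at (sqrt (Q x)))"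
            using Qp[of x] by (auto intro!: derivative_eq_intros simp: power2_eq_square[symmetric])
          from DERIV_chain2[OF this dsqrt[of x]] show ?thesis
            using x t s by (simp add: mult.commute)
        qed
        show "0 \<le> q x * (A / Q x)"
          using x t s qpos[of x] Qp[of x] A(2) by simp
      qed (use s in auto)
      also have "\<dots> \<le> ennreal (A / sqrt (Q t))"
        using A(2) Qp[of s] by (intro ennreal_leI) simp
      finally show "(\<integral>\<^sup>+x\<in>{t<..<s}. ennreal (q x * (A / Q x)) \<partial>lborel) \<le> ennreal (A / sqrt (Q t))" .
    qed measurable
    also have "ennreal (sqrt (Q t)) * (\<integral>\<^sup>+r\<in>{t<..<1}. U r \<partial>lborel) \<le> ennreal (sqrt (Q t)) * ennreal (A / Q t)"
      using t by (intro mult_left_mono tail) auto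
    also have "\<dots> = ennreal (A / sqrt (Q t))"
      using Qp[of t] A(2) by (simp add: ennreal_mult[symmetric] field_simps real_div_sqrt)
    finally have *: "(\<integral>\<^sup>+r\<in>{t<..<1}. ennreal (sqrt (Q r)) * U r \<partial>lborel) \<le> ennreal (A / sqrt (Q t)) + ennreal (A / sqrt (Q t))"
      by (simp add: add_mono)
    have "(\<integral>\<^sup>+r\<in>{t<..<1}. ennreal (2 * sqrt (Q r)) * U r \<partial>lborel)
        = 2 * (\<integral>\<^sup>+r\<in>{t<..<1}. ennreal (sqrt (Q r)) * U r \<partial>lborel)"
      using Qp by (subst nn_integral_cmult[symmetric]) (auto simp: ennreal_mult less_imp_le mult.assoc)
    also have "\<dots> \<le> 2 * (ennreal (A / sqrt (Q t)) + ennreal (A / sqrt (Q t)))"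
      by (intro mult_left_mono *) auto
    also have "\<dots> = ennreal (4 * A / sqrt (Q t))"
      using A(2) Qp[of t] by (simp add: ennreal_plus[symmetric] ennreal_mult[symmetric] ennreal_numeral[symmetric] del: ennreal_plus ennreal_numeral)
    finally show ?thesis .
  qed
  \<comment> \<open>After the exchange of the two integrals, the factor
    \<open>4 * A / sqrt (Q s)\<close> from \<open>step3\<close> cancels the
    \<open>sqrt (Q s)\<close> inside \<open>c s\<close> and leaves exactly
    \<open>1 / p s\<close>.\<close>
  have "(\<integral>\<^sup>+r\<in>{0<..<1}. (\<integral>\<^sup>+s\<in>{0<..<r}. ennreal (\<psi> s) \<partial>lborel)\<^sup>2 * U r \<partial>lborel)
      \<le> (\<integral>\<^sup>+r. (\<integral>\<^sup>+s. (ennreal ((\<psi> s)\<^sup>2 * c s) * indicator {0<..<1} s) *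
            (ennreal (2 * sqrt (Q r)) * U r * indicator {s<..<1} r) \<partial>lborel) \<partial>lborel)"
  proof (intro nn_integral_mono)
    fix r :: real
    show "(\<integral>\<^sup>+s\<in>{0<..<r}. ennreal (\<psi> s) \<partial>lborel)\<^sup>2 * U r * indicator {0<..<1} r
      \<le> (\<integral>\<^sup>+s. (ennreal ((\<psi> s)\<^sup>2 * c s) * indicator {0<..<1} s) *
            (ennreal (2 * sqrt (Q r)) * U r * indicator {s<..<1} r) \<partial>lborel)"
    proof (cases "r \<in> {0<..<1}")
      case True
      have "(\<integral>\<^sup>+s\<in>{0<..<r}. ennreal (\<psi> s) \<partial>lborel)\<^sup>2 * U r
          \<le> (\<integral>\<^sup>+s\<in>{0<..<r}. ennreal ((\<psi> s)\<^sup>2 * c s) \<partial>lborel) * ennreal (2 * sqrt (Q r)) * U r"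
        using True by (intro mult_right_mono step1) auto
      also have "\<dots> = (\<integral>\<^sup>+s. (ennreal ((\<psi> s)\<^sup>2 * c s) * indicator {0<..<r} s) * (ennreal (2 * sqrt (Q r)) * U r) \<partial>lborel)"
        by (subst nn_integral_multc) (auto simp: mult.assoc)
      also have "\<dots> = (\<integral>\<^sup>+s. (ennreal ((\<psi> s)\<^sup>2 * c s) * indicator {0<..<1} s) *
            (ennreal (2 * sqrt (Q r)) * U r * indicator {s<..<1} r) \<partial>lborel)"
        using True by (intro nn_integral_cong) (auto simp: indicator_def)
      finally show ?thesis using True by simp
    qed simp
  qed
  also have "\<dots> = (\<integral>\<^sup>+s. (\<integral>\<^sup>+r. (ennreal ((\<psi> s)\<^sup>2 * c s) * indicator {0<..<1} s) *
            (ennreal (2 * sqrt (Q r)) * U r * indicator {s<..<1} r) \<partial>lborel) \<partial>lborel)"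
    by (rule lborel_pair.Fubini') measurable
  also have "\<dots> = (\<integral>\<^sup>+s. (ennreal ((\<psi> s)\<^sup>2 * c s) * indicator {0<..<1} s) *
            (\<integral>\<^sup>+r\<in>{s<..<1}. ennreal (2 * sqrt (Q r)) * U r \<partial>lborel) \<partial>lborel)"
    by (simp add: nn_integral_cmult)
  also have "\<dots> \<le> (\<integral>\<^sup>+s. ennreal (4 * A) * (ennreal ((\<psi> s)\<^sup>2 / p s) * indicator {0<..<1} s) \<partial>lborel)"
  proof (intro nn_integral_mono)
    fix s :: real
    show "(ennreal ((\<psi> s)\<^sup>2 * c s) * indicator {0<..<1} s) *
            (\<integral>\<^sup>+r\<in>{s<..<1}. ennreal (2 * sqrt (Q r)) * U r \<partial>lborel)
      \<le> ennreal (4 * A) * (ennreal ((\<psi> s)\<^sup>2 / p s) * indicator {0<..<1} s)"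
    proof (cases "s \<in> {0<..<1}")
      case True
      then have "ennreal ((\<psi> s)\<^sup>2 * c s) * (\<integral>\<^sup>+r\<in>{s<..<1}. ennreal (2 * sqrt (Q r)) * U r \<partial>lborel)
          \<le> ennreal ((\<psi> s)\<^sup>2 * c s) * ennreal (4 * A / sqrt (Q s))"
        by (intro mult_left_mono step3) auto
      also have "\<dots> = ennreal ((\<psi> s)\<^sup>2 * c s * (4 * A / sqrt (Q s)))"
        using True A(2) Qp[of s] cpos[of s] by (intro ennreal_mult[symmetric]) (auto simp: less_imp_le)
      also have "(\<psi> s)\<^sup>2 * c s * (4 * A / sqrt (Q s)) = 4 * A * ((\<psi> s)\<^sup>2 / p s)"
        using Qp[of s] by (simp add: c_def)
      also have "ennreal \<dots> = ennreal (4 * A) * ennreal ((\<psi> s)\<^sup>2 / p s)"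
        using True A(2) p[of s] by (intro ennreal_mult) auto
      finally show ?thesis using True by simp
    qed simp
  qed
  also have "\<dots> = ennreal (4 * A) * (\<integral>\<^sup>+s\<in>{0<..<1}. ennreal ((\<psi> s)\<^sup>2 / p s) \<partial>lborel)"
    by (rule nn_integral_cmult) measurable
  finally show ?thesis .
qed

lemma nn_integral_reflect:
  fixes f :: "real \<Rightarrow> ennreal"
  assumes "f \<in> borel_measurable borel"
  shows "(\<integral>\<^sup>+x. f (1 - x) \<partial>lborel) = (\<integral>\<^sup>+x. f x \<partial>lborel)"
  using nn_integral_real_affine[OF assms, of "-1" 1] by simp

text \<open>The reflection of the unit interval exchanges primitives with tails and reverses the
  sign of the derivative of \<open>P\<close>.\<close>

lemma Hardy_Muckenhoupt_dual:
  fixes P p \<psi> :: "real \<Rightarrow> real" and U :: "real \<Rightarrow> ennreal"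
  assumes [measurable]: "p \<in> borel_measurable borel" "\<psi> \<in> borel_measurable borel" "U \<in> borel_measurable borel"
    and \<psi>: "\<And>x. 0 < x \<Longrightarrow> x < 1 \<Longrightarrow> 0 \<le> \<psi> x"
    and P: "\<And>x. 0 < x \<Longrightarrow> x < 1 \<Longrightarrow> 0 < P x"
    and p: "\<And>x. 0 < x \<Longrightarrow> x < 1 \<Longrightarrow> 0 < p x"
    and der: "\<And>x. 0 < x \<Longrightarrow> x < 1 \<Longrightarrow> (P has_real_derivative - p x) (at x)"
    and A: "\<And>r. 0 < r \<Longrightarrow> r < 1 \<Longrightarrow> (\<integral>\<^sup>+s\<in>{0<..<r}. U s \<partial>lborel) * ennreal (P r) \<le> ennreal A" "0 \<le> A"
  shows "(\<integral>\<^sup>+r\<in>{0<..<1}. (\<integral>\<^sup>+s\<in>{r<..<1}. ennreal (\<psi> s) \<partial>lborel)\<^sup>2 * U r \<partial>lborel)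
    \<le> ennreal (4 * A) * (\<integral>\<^sup>+s\<in>{0<..<1}. ennreal ((\<psi> s)\<^sup>2 / p s) \<partial>lborel)"
proof -
  have inner: "(\<integral>\<^sup>+s\<in>{1 - r<..<1}. f s \<partial>lborel) = (\<integral>\<^sup>+s\<in>{0<..<r}. f (1 - s) \<partial>lborel)"
    if [measurable]: "f \<in> borel_measurable borel" for r and f :: "real \<Rightarrow> ennreal"
    by (subst nn_integral_reflect[symmetric]) (auto intro!: nn_integral_cong simp: indicator_def)
  have inner': "(\<integral>\<^sup>+s\<in>{0<..<1 - r}. f s \<partial>lborel) = (\<integral>\<^sup>+s\<in>{r<..<1}. f (1 - s) \<partial>lborel)"
    if [measurable]: "f \<in> borel_measurable borel" for r and f :: "real \<Rightarrow> ennreal"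
    by (subst nn_integral_reflect[symmetric]) (auto intro!: nn_integral_cong simp: indicator_def)
  have "(\<integral>\<^sup>+r\<in>{0<..<1}. (\<integral>\<^sup>+s\<in>{r<..<1}. ennreal (\<psi> s) \<partial>lborel)\<^sup>2 * U r \<partial>lborel)
      = (\<integral>\<^sup>+r. (\<integral>\<^sup>+s\<in>{1 - r<..<1}. ennreal (\<psi> s) \<partial>lborel)\<^sup>2 * U (1 - r) * indicator {0<..<1} (1 - r) \<partial>lborel)"
    by (rule nn_integral_reflect[symmetric]) measurable
  also have "\<dots> = (\<integral>\<^sup>+r\<in>{0<..<1}. (\<integral>\<^sup>+s\<in>{0<..<r}. ennreal (\<psi> (1 - s)) \<partial>lborel)\<^sup>2 * U (1 - r) \<partial>lborel)"
    by (intro nn_integral_cong, subst inner) (auto simp: indicator_def)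
  also have "\<dots> \<le> ennreal (4 * A) * (\<integral>\<^sup>+s\<in>{0<..<1}. ennreal ((\<psi> (1 - s))\<^sup>2 / p (1 - s)) \<partial>lborel)"
  proof (rule Hardy_Muckenhoupt[where P = "\<lambda>x. P (1 - x)"])
    fix r :: real assume r: "0 < r" "r < 1"
    show "((\<lambda>x. P (1 - x)) has_real_derivative p (1 - r)) (at r)"
    proof -
      have "((\<lambda>x. 1 - x) has_real_derivative - 1) (at r)"
        by (auto intro!: derivative_eq_intros)
      from DERIV_chain2[OF der[of "1 - r"] this] r show ?thesis by simp
    qed
    have "ennreal (P (1 - r)) * (\<integral>\<^sup>+s\<in>{r<..<1}. U (1 - s) \<partial>lborel) = (\<integral>\<^sup>+s\<in>{0<..<1 - r}. U s \<partial>lborel) * ennreal (P (1 - r))"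
      by (simp add: inner' mult.commute)
    also have "\<dots> \<le> ennreal A" using r by (intro A) auto
    finally show "ennreal (P (1 - r)) * (\<integral>\<^sup>+s\<in>{r<..<1}. U (1 - s) \<partial>lborel) \<le> ennreal A" .
  qed (use \<psi> P p A in auto)
  also have "(\<integral>\<^sup>+s\<in>{0<..<1}. ennreal ((\<psi> (1 - s))\<^sup>2 / p (1 - s)) \<partial>lborel)
      = (\<integral>\<^sup>+s. ennreal ((\<psi> (1 - s))\<^sup>2 / p (1 - s)) * indicator {0<..<1} (1 - s) \<partial>lborel)"
    by (intro nn_integral_cong) (auto simp: indicator_def)
  also have "\<dots> = (\<integral>\<^sup>+s\<in>{0<..<1}. ennreal ((\<psi> s)\<^sup>2 / p s) \<partial>lborel)"
    by (rule nn_integral_reflect) measurable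
  finally show ?thesis .
qed

subsection \<open>The Fejer-Riesz inequality and the Poisson kernel\<close>

lemma nn_integral_Icc_Ioo:
  fixes f :: "real \<Rightarrow> ennreal"
  shows "(\<integral>\<^sup>+x\<in>{a..b}. f x \<partial>lborel) = (\<integral>\<^sup>+x\<in>{a<..<b}. f x \<partial>lborel)"
  by (intro nn_integral_cong_AE eventually_mono[OF eventually_conj[OF AE_lborel_singleton[of a] AE_lborel_singleton[of b]]])
     (auto simp: indicator_def)

lemma nn_integral_Ioo_continuous:
  fixes f :: "real \<Rightarrow> real"
  assumes "continuous_on {a..b} f" "\<And>x. x \<in> {a..b} \<Longrightarrow> 0 \<le> f x"
  shows "(\<integral>\<^sup>+x\<in>{a<..<b}. ennreal (f x) \<partial>lborel) = ennreal (integral {a..b} f)"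
  unfolding nn_integral_Icc_Ioo[symmetric]
  by (intro nn_integral_has_integral_lebesgue' integrable_integral integrable_continuous_real assms)

text \<open>Integrate \<open>g z * cnj (g (cnj z))\<close> over the boundary of a half disc: this
  function equals \<open>norm (g t) ^ 2\<close> on the diameter.\<close>

lemma Fejer_Riesz:
  assumes g: "g holomorphic_on ball 0 1" and \<rho>: "0 < \<rho>" "\<rho> < 1"
  shows "(\<integral>\<^sup>+t\<in>{0<..<\<rho>}. ennreal ((norm (g (of_real t)))\<^sup>2) \<partial>lborel)
    \<le> ennreal (\<rho> / 2) * (\<integral>\<^sup>+\<theta>\<in>{0<..<2*pi}. ennreal ((norm (g (of_real \<rho> * cis \<theta>)))\<^sup>2) \<partial>lborel)"
proof -
  define G where "G = (\<lambda>z. g z * cnj (g (cnj z)))"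
  have "cnj ` ball 0 1 = ball 0 1"
    by (auto simp: image_iff intro!: bexI[of _ "cnj _"])
  then have "(cnj \<circ> g \<circ> cnj) holomorphic_on ball 0 1"
    using g by (intro holomorphic_on_compose_cnj_cnj) auto
  then have G: "G holomorphic_on ball 0 1"
    using g unfolding G_def by (auto intro!: holomorphic_intros simp: o_def)
  have gc: "continuous_on (ball 0 1) g"
    using g by (rule holomorphic_on_imp_continuous_on)
  define q where "q = (\<lambda>\<theta>. (norm (g (of_real \<rho> * cis \<theta>)))\<^sup>2)"
  have qc: "continuous_on UNIV q"
  proof -
    have "continuous_on UNIV (\<lambda>\<theta>. g (of_real \<rho> * cis \<theta>))"
      by (rule continuous_on_compose2[OF gc]) (use \<rho> in \<open>auto intro!: continuous_intros simp: norm_mult\<close>)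
    then show ?thesis unfolding q_def by (intro continuous_intros)
  qed
  have [measurable]: "q \<in> borel_measurable borel"
    using qc by (rule borel_measurable_continuous_onI)
  define C where "C = part_circlepath 0 \<rho> 0 pi"
  define L where "L = linepath (- of_real \<rho>) (of_real \<rho> :: complex)"
  have imgL: "path_image L \<subseteq> ball 0 1"
    unfolding L_def path_image_linepath
    by (rule closed_segment_subset) (use \<rho> in auto)
  have imgC: "path_image C \<subseteq> ball 0 1"
    using path_image_part_circlepath_subset'[of \<rho> 0 0 pi] \<rho> by (force simp: C_def sphere_def)
  have join: "pathfinish L = pathstart C" "pathfinish C = pathstart L"
    by (simp_all add: L_def C_def)
  have vp: "valid_path L" "valid_path C"
    by (simp_all add: L_def C_def)
  have cont: "continuous_on (path_image L) G" "continuous_on (path_image C) G"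
    using holomorphic_on_imp_continuous_on[OF G] imgL imgC by (blast intro: continuous_on_subset)+
  have int: "G contour_integrable_on L" "G contour_integrable_on C"
    using cont by (auto simp: L_def C_def intro: contour_integrable_continuous_linepath
        contour_integrable_continuous_part_circlepath)
  have "(G has_contour_integral 0) (L +++ C)"
    by (rule Cauchy_theorem_convex_simple[OF G])
       (use imgL imgC vp join in \<open>auto simp: path_image_join\<close>)
  then have "contour_integral L G + contour_integral C G = 0"
    using int vp join by (metis contour_integral_join contour_integral_unique)
  then have eq: "norm (contour_integral L G) = norm (contour_integral C G)"
    by (metis add_eq_0_iff norm_minus_cancel)
  have Gt: "G (of_real t) = of_real ((norm (g (of_real t)))\<^sup>2)" for t
    by (simp add: G_def complex_norm_square[symmetric] del: of_real_power)
  have cg: "continuous_on {-\<rho>..\<rho>} (\<lambda>t. (norm (g (of_real t)))\<^sup>2)"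
  proof -
    have "continuous_on {-\<rho>..\<rho>} (\<lambda>t. g (of_real t))"
      by (rule continuous_on_compose2[OF gc]) (use \<rho> in \<open>auto intro!: continuous_intros\<close>)
    then show ?thesis by (intro continuous_intros)
  qed
  have "contour_integral L G = integral {-\<rho>..\<rho>} (\<lambda>t. G (of_real t))"
    unfolding L_def using \<rho> by (subst contour_integral_linepath_Reals_eq) auto
  also have "\<dots> = of_real (integral {-\<rho>..\<rho>} (\<lambda>t. (norm (g (of_real t)))\<^sup>2))"
    unfolding Gt using integral_linear[OF integrable_continuous_real[OF cg] bounded_linear_of_real]
    by (simp add: o_def)
  finally have L: "norm (contour_integral L G) = integral {-\<rho>..\<rho>} (\<lambda>t. (norm (g (of_real t)))\<^sup>2)"
    using cg by (simp add: integral_nonneg integrable_continuous_real)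
  \<comment> \<open>The constant \<open>\<rho> / 2\<close> is the length element
    \<open>\<rho>\<close> of the arc times the 1/2 of the arithmetic-geometric inequality applied to
    the two factors of \<open>G\<close>. Conjugating the point on the arc changes the angle
    \<open>t\<close> into \<open>- t\<close>.\<close>
  have "norm (contour_integral C G) \<le> integral {0..pi} (\<lambda>t. \<rho> / 2 * (q t + q (- t)))"
  proof -
    have CI: "contour_integral C G = integral {0..pi} (\<lambda>t. G (of_real \<rho> * cis t) * of_real \<rho> * \<i> * cis t)"
      unfolding C_def by (subst contour_integral_part_circlepath_eq) auto
    have "(\<lambda>t. G (0 + of_real \<rho> * cis t) * of_real \<rho> * \<i> * cis t) integrable_on {0..pi}"
      using int(2) unfolding C_def by (subst (asm) contour_integrable_part_circlepath_iff) auto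
    then have i: "(\<lambda>t. G (of_real \<rho> * cis t) * of_real \<rho> * \<i> * cis t) integrable_on {0..pi}"
      by simp
    show ?thesis
      unfolding CI
    proof (rule integral_norm_bound_integral[OF i])
      have "continuous_on {0..pi} (\<lambda>t. q (- t))" "continuous_on {0..pi} q"
        by (rule continuous_on_compose2[OF qc] continuous_on_subset[OF qc]; auto intro!: continuous_intros)+
      then show "(\<lambda>t. \<rho> / 2 * (q t + q (- t))) integrable_on {0..pi}"
        by (intro integrable_continuous_real continuous_intros)
      fix t :: real
      let ?a = "norm (g (of_real \<rho> * cis t))" and ?b = "norm (g (of_real \<rho> * cis (- t)))"
      have "norm (G (of_real \<rho> * cis t) * of_real \<rho> * \<i> * cis t) = \<rho> * (?a * ?b)"
        using \<rho> by (simp add: G_def norm_mult cis_cnj)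
      also have "\<dots> \<le> \<rho> * ((?a\<^sup>2 + ?b\<^sup>2) / 2)"
        using sum_squares_bound[of ?a ?b] \<rho> by (intro mult_left_mono) auto
      finally show "norm (G (of_real \<rho> * cis t) * of_real \<rho> * \<i> * cis t) \<le> \<rho> / 2 * (q t + q (- t))"
        by (simp add: q_def)
    qed
  qed
  also note eq[symmetric]
  finally have main: "integral {-\<rho>..\<rho>} (\<lambda>t. (norm (g (of_real t)))\<^sup>2) \<le> integral {0..pi} (\<lambda>t. \<rho> / 2 * (q t + q (- t)))"
    unfolding L by simp
  \<comment> \<open>The contour argument controls the whole diameter, of which only the right half
    is wanted.\<close>
  have "(\<integral>\<^sup>+t\<in>{0<..<\<rho>}. ennreal ((norm (g (of_real t)))\<^sup>2) \<partial>lborel)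
      \<le> (\<integral>\<^sup>+t\<in>{-\<rho><..<\<rho>}. ennreal ((norm (g (of_real t)))\<^sup>2) \<partial>lborel)"
    using \<rho> by (intro nn_set_integral_set_mono) auto
  also have "\<dots> = ennreal (integral {-\<rho>..\<rho>} (\<lambda>t. (norm (g (of_real t)))\<^sup>2))"
    by (rule nn_integral_Ioo_continuous[OF cg]) auto
  also have "\<dots> \<le> ennreal (integral {0..pi} (\<lambda>t. \<rho> / 2 * (q t + q (- t))))"
    by (intro ennreal_leI main)
  also have "\<dots> = (\<integral>\<^sup>+t\<in>{0<..<pi}. ennreal (\<rho> / 2 * (q t + q (- t))) \<partial>lborel)"
  proof (rule nn_integral_Ioo_continuous[symmetric])
    have "continuous_on {0..pi} (\<lambda>t. q (- t))" "continuous_on {0..pi} q"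
      by (rule continuous_on_compose2[OF qc] continuous_on_subset[OF qc]; auto intro!: continuous_intros)+
    then show "continuous_on {0..pi} (\<lambda>t. \<rho> / 2 * (q t + q (- t)))"
      by (intro continuous_intros)
  qed (use \<rho> in \<open>auto simp: q_def\<close>)
  also have "\<dots> = (\<integral>\<^sup>+t. ennreal (\<rho> / 2) * (ennreal (q t) * indicator {0<..<pi} t + ennreal (q (- t)) * indicator {0<..<pi} t) \<partial>lborel)"
    using \<rho> by (intro nn_integral_cong)
      (simp add: indicator_def q_def ennreal_mult[symmetric] ennreal_plus[symmetric] del: ennreal_plus)
  also have "\<dots> = ennreal (\<rho> / 2) * ((\<integral>\<^sup>+t\<in>{0<..<pi}. ennreal (q t) \<partial>lborel) + (\<integral>\<^sup>+t\<in>{0<..<pi}. ennreal (q (- t)) \<partial>lborel))"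
    by (simp add: nn_integral_cmult nn_integral_add)
  \<comment> \<open>The angles \<open>- t\<close> describe the lower half circle; shifted by a full
    turn they fill the range from \<open>pi\<close> to \<open>2 * pi\<close> and complete the upper
    half circle.\<close>
  also have "(\<integral>\<^sup>+t\<in>{0<..<pi}. ennreal (q (- t)) \<partial>lborel)
      = (\<integral>\<^sup>+t. (\<lambda>s. ennreal (q s) * indicator {pi<..<2*pi} s) (2 * pi + (-1) * t) \<partial>lborel)"
  proof (intro nn_integral_cong)
    fix t
    have "cis (2 * pi - t) = cis (- t)"
      by (simp add: complex_eq_iff)
    then have "q (2 * pi - t) = q (- t)" by (simp add: q_def)
    then show "ennreal (q (- t)) * indicator {0<..<pi} t
        = (\<lambda>s. ennreal (q s) * indicator {pi<..<2*pi} s) (2 * pi + (-1) * t)"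
      by (auto simp: indicator_def)
  qed
  also have "\<dots> = (\<integral>\<^sup>+s\<in>{pi<..<2*pi}. ennreal (q s) \<partial>lborel)"
    using nn_integral_real_affine[of "\<lambda>s. ennreal (q s) * indicator {pi<..<2*pi} s" "-1" "2 * pi"] by simp
  also have "(\<integral>\<^sup>+t\<in>{0<..<pi}. ennreal (q t) \<partial>lborel) + (\<integral>\<^sup>+s\<in>{pi<..<2*pi}. ennreal (q s) \<partial>lborel)
      = (\<integral>\<^sup>+t. ennreal (q t) * indicator {0<..<pi} t + ennreal (q t) * indicator {pi<..<2*pi} t \<partial>lborel)"
    by (rule nn_integral_add[symmetric]) auto
  also have "\<dots> \<le> (\<integral>\<^sup>+\<theta>\<in>{0<..<2*pi}. ennreal (q \<theta>) \<partial>lborel)"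
    by (intro nn_integral_mono) (auto simp: indicator_def)
  finally show ?thesis
    unfolding q_def by (simp add: mult_left_mono)
qed

lemma norm_one_minus_le: "1 - a \<le> norm (1 - of_real a * cis \<theta>)" if "0 \<le> a"
  using norm_triangle_ineq2[of 1 "of_real a * cis \<theta>"] that by (simp add: norm_mult)

text \<open>This is the Poisson kernel without its factor \<open>1 - a^2\<close>. Cauchy's formula
  on the unit circle for \<open>1 / (1 - a z)\<close>, evaluated at the point \<open>a\<close>,
  yields it: on the circle \<open>cis t - a\<close> is \<open>cis t\<close> times the conjugate of
  \<open>1 - a * cis t\<close>, so the integrand becomes \<open>\<i>\<close> times the
  kernel.\<close>

lemma nn_integral_Poisson_kernel:
  assumes a: "0 \<le> a" "a < 1"
  shows "(\<integral>\<^sup>+\<theta>\<in>{0<..<2*pi}. ennreal (1 / (norm (1 - of_real a * cis \<theta>))\<^sup>2) \<partial>lborel) = ennreal (2 * pi / (1 - a\<^sup>2))"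
proof -
  have pole: "1 - of_real a * z \<noteq> 0" if "norm z \<le> 1" for z :: complex
  proof
    assume "1 - of_real a * z = 0"
    then have "of_real a * z = 1" by simp
    then have "norm (of_real a * z) = 1" by (simp only: norm_one)
    moreover have "norm (of_real a * z) \<le> a"
      using a that by (simp add: norm_mult mult_left_le)
    ultimately show False using a by simp
  qed
  define f where "f = (\<lambda>z :: complex. 1 / (1 - of_real a * z))"
  have "f holomorphic_on cball 0 1"
    unfolding f_def by (intro holomorphic_intros) (use pole in auto)
  then have "((\<lambda>u. f u / (u - of_real a)) has_contour_integral (2 * of_real pi * \<i> * f (of_real a))) (circlepath 0 1)"
    by (rule Cauchy_integral_circlepath_simple) (use a in auto)
  then have "((\<lambda>t. f (cis t) / (cis t - of_real a) * \<i> * cis t) has_integral (2 * of_real pi * \<i> * f (of_real a))) {0..2*pi}"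
    unfolding circlepath_def by (subst (asm) has_contour_integral_part_circlepath_iff) auto
  then have "((\<lambda>t. Im (f (cis t) / (cis t - of_real a) * \<i> * cis t)) has_integral Im (2 * of_real pi * \<i> * f (of_real a))) {0..2*pi}"
    by (rule has_integral_Im)
  also have "(\<lambda>t. Im (f (cis t) / (cis t - of_real a) * \<i> * cis t)) = (\<lambda>t. 1 / (norm (1 - of_real a * cis t))\<^sup>2)"
  proof
    fix t
    let ?w = "1 - of_real a * cis t"
    have "cis t - of_real a = cis t * cnj ?w"
      by (simp add: cis_cnj algebra_simps cis_mult)
    moreover have "1 / w / (c * w') * \<i> * c = \<i> / (w * w')" if "c \<noteq> 0" for c w w' :: complex
      using that by simp
    ultimately have "f (cis t) / (cis t - of_real a) * \<i> * cis t = \<i> / (?w * cnj ?w)"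
      by (simp only: f_def cis_neq_zero not_False_eq_True)
    also have "\<dots> = \<i> * of_real (1 / (norm ?w)\<^sup>2)"
      by (simp add: complex_norm_square[symmetric] del: complex_cnj_diff)
    also have "Im \<dots> = 1 / (norm ?w)\<^sup>2"
      by (simp only: Im_i_times Re_complex_of_real)
    finally show "Im (f (cis t) / (cis t - of_real a) * \<i> * cis t) = 1 / (norm ?w)\<^sup>2" .
  qed
  also have "f (of_real a) = of_real (1 / (1 - a\<^sup>2))"
    by (simp add: f_def power2_eq_square)
  also have "Im (2 * of_real pi * \<i> * of_real (1 / (1 - a\<^sup>2))) = 2 * pi / (1 - a\<^sup>2)"
    by (simp add: Re_divide_of_real del: of_real_divide of_real_diff of_real_power)
  finally have "((\<lambda>t. 1 / (norm (1 - of_real a * cis t))\<^sup>2) has_integral 2 * pi / (1 - a\<^sup>2)) {0..2*pi}" .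
  from nn_integral_has_integral_lebesgue'[OF _ this] show ?thesis
    by (simp add: nn_integral_Icc_Ioo)
qed

text \<open>Two of the four powers are estimated by the minimum \<open>1 - a\<close> of the norm and
  the other two are integrated as a Poisson kernel; finally \<open>1 - a^2\<close> is replaced by
  the smaller \<open>1 - a\<close>.\<close>

lemma nn_integral_Poisson_kernel_squared_le:
  assumes a: "0 \<le> a" "a < 1"
  shows "(\<integral>\<^sup>+\<theta>\<in>{0<..<2*pi}. ennreal (1 / (norm (1 - of_real a * cis \<theta>)) ^ 4) \<partial>lborel) \<le> ennreal (2 * pi / (1 - a) ^ 3)"
proof -
  have [measurable]: "cis \<in> borel_measurable borel"
    by (intro borel_measurable_continuous_onI continuous_intros)
  have "(\<integral>\<^sup>+\<theta>\<in>{0<..<2*pi}. ennreal (1 / (norm (1 - of_real a * cis \<theta>)) ^ 4) \<partial>lborel)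
    \<le> (\<integral>\<^sup>+\<theta>. ennreal (1 / (1 - a)\<^sup>2) * (ennreal (1 / (norm (1 - of_real a * cis \<theta>))\<^sup>2) * indicator {0<..<2*pi} \<theta>) \<partial>lborel)"
  proof (intro nn_integral_mono)
    fix \<theta>
    let ?n = "norm (1 - of_real a * cis \<theta>)"
    have n: "1 - a \<le> ?n" using a by (intro norm_one_minus_le)
    have "1 / ?n ^ 4 = 1 / ?n\<^sup>2 * (1 / ?n\<^sup>2)" by (simp add: power_add[symmetric])
    also have "\<dots> \<le> 1 / (1 - a)\<^sup>2 * (1 / ?n\<^sup>2)"
      using n a by (intro mult_right_mono divide_left_mono power_mono mult_pos_pos zero_less_power) auto
    finally have "ennreal (1 / ?n ^ 4) \<le> ennreal (1 / (1 - a)\<^sup>2) * ennreal (1 / ?n\<^sup>2)"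
      by (subst ennreal_mult[symmetric]) (auto intro: ennreal_leI)
    then show "ennreal (1 / ?n ^ 4) * indicator {0<..<2*pi} \<theta>
        \<le> ennreal (1 / (1 - a)\<^sup>2) * (ennreal (1 / ?n\<^sup>2) * indicator {0<..<2*pi} \<theta>)"
      by (auto simp: indicator_def)
  qed
  also have "\<dots> = ennreal (1 / (1 - a)\<^sup>2) * ennreal (2 * pi / (1 - a\<^sup>2))"
    by (subst nn_integral_cmult) (auto simp: nn_integral_Poisson_kernel[OF a])
  also have "\<dots> = ennreal (1 / (1 - a)\<^sup>2 * (2 * pi / (1 - a\<^sup>2)))"
    using a by (intro ennreal_mult[symmetric]) (auto simp: power_le_one)
  also have "\<dots> \<le> ennreal (2 * pi / (1 - a) ^ 3)"
  proof (intro ennreal_leI)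
    have "1 - a \<le> 1 - a\<^sup>2" using a by (simp add: power2_eq_square mult_left_le)
    then have "1 / (1 - a)\<^sup>2 * (2 * pi / (1 - a\<^sup>2)) \<le> 1 / (1 - a)\<^sup>2 * (2 * pi / (1 - a))"
      using a by (intro mult_left_mono divide_left_mono mult_pos_pos) auto
    also have "\<dots> = 2 * pi / (1 - a) ^ 3"
      using a by (simp add: power2_eq_square power3_eq_cube)
    finally show "1 / (1 - a)\<^sup>2 * (2 * pi / (1 - a\<^sup>2)) \<le> 2 * pi / (1 - a) ^ 3" .
  qed
  finally show ?thesis .
qed

subsection \<open>The Hilbert transform of a function on the unit interval\<close>

lemma norm_one_minus_ge:
  fixes z :: complex
  assumes "0 \<le> t" "t \<le> 1" "norm z \<le> R"
  shows "1 - R \<le> norm (1 - of_real t * z)"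
proof -
  have "norm (of_real t * z) \<le> 1 * norm z"
    unfolding norm_mult using assms by (intro mult_right_mono) auto
  then show ?thesis
    using norm_triangle_ineq2[of 1 "of_real t * z"] assms by simp
qed

text \<open>The multiplier is bounded only where \<open>K\<close> does not vanish, since the kernels
  below are controlled only for \<open>t\<close> in the unit interval, outside of which
  \<open>K\<close> is 0.\<close>

lemma integrable_mult_bounded:
  fixes K m :: "'a \<Rightarrow> complex"
  assumes "integrable M K" and [measurable]: "m \<in> borel_measurable M" and "\<And>x. K x \<noteq> 0 \<Longrightarrow> norm (m x) \<le> B"
  shows "integrable M (\<lambda>x. K x * m x)"
proof (rule Bochner_Integration.integrable_bound)
  show "integrable M (\<lambda>x. of_real B * K x)"
    using assms(1) by simp
  show "AE x in M. norm (K x * m x) \<le> norm (of_real B * K x)"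
  proof (rule AE_I2)
    fix x
    have "norm (K x) * norm (m x) \<le> norm (K x) * \<bar>B\<bar>"
      using assms(3)[of x] by (cases "K x = 0") (auto intro!: mult_left_mono)
    then show "norm (K x * m x) \<le> norm (of_real B * K x)"
      by (simp add: norm_mult mult.commute)
  qed
qed (use assms(1) in measurable)

text \<open>The input is an arbitrary function on the radius, not an analytic one. Taking
  \<open>k t\<close> to be \<open>f t\<close> or \<open>norm (f t)\<close> gives the two operators,
  so that one argument treats both.\<close>

definition hilbert_transform :: "(real \<Rightarrow> complex) \<Rightarrow> complex \<Rightarrow> complex" where
  "hilbert_transform k z = (LBINT t:{0..<1}. k t / (1 - of_real t * z))"

lemma set_integrable_hilbert_kernel:
  fixes k :: "real \<Rightarrow> complex"
  assumes k: "set_integrable lborel {0..<1} k" and z: "norm z < 1"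
  shows "set_integrable lborel {0..<1} (\<lambda>t. k t / (1 - of_real t * z))"
proof -
  have "integrable lborel (\<lambda>t. (indicator {0..<1} t *\<^sub>R k t) * (1 / (1 - of_real t * z)))"
  proof (rule integrable_mult_bounded[where B = "1 / (1 - norm z)"])
    fix t assume "indicator {0..<1} t *\<^sub>R k t \<noteq> 0"
    then have "1 - norm z \<le> norm (1 - of_real t * z)"
      by (intro norm_one_minus_ge) (auto simp: indicator_def split: if_splits)
    then show "norm (1 / (1 - of_real t * z)) \<le> 1 / (1 - norm z)"
      using z by (simp add: norm_divide frac_le)
  qed (use k in \<open>auto simp: set_integrable_def\<close>)
  then show ?thesis by (simp add: set_integrable_def scaleR_conv_of_real)
qed

text \<open>For \<open>norm y \<le> R\<close>, with \<open>R\<close> halfway between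
  \<open>norm z\<close> and 1, every denominator has norm at least \<open>\<delta>\<close>. The
  difference quotient of the kernel then differs from its derivative by at most
  \<open>norm (y - z) / \<delta> ^ 3\<close>, uniformly in \<open>t\<close>, and integrating this
  bound against \<open>K\<close> gives the limit directly.\<close>

lemma has_field_derivative_hilbert_transform:
  fixes k :: "real \<Rightarrow> complex"
  assumes k: "set_integrable lborel {0..<1} k" and z: "norm z < 1"
  shows "(hilbert_transform k has_field_derivative
      (LBINT t:{0..<1}. k t * (of_real t / (1 - of_real t * z)\<^sup>2))) (at z)"
    and "set_integrable lborel {0..<1} (\<lambda>t. k t * (of_real t / (1 - of_real t * z)\<^sup>2))"
proof -
  define K where "K = (\<lambda>t. indicator {0..<1} t *\<^sub>R k t)"
  have K: "integrable lborel K" using k by (simp add: K_def set_integrable_def)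
  have K0: "0 \<le> t \<and> t < 1" if "K t \<noteq> 0" for t
    using that by (auto simp: K_def indicator_def split: if_splits)
  define R where "R = (1 + norm z) / 2"
  define \<delta> where "\<delta> = 1 - R"
  have R: "norm z < R" "R < 1" and \<delta>: "\<delta> > 0" using z by (auto simp: R_def \<delta>_def)
  have ge: "\<delta> \<le> norm (1 - of_real t * y)" if "K t \<noteq> 0" "norm y \<le> R" for t and y :: complex
    using K0[OF that(1)] that(2) norm_one_minus_ge[of t y R] by (simp add: \<delta>_def)
  have H: "hilbert_transform k y = (\<integral>t. K t * (1 / (1 - of_real t * y)) \<partial>lborel)" for y
    by (simp add: hilbert_transform_def set_lebesgue_integral_def K_def scaleR_conv_of_real)
  have D: "(LBINT t:{0..<1}. k t * (of_real t / (1 - of_real t * z)\<^sup>2)) = (\<integral>t. K t * (of_real t / (1 - of_real t * z)\<^sup>2) \<partial>lborel)"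
    by (simp add: set_lebesgue_integral_def K_def scaleR_conv_of_real mult.assoc)
  have int1: "integrable lborel (\<lambda>t. K t * (1 / (1 - of_real t * y)))" if "norm y \<le> R" for y
  proof (rule integrable_mult_bounded[OF K])
    fix t assume "K t \<noteq> 0"
    then show "norm (1 / (1 - of_real t * y)) \<le> 1 / \<delta>"
      using ge[of t y] that \<delta> by (simp add: norm_divide frac_le)
  qed measurable
  have int2: "integrable lborel (\<lambda>t. K t * (of_real t / (1 - of_real t * z)\<^sup>2))"
  proof (rule integrable_mult_bounded[OF K])
    fix t assume t: "K t \<noteq> 0"
    then show "norm (of_real t / (1 - of_real t * z)\<^sup>2) \<le> 1 / \<delta>\<^sup>2"
      using ge[of t z] K0[OF t] R \<delta> by (auto simp: norm_divide norm_power intro!: frac_le power_mono)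
  qed measurable
  then show "set_integrable lborel {0..<1} (\<lambda>t. k t * (of_real t / (1 - of_real t * z)\<^sup>2))"
    by (simp add: K_def set_integrable_def scaleR_conv_of_real mult.assoc)
  define D where "D = (\<integral>t. K t * (of_real t / (1 - of_real t * z)\<^sup>2) \<partial>lborel)"
  define C where "C = (\<integral>t. norm (K t) \<partial>lborel) / \<delta> ^ 3"
  have est: "norm ((hilbert_transform k y - hilbert_transform k z) / (y - z) - D) \<le> C * norm (y - z)"
    if y: "norm y \<le> R" "y \<noteq> z" for y
  proof -
    define m where "m = (\<lambda>t. (1 / (1 - of_real t * y) - 1 / (1 - of_real t * z)) / (y - z) - of_real t / (1 - of_real t * z)\<^sup>2)"
    have "(hilbert_transform k y - hilbert_transform k z) / (y - z) - D
        = (\<integral>t. (K t * (1 / (1 - of_real t * y)) - K t * (1 / (1 - of_real t * z))) / (y - z) - K t * (of_real t / (1 - of_real t * z)\<^sup>2) \<partial>lborel)"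
      using int1[of y] int1[of z] int2 y R unfolding H D_def by simp
    also have "\<dots> = (\<integral>t. K t * m t \<partial>lborel)"
      by (rule Bochner_Integration.integral_cong) (auto simp: m_def algebra_simps diff_divide_distrib)
    also have "norm \<dots> \<le> (\<integral>t. norm (K t) / \<delta> ^ 3 * norm (y - z) \<partial>lborel)"
    proof (rule order_trans[OF integral_norm_bound integral_mono])
      have m: "norm (m t) \<le> norm (y - z) / \<delta> ^ 3" if t: "K t \<noteq> 0" for t
      proof -
        have g: "\<delta> \<le> norm (1 - of_real t * y)" "\<delta> \<le> norm (1 - of_real t * z)"
          using ge[OF t] y R by auto
        then have nz: "1 - of_real t * y \<noteq> 0" "1 - of_real t * z \<noteq> 0"
          using \<delta> by auto
        \<comment> \<open>Stated for abstract \<open>a\<close>, \<open>b\<close>, \<open>d\<close>,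
          \<open>s\<close>, to be used with \<open>a = 1 - t y\<close>, \<open>b = 1 - t z\<close>,
          \<open>d = y - z\<close>, \<open>s = t\<close>: it exhibits the error of the difference
          quotient as a multiple of \<open>d\<close>.\<close>
        have "(1 / a - 1 / b) / d - s / b\<^sup>2 = s\<^sup>2 * d / (a * b\<^sup>2)"
          if "a \<noteq> 0" "b \<noteq> 0" "d \<noteq> 0" "b - a = s * d" for a b d s :: complex
        proof -
          have "1 / a - 1 / b = s * d / (a * b)"
            using that by (simp add: diff_frac_eq)
          then have "(1 / a - 1 / b) / d = s / (a * b)"
            using that by simp
          moreover have "s / (a * b) - s / b\<^sup>2 = s * (b - a) / (a * b\<^sup>2)"
            using that(1,2) by (simp add: field_simps power2_eq_square)
          ultimately show ?thesis
            using that by (simp add: power2_eq_square)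
        qed
        note * = this[OF nz, of "y - z" "of_real t"]
        have "m t = (of_real t)\<^sup>2 * (y - z) / ((1 - of_real t * y) * (1 - of_real t * z)\<^sup>2)"
          unfolding m_def using y by (intro *) (auto simp: algebra_simps)
        then have "norm (m t) = t\<^sup>2 * norm (y - z) / (norm (1 - of_real t * y) * (norm (1 - of_real t * z))\<^sup>2)"
          by (simp add: norm_divide norm_mult norm_power)
        also have "\<dots> \<le> 1 * norm (y - z) / (\<delta> * \<delta>\<^sup>2)"
          using g \<delta> K0[OF t] by (intro frac_le mult_mono power_mono mult_pos_pos power_le_one) auto
        finally show ?thesis by (simp add: power3_eq_cube power2_eq_square)
      qed
      have [measurable]: "m \<in> borel_measurable borel"
        unfolding m_def by measurable
      show "integrable lborel (\<lambda>t. norm (K t * m t))"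
        by (intro integrable_norm integrable_mult_bounded[OF K _ m]) auto
      show "integrable lborel (\<lambda>t. norm (K t) / \<delta> ^ 3 * norm (y - z))"
        using K by simp
      show "norm (K t * m t) \<le> norm (K t) / \<delta> ^ 3 * norm (y - z)" for t
        using mult_left_mono[OF m[of t], of "norm (K t)"] by (cases "K t = 0") (auto simp: norm_mult)
    qed
    also have "\<dots> = C * norm (y - z)"
      by (simp add: C_def)
    finally show ?thesis .
  qed
  have "(\<lambda>y. (hilbert_transform k y - hilbert_transform k z) / (y - z)) \<midarrow>z\<rightarrow> D"
  proof (rule LIM_zero_cancel, rule Lim_null_comparison)
    have "\<forall>\<^sub>F y in at z. y \<in> ball 0 R"
      using R by (intro eventually_at_in_open') auto
    moreover have "\<forall>\<^sub>F y in at z. y \<noteq> z"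
      by (simp add: eventually_at_filter)
    ultimately show "\<forall>\<^sub>F y in at z. norm ((hilbert_transform k y - hilbert_transform k z) / (y - z) - D) \<le> C * norm (y - z)"
      by eventually_elim (auto intro!: est)
    show "((\<lambda>y. C * norm (y - z)) \<longlongrightarrow> 0) (at z)"
      by (auto intro!: tendsto_eq_intros)
  qed
  then show "(hilbert_transform k has_field_derivative
      (LBINT t:{0..<1}. k t * (of_real t / (1 - of_real t * z)\<^sup>2))) (at z)"
    unfolding has_field_derivative_iff D D_def .
qed

subsection \<open>Estimates for Muckenhoupt weights\<close>

lemma nn_integral_Ioo_pos:
  fixes f :: "real \<Rightarrow> ennreal"
  assumes [measurable]: "f \<in> borel_measurable borel" and "a < b"
    and pos: "AE x in lborel. a < x \<and> x < b \<longrightarrow> 0 < f x"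
  shows "0 < (\<integral>\<^sup>+x\<in>{a<..<b}. f x \<partial>lborel)"
proof (rule ccontr)
  assume "\<not> ?thesis"
  then have "(\<integral>\<^sup>+x\<in>{a<..<b}. f x \<partial>lborel) = 0" by simp
  then have "AE x in lborel. f x * indicator {a<..<b} x = 0"
    by (subst (asm) nn_integral_0_iff_AE) auto
  with pos have "AE x in lborel. x \<notin> {a<..<b}"
    by eventually_elim (auto simp: indicator_def split: if_splits)
  then have "{a<..<b} \<in> null_sets lborel"
    by (subst AE_iff_null_sets) auto
  then show False using \<open>a < b\<close> by (simp add: null_sets_def)
qed

lemma nn_integral_Ioo_split:
  fixes f :: "real \<Rightarrow> ennreal"
  assumes [measurable]: "f \<in> borel_measurable borel" and "a \<le> c" "c \<le> b"
  shows "(\<integral>\<^sup>+x\<in>{a<..<b}. f x \<partial>lborel) = (\<integral>\<^sup>+x\<in>{a<..<c}. f x \<partial>lborel) + (\<integral>\<^sup>+x\<in>{c<..<b}. f x \<partial>lborel)"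
proof -
  have "(\<integral>\<^sup>+x\<in>{a<..<b}. f x \<partial>lborel) = (\<integral>\<^sup>+x. f x * indicator {a<..<c} x + f x * indicator {c<..<b} x \<partial>lborel)"
    by (intro nn_integral_cong_AE eventually_mono[OF AE_lborel_singleton[of c]])
       (use assms in \<open>auto simp: indicator_def\<close>)
  also have "\<dots> = (\<integral>\<^sup>+x\<in>{a<..<c}. f x \<partial>lborel) + (\<integral>\<^sup>+x\<in>{c<..<b}. f x \<partial>lborel)"
    by (rule nn_integral_add) auto
  finally show ?thesis .
qed

lemma nn_integral_Ioo_le_const:
  fixes f :: "real \<Rightarrow> real"
  assumes "a \<le> b" and "\<And>x. a < x \<Longrightarrow> x < b \<Longrightarrow> f x \<le> B" "0 \<le> B"
  shows "(\<integral>\<^sup>+x\<in>{a<..<b}. ennreal (f x) \<partial>lborel) \<le> ennreal (B * (b - a))"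
proof -
  have "(\<integral>\<^sup>+x\<in>{a<..<b}. ennreal (f x) \<partial>lborel) \<le> (\<integral>\<^sup>+x. ennreal B * indicator {a<..<b} x \<partial>lborel)"
    by (intro nn_integral_mono) (use assms in \<open>auto simp: indicator_def intro: ennreal_leI\<close>)
  also have "\<dots> = ennreal (B * (b - a))"
    using assms by (simp add: nn_integral_cmult_indicator ennreal_mult)
  finally show ?thesis .
qed

lemma nn_integral_Ioo_ge_const:
  fixes f :: "real \<Rightarrow> real"
  assumes "a \<le> b" and "\<And>x. a < x \<Longrightarrow> x < b \<Longrightarrow> B \<le> f x" "0 \<le> B"
  shows "ennreal (B * (b - a)) \<le> (\<integral>\<^sup>+x\<in>{a<..<b}. ennreal (f x) \<partial>lborel)"
proof -
  have "ennreal (B * (b - a)) = (\<integral>\<^sup>+x. ennreal B * indicator {a<..<b} x \<partial>lborel)"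
    using assms by (simp add: nn_integral_cmult_indicator ennreal_mult)
  also have "\<dots> \<le> (\<integral>\<^sup>+x\<in>{a<..<b}. ennreal (f x) \<partial>lborel)"
    by (intro nn_integral_mono) (use assms in \<open>auto simp: indicator_def intro: ennreal_leI\<close>)
  finally show ?thesis .
qed

text \<open>Supplies the differentiable antiderivative that the Hardy inequality asks for. The
  integrand may be unbounded near 1, so the calculus is done on a closed interval ending strictly
  between \<open>r\<close> and 1.\<close>

lemma antiderivative_Ioo:
  fixes u :: "real \<Rightarrow> real"
  assumes u: "continuous_on {0..<1} u" "\<And>x. 0 \<le> x \<Longrightarrow> x < 1 \<Longrightarrow> 0 \<le> u x" and r: "0 < r" "r < 1"
  shows "((\<lambda>r. integral {0..r} u) has_real_derivative u r) (at r)"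
    and "(\<integral>\<^sup>+x\<in>{0<..<r}. ennreal (u x) \<partial>lborel) = ennreal (integral {0..r} u)"
    and "0 \<le> integral {0..r} u"
proof -
  define b where "b = (1 + r) / 2"
  have b: "r < b" "b < 1" using r by (auto simp: b_def)
  have "continuous_on {0..b} u" using b by (intro continuous_on_subset[OF u(1)]) auto
  then have "((\<lambda>r. integral {0..r} u) has_real_derivative u r) (at r within {0..b})"
    by (rule integral_has_real_derivative) (use r b in auto)
  then show "((\<lambda>r. integral {0..r} u) has_real_derivative u r) (at r)"
    using r b by (simp add: at_within_Icc_at)
  have c: "continuous_on {0..r} u" using r by (intro continuous_on_subset[OF u(1)]) auto
  show "(\<integral>\<^sup>+x\<in>{0<..<r}. ennreal (u x) \<partial>lborel) = ennreal (integral {0..r} u)"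
    by (rule nn_integral_Ioo_continuous[OF c]) (use u r in auto)
  show "0 \<le> integral {0..r} u"
    by (rule integral_nonneg) (use u r c in \<open>auto intro: integrable_continuous_real\<close>)
qed

text \<open>What remains of the weight once everything is reduced to the radius: a Borel profile
  \<open>w\<close> and its tail \<open>W\<close>, now real valued. \<open>A1\<close> and
  \<open>A2\<close> bound the products of integrals in the two conditions without the square roots,
  and \<open>Cd\<close> is a doubling constant.\<close>

locale Muckenhoupt_weight =
  fixes w W :: "real \<Rightarrow> real" and A1 A2 Cd :: real
  assumes w_meas [measurable]: "w \<in> borel_measurable borel"
    and w_nonneg: "0 \<le> w r"
    and w_pos: "AE r in lborel. 0 < r \<and> r < 1 \<longrightarrow> 0 < w r"
    and W_meas [measurable]: "W \<in> borel_measurable borel"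
    and W_eq: "\<lbrakk>0 \<le> r; r < 1\<rbrakk> \<Longrightarrow> (\<integral>\<^sup>+s\<in>{r<..<1}. ennreal (w s) \<partial>lborel) = ennreal (W r)"
    and W_nonneg: "0 \<le> W r"
    and W_cont: "continuous_on {0..<1} W"
    and Cd: "0 < r \<Longrightarrow> r < 1 \<Longrightarrow> W r \<le> Cd * W ((1 + r) / 2)" "0 \<le> Cd"
    and A1: "0 < r \<Longrightarrow> r < 1 \<Longrightarrow> (\<integral>\<^sup>+s\<in>{r<..<1}. ennreal (W s / (1 - s)\<^sup>2) \<partial>lborel) *
        (\<integral>\<^sup>+s\<in>{0<..<r}. ennreal (1 / W s) \<partial>lborel) \<le> ennreal A1" "0 \<le> A1"
    and A2: "0 < r \<Longrightarrow> r < 1 \<Longrightarrow> (\<integral>\<^sup>+s\<in>{0<..<r}. ennreal (W s / (1 - s) ^ 4) \<partial>lborel) *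
        (\<integral>\<^sup>+s\<in>{r<..<1}. ennreal ((1 - s)\<^sup>2 / W s) \<partial>lborel) \<le> ennreal A2" "0 \<le> A2"
begin

lemma W_pos: "0 < W r" if "0 \<le> r" "r < 1"
proof -
  have "0 < (\<integral>\<^sup>+s\<in>{r<..<1}. ennreal (w s) \<partial>lborel)"
    by (rule nn_integral_Ioo_pos) (use w_pos that in \<open>auto elim!: eventually_mono\<close>)
  then show ?thesis using that by (simp add: W_eq)
qed

lemma W_antimono: "W s \<le> W r" if "0 \<le> r" "r \<le> s" "s < 1"
proof -
  have "(\<integral>\<^sup>+s\<in>{s<..<1}. ennreal (w s) \<partial>lborel) \<le> (\<integral>\<^sup>+s\<in>{r<..<1}. ennreal (w s) \<partial>lborel)"
    by (intro nn_set_integral_set_mono) (use that in auto)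
  then show ?thesis using that by (simp add: W_eq ennreal_le_iff W_nonneg)
qed

text \<open>In the first condition at \<open>r = 1/2\<close> the factor over the left half is
  positive, which forces the factor over the right half to be finite. On the left half the integrand
  is bounded by means of \<open>W 0\<close>.\<close>

lemma finite_integral_W: "(\<integral>\<^sup>+s\<in>{0<..<1}. ennreal (W s / (1 - s)\<^sup>2) \<partial>lborel) < \<infinity>"
proof -
  have "0 < (\<integral>\<^sup>+s\<in>{0<..<1/2}. ennreal (1 / W s) \<partial>lborel)"
    by (rule nn_integral_Ioo_pos) (auto intro!: W_pos)
  moreover have "(\<integral>\<^sup>+s\<in>{1/2<..<1}. ennreal (W s / (1 - s)\<^sup>2) \<partial>lborel) *
      (\<integral>\<^sup>+s\<in>{0<..<1/2}. ennreal (1 / W s) \<partial>lborel) < \<infinity>"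
    using A1(1)[of "1/2"] by (rule le_less_trans) auto
  ultimately have 1: "(\<integral>\<^sup>+s\<in>{1/2<..<1}. ennreal (W s / (1 - s)\<^sup>2) \<partial>lborel) < \<infinity>"
    by (auto simp: ennreal_mult_less_top)
  have "(\<integral>\<^sup>+s\<in>{0<..<1/2}. ennreal (W s / (1 - s)\<^sup>2) \<partial>lborel) \<le> ennreal (W 0 / (1/2)\<^sup>2 * (1/2 - 0))"
    by (rule nn_integral_Ioo_le_const) (auto intro!: frac_le W_antimono power_mono W_nonneg divide_nonneg_nonneg)
  then have 2: "(\<integral>\<^sup>+s\<in>{0<..<1/2}. ennreal (W s / (1 - s)\<^sup>2) \<partial>lborel) < \<infinity>"
    by (rule le_less_trans) auto
  show ?thesis
    by (subst nn_integral_Ioo_split[where c = "1/2"]) (use 1 2 in auto)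
qed

text \<open>The same argument with the second condition at \<open>r = 1/2\<close>; on the left half
  \<open>W\<close> is bounded below by \<open>W (1/2)\<close>.\<close>

lemma finite_integral_inverse_W: "(\<integral>\<^sup>+s\<in>{0<..<1}. ennreal ((1 - s)\<^sup>2 / W s) \<partial>lborel) < \<infinity>"
proof -
  have "0 < (\<integral>\<^sup>+s\<in>{0<..<1/2}. ennreal (W s / (1 - s) ^ 4) \<partial>lborel)"
    by (rule nn_integral_Ioo_pos) (auto intro!: W_pos divide_pos_pos)
  moreover have "(\<integral>\<^sup>+s\<in>{0<..<1/2}. ennreal (W s / (1 - s) ^ 4) \<partial>lborel) *
      (\<integral>\<^sup>+s\<in>{1/2<..<1}. ennreal ((1 - s)\<^sup>2 / W s) \<partial>lborel) < \<infinity>"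
    using A2(1)[of "1/2"] by (rule le_less_trans) auto
  ultimately have 1: "(\<integral>\<^sup>+s\<in>{1/2<..<1}. ennreal ((1 - s)\<^sup>2 / W s) \<partial>lborel) < \<infinity>"
    by (auto simp: ennreal_mult_less_top)
  have "(\<integral>\<^sup>+s\<in>{0<..<1/2}. ennreal ((1 - s)\<^sup>2 / W s) \<partial>lborel) \<le> ennreal (1 / W (1/2) * (1/2 - 0))"
    by (rule nn_integral_Ioo_le_const)
       (auto intro!: frac_le W_antimono W_pos W_nonneg power_le_one)
  then have 2: "(\<integral>\<^sup>+s\<in>{0<..<1/2}. ennreal ((1 - s)\<^sup>2 / W s) \<partial>lborel) < \<infinity>"
    by (rule le_less_trans) auto
  show ?thesis
    by (subst nn_integral_Ioo_split[where c = "1/2"]) (use 1 2 in auto)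
qed

text \<open>The first condition is literally the Muckenhoupt condition for this pair of weights,
  with \<open>1 / W\<close> as the reciprocal right-hand weight. It will pass from the derivative of
  \<open>f\<close> on the radius to \<open>f\<close> itself.\<close>

lemma Hardy_primitive:
  assumes [measurable]: "\<psi> \<in> borel_measurable borel" and \<psi>: "\<And>x. 0 < x \<Longrightarrow> x < 1 \<Longrightarrow> 0 \<le> \<psi> x"
  shows "(\<integral>\<^sup>+r\<in>{0<..<1}. (\<integral>\<^sup>+s\<in>{0<..<r}. ennreal (\<psi> s) \<partial>lborel)\<^sup>2 * ennreal (W r / (1 - r)\<^sup>2) \<partial>lborel)
    \<le> ennreal (4 * A1) * (\<integral>\<^sup>+s\<in>{0<..<1}. ennreal ((\<psi> s)\<^sup>2 * W s) \<partial>lborel)"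
proof -
  have c: "continuous_on {0..<1} (\<lambda>x. 1 / W x)"
    by (intro continuous_intros W_cont) (use W_pos in force)
  have nn: "0 \<le> 1 / W x" for x using W_nonneg by simp
  note P = antiderivative_Ioo[OF c nn]
  have "(\<integral>\<^sup>+r\<in>{0<..<1}. (\<integral>\<^sup>+s\<in>{0<..<r}. ennreal (\<psi> s) \<partial>lborel)\<^sup>2 * ennreal (W r / (1 - r)\<^sup>2) \<partial>lborel)
    \<le> ennreal (4 * A1) * (\<integral>\<^sup>+s\<in>{0<..<1}. ennreal ((\<psi> s)\<^sup>2 / (1 / W s)) \<partial>lborel)"
  proof (rule Hardy_Muckenhoupt[where P = "\<lambda>r. integral {0..r} (\<lambda>x. 1 / W x)"])
    fix r :: real assume r: "0 < r" "r < 1"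
    have "0 < (\<integral>\<^sup>+s\<in>{0<..<r}. ennreal (1 / W s) \<partial>lborel)"
      by (rule nn_integral_Ioo_pos) (use r in \<open>auto intro!: W_pos\<close>)
    then show "0 < integral {0..r} (\<lambda>x. 1 / W x)"
      by (simp only: P(2)[OF r] ennreal_less_zero_iff)
    show "ennreal (integral {0..r} (\<lambda>x. 1 / W x)) * (\<integral>\<^sup>+s\<in>{r<..<1}. ennreal (W s / (1 - s)\<^sup>2) \<partial>lborel) \<le> ennreal A1"
      using A1(1)[OF r] by (simp only: P(2)[OF r] mult.commute)
    show "0 < 1 / W r" using r by (simp add: W_pos)
  qed (use P(1) \<psi> A1(2) in auto)
  then show ?thesis by simp
qed

text \<open>The second condition is the dual Muckenhoupt condition for this pair, with
  \<open>(1 - s)^2 / W s\<close> as the reciprocal right-hand weight.\<close>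

lemma Hardy_tail:
  assumes [measurable]: "\<psi> \<in> borel_measurable borel" and \<psi>: "\<And>x. 0 < x \<Longrightarrow> x < 1 \<Longrightarrow> 0 \<le> \<psi> x"
  shows "(\<integral>\<^sup>+r\<in>{0<..<1}. (\<integral>\<^sup>+s\<in>{r<..<1}. ennreal (\<psi> s) \<partial>lborel)\<^sup>2 * ennreal (W r / (1 - r) ^ 4) \<partial>lborel)
    \<le> ennreal (4 * A2) * (\<integral>\<^sup>+s\<in>{0<..<1}. ennreal ((\<psi> s)\<^sup>2 * (W s / (1 - s)\<^sup>2)) \<partial>lborel)"
proof -
  define p where "p = (\<lambda>x. (1 - x)\<^sup>2 / W x)"
  have [measurable]: "p \<in> borel_measurable borel" unfolding p_def by measurable
  have c: "continuous_on {0..<1} p"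
    unfolding p_def by (intro continuous_intros W_cont) (use W_pos in force)
  have nn: "0 \<le> p x" for x using W_nonneg by (simp add: p_def)
  note P = antiderivative_Ioo[OF c nn]
  define M where "M = enn2real (\<integral>\<^sup>+s\<in>{0<..<1}. ennreal (p s) \<partial>lborel)"
  have M: "(\<integral>\<^sup>+s\<in>{0<..<1}. ennreal (p s) \<partial>lborel) = ennreal M"
    using finite_integral_inverse_W by (simp add: M_def p_def)
  \<comment> \<open>The decreasing antiderivative required by the dual inequality is the tail of
    \<open>p\<close>. Writing it as the finite total mass minus an integral from 0 makes it visibly
    differentiable.\<close>
  define Q where "Q = (\<lambda>r. M - integral {0..r} p)"
  have Q: "(\<integral>\<^sup>+s\<in>{r<..<1}. ennreal (p s) \<partial>lborel) = ennreal (Q r)" if r: "0 < r" "r < 1" for r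
  proof -
    have "ennreal M = (\<integral>\<^sup>+s\<in>{0<..<r}. ennreal (p s) \<partial>lborel) + (\<integral>\<^sup>+s\<in>{r<..<1}. ennreal (p s) \<partial>lborel)"
      unfolding M[symmetric] by (rule nn_integral_Ioo_split) (use r in auto)
    then have "ennreal M - ennreal (integral {0..r} p) = (\<integral>\<^sup>+s\<in>{r<..<1}. ennreal (p s) \<partial>lborel)"
      by (simp add: P(2)[OF r])
    then show ?thesis
      using P(3)[OF r] by (simp add: Q_def ennreal_minus)
  qed
  have "(\<integral>\<^sup>+r\<in>{0<..<1}. (\<integral>\<^sup>+s\<in>{r<..<1}. ennreal (\<psi> s) \<partial>lborel)\<^sup>2 * ennreal (W r / (1 - r) ^ 4) \<partial>lborel)
    \<le> ennreal (4 * A2) * (\<integral>\<^sup>+s\<in>{0<..<1}. ennreal ((\<psi> s)\<^sup>2 / p s) \<partial>lborel)"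
  proof (rule Hardy_Muckenhoupt_dual[where P = Q])
    fix r :: real assume r: "0 < r" "r < 1"
    have "0 < (\<integral>\<^sup>+s\<in>{r<..<1}. ennreal (p s) \<partial>lborel)"
      by (rule nn_integral_Ioo_pos) (use r in \<open>auto intro!: W_pos divide_pos_pos simp: p_def\<close>)
    then show "0 < Q r"
      by (simp add: Q[OF r])
    show "(\<integral>\<^sup>+s\<in>{0<..<r}. ennreal (W s / (1 - s) ^ 4) \<partial>lborel) * ennreal (Q r) \<le> ennreal A2"
      using A2(1)[OF r] by (simp add: Q[OF r, symmetric] p_def)
    show "0 < p r" using r by (auto simp: p_def intro!: divide_pos_pos W_pos)
    show "(Q has_real_derivative - p r) (at r)"
      unfolding Q_def using P(1)[OF r] by (auto intro!: derivative_eq_intros)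
  qed (use \<psi> A2(2) in auto)
  also have "(\<lambda>s. (\<psi> s)\<^sup>2 / p s) = (\<lambda>s. (\<psi> s)\<^sup>2 * (W s / (1 - s)\<^sup>2))"
    by (simp add: p_def)
  finally show ?thesis .
qed

text \<open>On the interval from \<open>r\<close> to the midpoint \<open>m\<close> of
  \<open>r\<close> and 1 the integrand is at least \<open>W m / (1 - r)^2\<close>, the length is
  \<open>(1 - r) / 2\<close>, and doubling compares \<open>W m\<close> with
  \<open>W r\<close>.\<close>

lemma tail_doubling: "ennreal (W r) \<le> ennreal (2 * Cd * (1 - r)) * (\<integral>\<^sup>+s\<in>{r<..<1}. ennreal (W s / (1 - s)\<^sup>2) \<partial>lborel)"
  if r: "0 < r" "r < 1"
proof -
  define m where "m = (1 + r) / 2"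
  have m: "r < m" "m < 1" "m - r = (1 - r) / 2" using r by (auto simp: m_def field_simps)
  have "W r \<le> Cd * W m" using Cd r by (simp add: m_def)
  also have "\<dots> = 2 * Cd * (1 - r) * (W m / (1 - r)\<^sup>2 * (m - r))"
  proof -
    have "Cd * x = 2 * Cd * d * (x / d\<^sup>2 * (d / 2))" if "d \<noteq> 0" for d x
      using that by (simp add: power2_eq_square)
    then show ?thesis unfolding m(3) using r by simp
  qed
  finally have "ennreal (W r) \<le> ennreal (2 * Cd * (1 - r) * (W m / (1 - r)\<^sup>2 * (m - r)))"
    by (rule ennreal_leI)
  also have "\<dots> = ennreal (2 * Cd * (1 - r)) * ennreal (W m / (1 - r)\<^sup>2 * (m - r))"
    using r m(1) Cd(2) W_nonneg[of m] by (intro ennreal_mult mult_nonneg_nonneg) auto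
  also have "ennreal (W m / (1 - r)\<^sup>2 * (m - r)) \<le> (\<integral>\<^sup>+s\<in>{r<..<m}. ennreal (W s / (1 - s)\<^sup>2) \<partial>lborel)"
    by (rule nn_integral_Ioo_ge_const)
       (use r m in \<open>auto intro!: frac_le W_antimono power_mono W_nonneg divide_nonneg_nonneg\<close>)
  also have "\<dots> \<le> (\<integral>\<^sup>+s\<in>{r<..<1}. ennreal (W s / (1 - s)\<^sup>2) \<partial>lborel)"
    by (intro nn_set_integral_set_mono) (use m in auto)
  finally show ?thesis by (simp add: mult_left_mono)
qed

text \<open>The tail of \<open>w\<close> is \<open>W\<close>, so the Muckenhoupt product is
  \<open>W r\<close> times the integral of \<open>1 / (W s * (1 - s))\<close> up to
  \<open>r\<close>. There \<open>1 / (1 - s)\<close> is at most \<open>1 / (1 - r)\<close>, while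
  \<open>tail_doubling\<close> bounds \<open>W r\<close> with a factor \<open>1 - r\<close>; these
  cancel, and the product of the first condition is left with the factor
  \<open>2 * Cd\<close>.\<close>

lemma Hardy_profile:
  assumes [measurable]: "\<psi> \<in> borel_measurable borel" and \<psi>: "\<And>x. 0 < x \<Longrightarrow> x < 1 \<Longrightarrow> 0 \<le> \<psi> x"
  shows "(\<integral>\<^sup>+r\<in>{0<..<1}. (\<integral>\<^sup>+s\<in>{0<..<r}. ennreal (\<psi> s) \<partial>lborel)\<^sup>2 * ennreal (w r) \<partial>lborel)
    \<le> ennreal (8 * Cd * A1) * (\<integral>\<^sup>+s\<in>{0<..<1}. ennreal ((\<psi> s)\<^sup>2 * (W s * (1 - s))) \<partial>lborel)"
proof -
  define p where "p = (\<lambda>x. 1 / (W x * (1 - x)))"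
  have [measurable]: "p \<in> borel_measurable borel" unfolding p_def by measurable
  have c: "continuous_on {0..<1} p"
    unfolding p_def by (intro continuous_intros W_cont) (use W_pos in force)
  have ppos: "0 < p x" if "0 \<le> x" "x < 1" for x using W_pos that by (simp add: p_def)
  note P = antiderivative_Ioo[OF c less_imp_le[OF ppos]]
  have "(\<integral>\<^sup>+r\<in>{0<..<1}. (\<integral>\<^sup>+s\<in>{0<..<r}. ennreal (\<psi> s) \<partial>lborel)\<^sup>2 * ennreal (w r) \<partial>lborel)
    \<le> ennreal (4 * (2 * Cd * A1)) * (\<integral>\<^sup>+s\<in>{0<..<1}. ennreal ((\<psi> s)\<^sup>2 / p s) \<partial>lborel)"
  proof (rule Hardy_Muckenhoupt[where P = "\<lambda>r. integral {0..r} p"])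
    fix r :: real assume r: "0 < r" "r < 1"
    have "0 < (\<integral>\<^sup>+s\<in>{0<..<r}. ennreal (p s) \<partial>lborel)"
      by (rule nn_integral_Ioo_pos) (use r in \<open>auto intro!: ppos\<close>)
    then show "0 < integral {0..r} p"
      by (simp only: P(2)[OF _ _ r] ennreal_less_zero_iff)
    let ?I = "\<integral>\<^sup>+s\<in>{r<..<1}. ennreal (W s / (1 - s)\<^sup>2) \<partial>lborel" and ?J = "\<integral>\<^sup>+s\<in>{0<..<r}. ennreal (1 / W s) \<partial>lborel"
    have "ennreal (integral {0..r} p) = (\<integral>\<^sup>+s\<in>{0<..<r}. ennreal (p s) \<partial>lborel)"
      by (simp only: P(2)[OF _ _ r])
    also have "\<dots> \<le> (\<integral>\<^sup>+s. ennreal (1 / (1 - r)) * (ennreal (1 / W s) * indicator {0<..<r} s) \<partial>lborel)"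
    proof (intro nn_integral_mono)
      fix s
      have "p s \<le> 1 / (1 - r) * (1 / W s)" if "0 < s" "s < r"
        using that r W_pos[of s] by (auto simp: p_def field_simps)
      then show "ennreal (p s) * indicator {0<..<r} s \<le> ennreal (1 / (1 - r)) * (ennreal (1 / W s) * indicator {0<..<r} s)"
        using r W_nonneg[of s] by (auto simp: indicator_def ennreal_mult[symmetric] simp del: times_divide_eq_right intro!: ennreal_leI)
    qed
    also have "\<dots> = ennreal (1 / (1 - r)) * ?J"
      by (rule nn_integral_cmult) measurable
    finally have 1: "ennreal (integral {0..r} p) \<le> ennreal (1 / (1 - r)) * ?J" .
    have "ennreal (integral {0..r} p) * (\<integral>\<^sup>+s\<in>{r<..<1}. ennreal (w s) \<partial>lborel) = ennreal (integral {0..r} p) * ennreal (W r)"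
      using r by (simp add: W_eq)
    also have "\<dots> \<le> (ennreal (1 / (1 - r)) * ?J) * (ennreal (2 * Cd * (1 - r)) * ?I)"
      by (intro mult_mono 1 tail_doubling r) auto
    also have "\<dots> = (ennreal (1 / (1 - r)) * ennreal (2 * Cd * (1 - r))) * (?I * ?J)"
      by (simp add: ac_simps)
    also have "ennreal (1 / (1 - r)) * ennreal (2 * Cd * (1 - r)) = ennreal (2 * Cd)"
      using r Cd(2) by (subst ennreal_mult[symmetric]) auto
    also have "ennreal (2 * Cd) * (?I * ?J) \<le> ennreal (2 * Cd) * ennreal A1"
      by (intro mult_left_mono A1(1) r) auto
    also have "\<dots> = ennreal (2 * Cd * A1)"
      using Cd(2) A1(2) by (simp add: ennreal_mult)
    finally show "ennreal (integral {0..r} p) * (\<integral>\<^sup>+s\<in>{r<..<1}. ennreal (w s) \<partial>lborel) \<le> ennreal (2 * Cd * A1)" .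
  qed (use P(1) ppos \<psi> A1(2) Cd(2) in auto)
  then show ?thesis by (simp add: p_def mult.assoc)
qed

end

section \<open>Splitting the kernel and chaining the Hardy inequalities\<close>

lemma ennreal_sum_squared_le: "(a + b)\<^sup>2 \<le> 2 * a\<^sup>2 + 2 * b\<^sup>2" for a b :: ennreal
proof (cases "a = top \<or> b = top")
  case False
  then obtain x y where xy: "a = ennreal x" "b = ennreal y" "0 \<le> x" "0 \<le> y"
    by (metis ennreal_cases)
  have "(x + y)\<^sup>2 \<le> 2 * x\<^sup>2 + 2 * y\<^sup>2"
    using sum_squares_bound[of x y] by (simp add: power2_sum)
  then have "ennreal ((x + y)\<^sup>2) \<le> ennreal (2 * x\<^sup>2 + 2 * y\<^sup>2)"
    by (rule ennreal_leI)
  then show ?thesis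
    using xy by (simp add: ennreal_plus ennreal_mult ennreal_power[symmetric])
qed (auto simp: ennreal_mult_eq_top_iff power2_eq_square)

text \<open>With \<open>m = min t r\<close> the right-hand side is exactly
  \<open>(1 - m) powr (- 3 / 2)\<close>, by the fundamental theorem from 0 to \<open>m\<close>, and
  \<open>t * r \<le> m\<close>. Writing \<open>x < m\<close> as \<open>x < r\<close> together with
  \<open>x < t\<close> separates the variables: integration against \<open>F\<close> in
  \<open>t\<close> then yields a tail at \<open>x\<close>.\<close>

lemma powr_kernel_le:
  assumes t: "0 < t" "t < 1" and r: "0 < r" "r < 1"
  shows "ennreal ((1 - t * r) powr (- 3 / 2))
    \<le> 1 + (\<integral>\<^sup>+x\<in>{0<..<r}. ennreal (3 / 2 * (1 - x) powr (- 5 / 2)) * indicator {x<..<1} t \<partial>lborel)"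
proof -
  define m where "m = min t r"
  have m: "0 < m" "m < 1" "t * r \<le> m"
    using t r by (auto simp: m_def min_def mult_left_le mult_left_le_one_le)
  have "(\<integral>\<^sup>+x\<in>{0<..<r}. ennreal (3 / 2 * (1 - x) powr (- 5 / 2)) * indicator {x<..<1} t \<partial>lborel)
      = (\<integral>\<^sup>+x\<in>{0<..<m}. ennreal (3 / 2 * (1 - x) powr (- 5 / 2)) \<partial>lborel)"
    by (intro nn_integral_cong) (use t in \<open>auto simp: indicator_def m_def\<close>)
  also have "\<dots> = ennreal ((1 - m) powr (- 3 / 2) - (1 - 0) powr (- 3 / 2))"
  proof (rule nn_integral_Ioo_FTC)
    fix x :: real assume "0 \<le> x" "x \<le> m"
    then have "0 < 1 - x" using m by simp
    then show "((\<lambda>x. (1 - x) powr (- 3 / 2)) has_real_derivative 3 / 2 * (1 - x) powr (- 5 / 2)) (at x)"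
      by (auto intro!: derivative_eq_intros)
  qed (use m in auto)
  also have "1 + \<dots> = ennreal (1 + ((1 - m) powr (- 3 / 2) - (1 - 0) powr (- 3 / 2)))"
  proof -
    have "1 powr (- 3 / 2) \<le> (1 - m) powr (- 3 / 2)"
      using m by (intro powr_mono2') auto
    then show ?thesis by (subst ennreal_plus) auto
  qed
  also have "1 + ((1 - m) powr (- 3 / 2) - (1 - 0) powr (- 3 / 2)) = (1 - m) powr (- 3 / 2)"
    by simp
  finally have eq: "1 + (\<integral>\<^sup>+x\<in>{0<..<r}. ennreal (3 / 2 * (1 - x) powr (- 5 / 2)) * indicator {x<..<1} t \<partial>lborel)
      = ennreal ((1 - m) powr (- 3 / 2))" .
  have "(1 - t * r) powr (- 3 / 2) \<le> (1 - m) powr (- 3 / 2)"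
    using m by (intro powr_mono2') auto
  then show ?thesis
    unfolding eq by (rule ennreal_leI)
qed

text \<open>The tail of \<open>F\<close> is converted by \<open>enn2real\<close> because the Hardy
  inequalities take real integrands; the assumption \<open>fin\<close> ensures that no infinite tail
  is turned into 0.\<close>

lemma nn_integral_powr_kernel_le:
  fixes F :: "real \<Rightarrow> real"
  assumes [measurable]: "F \<in> borel_measurable borel" and F: "\<And>t. 0 \<le> F t"
    and fin: "(\<integral>\<^sup>+t\<in>{0<..<1}. ennreal (F t) \<partial>lborel) < \<infinity>"
    and r: "0 < r" "r < 1"
  shows "(\<integral>\<^sup>+t\<in>{0<..<1}. ennreal (F t * (1 - t * r) powr (- 3 / 2)) \<partial>lborel)
    \<le> (\<integral>\<^sup>+t\<in>{0<..<1}. ennreal (F t) \<partial>lborel) + (\<integral>\<^sup>+x\<in>{0<..<r}.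
        ennreal (3 / 2 * (1 - x) powr (- 5 / 2) * enn2real (\<integral>\<^sup>+t\<in>{x<..<1}. ennreal (F t) \<partial>lborel)) \<partial>lborel)"
proof -
  let ?\<kappa> = "\<lambda>x::real. ennreal (3 / 2 * (1 - x) powr (- 5 / 2))"
  have "(\<integral>\<^sup>+t\<in>{0<..<1}. ennreal (F t * (1 - t * r) powr (- 3 / 2)) \<partial>lborel)
      \<le> (\<integral>\<^sup>+t. ennreal (F t) * indicator {0<..<1} t
          + (\<integral>\<^sup>+x. (?\<kappa> x * indicator {0<..<r} x) * (ennreal (F t) * indicator {x<..<1} t) \<partial>lborel) \<partial>lborel)"
  proof (intro nn_integral_mono)
    fix t :: real
    show "ennreal (F t * (1 - t * r) powr (- 3 / 2)) * indicator {0<..<1} t \<le> ennreal (F t) * indicator {0<..<1} t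
          + (\<integral>\<^sup>+x. (?\<kappa> x * indicator {0<..<r} x) * (ennreal (F t) * indicator {x<..<1} t) \<partial>lborel)"
    proof (cases "t \<in> {0<..<1}")
      case True
      have "ennreal (F t * (1 - t * r) powr (- 3 / 2)) = ennreal (F t) * ennreal ((1 - t * r) powr (- 3 / 2))"
        using F by (intro ennreal_mult) auto
      also have "\<dots> \<le> ennreal (F t) * (1 + (\<integral>\<^sup>+x\<in>{0<..<r}. ?\<kappa> x * indicator {x<..<1} t \<partial>lborel))"
        using True r by (intro mult_left_mono powr_kernel_le) auto
      also have "\<dots> = ennreal (F t) + (\<integral>\<^sup>+x. ennreal (F t) * (?\<kappa> x * indicator {x<..<1} t * indicator {0<..<r} x) \<partial>lborel)"
        by (subst nn_integral_cmult) (auto simp: distrib_left)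
      also have "\<dots> = ennreal (F t) + (\<integral>\<^sup>+x. (?\<kappa> x * indicator {0<..<r} x) * (ennreal (F t) * indicator {x<..<1} t) \<partial>lborel)"
        by (simp add: mult_ac)
      finally show ?thesis using True by simp
    qed simp
  qed
  also have "\<dots> = (\<integral>\<^sup>+t\<in>{0<..<1}. ennreal (F t) \<partial>lborel)
      + (\<integral>\<^sup>+t. (\<integral>\<^sup>+x. (?\<kappa> x * indicator {0<..<r} x) * (ennreal (F t) * indicator {x<..<1} t) \<partial>lborel) \<partial>lborel)"
    by (rule nn_integral_add) measurable
  also have "(\<integral>\<^sup>+t. (\<integral>\<^sup>+x. (?\<kappa> x * indicator {0<..<r} x) * (ennreal (F t) * indicator {x<..<1} t) \<partial>lborel) \<partial>lborel)
      = (\<integral>\<^sup>+x. (\<integral>\<^sup>+t. (?\<kappa> x * indicator {0<..<r} x) * (ennreal (F t) * indicator {x<..<1} t) \<partial>lborel) \<partial>lborel)"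
    by (rule lborel_pair.Fubini') measurable
  also have "\<dots> = (\<integral>\<^sup>+x\<in>{0<..<r}.
        ennreal (3 / 2 * (1 - x) powr (- 5 / 2) * enn2real (\<integral>\<^sup>+t\<in>{x<..<1}. ennreal (F t) \<partial>lborel)) \<partial>lborel)"
  proof (intro nn_integral_cong)
    fix x :: real
    show "(\<integral>\<^sup>+t. (?\<kappa> x * indicator {0<..<r} x) * (ennreal (F t) * indicator {x<..<1} t) \<partial>lborel)
        = ennreal (3 / 2 * (1 - x) powr (- 5 / 2) * enn2real (\<integral>\<^sup>+t\<in>{x<..<1}. ennreal (F t) \<partial>lborel)) * indicator {0<..<r} x"
    proof (cases "x \<in> {0<..<r}")
      case True
      have "(\<integral>\<^sup>+t\<in>{x<..<1}. ennreal (F t) \<partial>lborel) \<le> (\<integral>\<^sup>+t\<in>{0<..<1}. ennreal (F t) \<partial>lborel)"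
        by (intro nn_set_integral_set_mono) (use True in auto)
      with fin have "(\<integral>\<^sup>+t\<in>{x<..<1}. ennreal (F t) \<partial>lborel) < \<infinity>"
        by (rule le_less_trans[rotated])
      then have "(\<integral>\<^sup>+t. (?\<kappa> x * indicator {0<..<r} x) * (ennreal (F t) * indicator {x<..<1} t) \<partial>lborel)
          = ?\<kappa> x * ennreal (enn2real (\<integral>\<^sup>+t\<in>{x<..<1}. ennreal (F t) \<partial>lborel))"
        using True by (subst nn_integral_cmult) auto
      also have "\<dots> = ennreal (3 / 2 * (1 - x) powr (- 5 / 2) * enn2real (\<integral>\<^sup>+t\<in>{x<..<1}. ennreal (F t) \<partial>lborel))"
        by (intro ennreal_mult[symmetric]) auto
      finally show ?thesis using True by simp
    qed simp
  qed
  finally show ?thesis .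
qed

context Muckenhoupt_weight begin

text \<open>\<open>M1\<close> is the cost of the constant \<open>norm (f 0)\<close> in the weighted
  norm of \<open>F\<close>; \<open>M2\<close> is the cost of bounding the plain integral of
  \<open>F\<close> by that norm.\<close>

definition M1 :: real where "M1 = enn2real (\<integral>\<^sup>+s\<in>{0<..<1}. ennreal (W s / (1 - s)\<^sup>2) \<partial>lborel)"
definition M2 :: real where "M2 = enn2real (\<integral>\<^sup>+s\<in>{0<..<1}. ennreal ((1 - s)\<^sup>2 / W s) \<partial>lborel)"

lemma M1: "(\<integral>\<^sup>+s\<in>{0<..<1}. ennreal (W s / (1 - s)\<^sup>2) \<partial>lborel) = ennreal M1"
  and M2: "(\<integral>\<^sup>+s\<in>{0<..<1}. ennreal ((1 - s)\<^sup>2 / W s) \<partial>lborel) = ennreal M2"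
  using finite_integral_W finite_integral_inverse_W by (simp_all add: M1_def M2_def)

lemma M_nonneg: "0 \<le> M1" "0 \<le> M2"
  by (simp_all add: M1_def M2_def)

text \<open>Used three times over: for the convergence of the integrals defining the operators, for
  the value of the transform at 0, and for the part of the kernel that is constant.\<close>

lemma integral_squared_le:
  assumes [measurable]: "F \<in> borel_measurable borel" and F: "\<And>t. 0 \<le> F t"
  shows "(\<integral>\<^sup>+t\<in>{0<..<1}. ennreal (F t) \<partial>lborel)\<^sup>2
    \<le> ennreal M2 * (\<integral>\<^sup>+s\<in>{0<..<1}. ennreal ((F s)\<^sup>2 * (W s / (1 - s)\<^sup>2)) \<partial>lborel)"
proof -
  have "(\<integral>\<^sup>+t\<in>{0<..<1}. ennreal (F t) \<partial>lborel)\<^sup>2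
    \<le> (\<integral>\<^sup>+s\<in>{0<..<1}. ennreal ((F s)\<^sup>2 * (W s / (1 - s)\<^sup>2)) \<partial>lborel) *
       (\<integral>\<^sup>+s\<in>{0<..<1}. ennreal (1 / (W s / (1 - s)\<^sup>2)) \<partial>lborel)"
    by (rule nn_integral_Cauchy_Schwarz) (use F in \<open>auto intro!: divide_pos_pos W_pos\<close>)
  also have "(\<integral>\<^sup>+s\<in>{0<..<1}. ennreal (1 / (W s / (1 - s)\<^sup>2)) \<partial>lborel) = ennreal M2"
    by (simp add: M2)
  finally show ?thesis by (simp only: mult.commute)
qed

text \<open>The constant part of the kernel costs \<open>c^2\<close> times the total mass
  \<open>W 0\<close> of \<open>w\<close>. For the rest, \<open>Hardy_profile\<close> removes the
  outer primitive and \<open>Hardy_tail\<close> the inner tail; finiteness of \<open>c\<close> makes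
  every tail of \<open>F\<close> a genuine real number.\<close>

lemma weighted_kernel_estimate:
  assumes [measurable]: "F \<in> borel_measurable borel" and F: "\<And>t. 0 \<le> F t"
    and fin: "(\<integral>\<^sup>+s\<in>{0<..<1}. ennreal ((F s)\<^sup>2 * (W s / (1 - s)\<^sup>2)) \<partial>lborel) < \<infinity>"
  shows "(\<integral>\<^sup>+r\<in>{0<..<1}. (\<integral>\<^sup>+t\<in>{0<..<1}. ennreal (F t * (1 - t * r) powr (- 3 / 2)) \<partial>lborel)\<^sup>2 * ennreal (w r) \<partial>lborel)
    \<le> ennreal (2 * M2 * W 0 + 144 * Cd * A1 * A2) * (\<integral>\<^sup>+s\<in>{0<..<1}. ennreal ((F s)\<^sup>2 * (W s / (1 - s)\<^sup>2)) \<partial>lborel)"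
    (is "_ \<le> _ * ?N")
proof -
  define c where "c = (\<integral>\<^sup>+t\<in>{0<..<1}. ennreal (F t) \<partial>lborel)"
  define \<Psi> where "\<Psi> = (\<lambda>x. enn2real (\<integral>\<^sup>+t\<in>{x<..<1}. ennreal (F t) \<partial>lborel))"
  define \<gamma> where "\<gamma> = (\<lambda>x. 3 / 2 * (1 - x) powr (- 5 / 2) * \<Psi> x)"
  have [measurable]: "\<Psi> \<in> borel_measurable borel" unfolding \<Psi>_def by measurable
  then have [measurable]: "\<gamma> \<in> borel_measurable borel" unfolding \<gamma>_def by measurable
  have \<Psi>_nonneg: "0 \<le> \<Psi> x" for x by (simp add: \<Psi>_def)
  then have \<gamma>: "0 \<le> \<gamma> x" for x by (simp add: \<gamma>_def)
  have c2: "c\<^sup>2 \<le> ennreal M2 * ?N"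
    unfolding c_def by (rule integral_squared_le) (use F in auto)
  also have "\<dots> < \<infinity>" using fin by (simp add: ennreal_mult_less_top)
  finally have cfin: "c < \<infinity>" by (auto simp: power2_eq_square ennreal_mult_less_top)
  have \<Psi>: "(\<integral>\<^sup>+t\<in>{x<..<1}. ennreal (F t) \<partial>lborel) = ennreal (\<Psi> x)" if "0 < x" for x
  proof -
    have "(\<integral>\<^sup>+t\<in>{x<..<1}. ennreal (F t) \<partial>lborel) \<le> c"
      unfolding c_def by (intro nn_set_integral_set_mono) (use that in auto)
    with cfin show ?thesis by (simp add: \<Psi>_def le_less_trans[of _ c])
  qed
  have "(\<integral>\<^sup>+r\<in>{0<..<1}. (\<integral>\<^sup>+t\<in>{0<..<1}. ennreal (F t * (1 - t * r) powr (- 3 / 2)) \<partial>lborel)\<^sup>2 * ennreal (w r) \<partial>lborel)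
    \<le> (\<integral>\<^sup>+r. 2 * c\<^sup>2 * (ennreal (w r) * indicator {0<..<1} r)
        + 2 * ((\<integral>\<^sup>+x\<in>{0<..<r}. ennreal (\<gamma> x) \<partial>lborel)\<^sup>2 * ennreal (w r) * indicator {0<..<1} r) \<partial>lborel)"
  proof (intro nn_integral_mono)
    fix r :: real
    show "(\<integral>\<^sup>+t\<in>{0<..<1}. ennreal (F t * (1 - t * r) powr (- 3 / 2)) \<partial>lborel)\<^sup>2 * ennreal (w r) * indicator {0<..<1} r
      \<le> 2 * c\<^sup>2 * (ennreal (w r) * indicator {0<..<1} r)
        + 2 * ((\<integral>\<^sup>+x\<in>{0<..<r}. ennreal (\<gamma> x) \<partial>lborel)\<^sup>2 * ennreal (w r) * indicator {0<..<1} r)"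
    proof (cases "r \<in> {0<..<1}")
      case True
      have "(\<integral>\<^sup>+t\<in>{0<..<1}. ennreal (F t * (1 - t * r) powr (- 3 / 2)) \<partial>lborel)
          \<le> c + (\<integral>\<^sup>+x\<in>{0<..<r}. ennreal (\<gamma> x) \<partial>lborel)"
        unfolding c_def \<gamma>_def \<Psi>_def
        by (rule nn_integral_powr_kernel_le) (use True F cfin in \<open>auto simp: c_def\<close>)
      then have "(\<integral>\<^sup>+t\<in>{0<..<1}. ennreal (F t * (1 - t * r) powr (- 3 / 2)) \<partial>lborel)\<^sup>2
          \<le> (c + (\<integral>\<^sup>+x\<in>{0<..<r}. ennreal (\<gamma> x) \<partial>lborel))\<^sup>2"
        by (intro power_mono) auto
      also have "\<dots> \<le> 2 * c\<^sup>2 + 2 * (\<integral>\<^sup>+x\<in>{0<..<r}. ennreal (\<gamma> x) \<partial>lborel)\<^sup>2"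
        by (rule ennreal_sum_squared_le)
      finally have "(\<integral>\<^sup>+t\<in>{0<..<1}. ennreal (F t * (1 - t * r) powr (- 3 / 2)) \<partial>lborel)\<^sup>2 * ennreal (w r)
          \<le> (2 * c\<^sup>2 + 2 * (\<integral>\<^sup>+x\<in>{0<..<r}. ennreal (\<gamma> x) \<partial>lborel)\<^sup>2) * ennreal (w r)"
        by (intro mult_right_mono) auto
      then show ?thesis using True by (simp add: distrib_right mult.assoc)
    qed simp
  qed
  also have "\<dots> = 2 * c\<^sup>2 * (\<integral>\<^sup>+r\<in>{0<..<1}. ennreal (w r) \<partial>lborel)
      + 2 * (\<integral>\<^sup>+r\<in>{0<..<1}. (\<integral>\<^sup>+x\<in>{0<..<r}. ennreal (\<gamma> x) \<partial>lborel)\<^sup>2 * ennreal (w r) \<partial>lborel)"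
    by (simp add: nn_integral_add nn_integral_cmult)
  also have "(\<integral>\<^sup>+r\<in>{0<..<1}. ennreal (w r) \<partial>lborel) = ennreal (W 0)"
    by (rule W_eq) auto
  also have "(\<integral>\<^sup>+r\<in>{0<..<1}. (\<integral>\<^sup>+x\<in>{0<..<r}. ennreal (\<gamma> x) \<partial>lborel)\<^sup>2 * ennreal (w r) \<partial>lborel)
      \<le> ennreal (8 * Cd * A1) * (\<integral>\<^sup>+s\<in>{0<..<1}. ennreal ((\<gamma> s)\<^sup>2 * (W s * (1 - s))) \<partial>lborel)"
    by (rule Hardy_profile) (use \<gamma> in auto)
  \<comment> \<open>The squared kernel derivative is \<open>9 / 4 * (1 - s) powr (- 5)\<close>, and
    the factor \<open>1 - s\<close> of the weight lowers the exponent to the 4 that the second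
    condition handles.\<close>
  also have "(\<integral>\<^sup>+s\<in>{0<..<1}. ennreal ((\<gamma> s)\<^sup>2 * (W s * (1 - s))) \<partial>lborel)
      = (\<integral>\<^sup>+s. ennreal (9 / 4) * ((\<integral>\<^sup>+t\<in>{s<..<1}. ennreal (F t) \<partial>lborel)\<^sup>2 * ennreal (W s / (1 - s) ^ 4) * indicator {0<..<1} s) \<partial>lborel)"
  proof (intro nn_integral_cong)
    fix s :: real
    show "ennreal ((\<gamma> s)\<^sup>2 * (W s * (1 - s))) * indicator {0<..<1} s
        = ennreal (9 / 4) * ((\<integral>\<^sup>+t\<in>{s<..<1}. ennreal (F t) \<partial>lborel)\<^sup>2 * ennreal (W s / (1 - s) ^ 4) * indicator {0<..<1} s)"
    proof (cases "s \<in> {0<..<1}")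
      case True
      then have s: "0 < 1 - s" by simp
      have "((1 - s) powr (- 5 / 2))\<^sup>2 = 1 / (1 - s) ^ 5"
      proof -
        have "((1 - s) powr (- 5 / 2))\<^sup>2 = (1 - s) powr (- 5)"
          using s by (simp add: powr_power)
        also have "\<dots> = 1 / (1 - s) ^ 5"
          using s by (simp add: powr_minus powr_numeral divide_inverse)
        finally show ?thesis .
      qed
      then have "(\<gamma> s)\<^sup>2 = 9 / 4 * (1 / (1 - s) ^ 5) * (\<Psi> s)\<^sup>2"
        unfolding \<gamma>_def power_mult_distrib by (simp add: power_divide)
      then have "(\<gamma> s)\<^sup>2 * (W s * (1 - s)) = 9 / 4 * (\<Psi> s)\<^sup>2 * W s * ((1 - s) / (1 - s) ^ 5)"
        by simp
      also have "(1 - s) / (1 - s) ^ 5 = 1 / (1 - s) ^ 4"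
        using s by (simp add: power_eq_if)
      finally have "(\<gamma> s)\<^sup>2 * (W s * (1 - s)) = 9 / 4 * ((\<Psi> s)\<^sup>2 * (W s / (1 - s) ^ 4))"
        by simp
      then have "ennreal ((\<gamma> s)\<^sup>2 * (W s * (1 - s))) = ennreal (9 / 4 * ((\<Psi> s)\<^sup>2 * (W s / (1 - s) ^ 4)))"
        by simp
      also have "\<dots> = ennreal (9 / 4) * ennreal ((\<Psi> s)\<^sup>2 * (W s / (1 - s) ^ 4))"
        using s W_nonneg[of s] by (intro ennreal_mult) auto
      also have "ennreal ((\<Psi> s)\<^sup>2 * (W s / (1 - s) ^ 4)) = ennreal ((\<Psi> s)\<^sup>2) * ennreal (W s / (1 - s) ^ 4)"
        using s W_nonneg[of s] by (intro ennreal_mult) auto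
      also have "ennreal ((\<Psi> s)\<^sup>2) = (\<integral>\<^sup>+t\<in>{s<..<1}. ennreal (F t) \<partial>lborel)\<^sup>2"
        using True \<Psi>_nonneg[of s] by (simp add: \<Psi> ennreal_power)
      finally show ?thesis using True by simp
    qed simp
  qed
  also have "\<dots> = ennreal (9 / 4) * (\<integral>\<^sup>+s\<in>{0<..<1}. (\<integral>\<^sup>+t\<in>{s<..<1}. ennreal (F t) \<partial>lborel)\<^sup>2 * ennreal (W s / (1 - s) ^ 4) \<partial>lborel)"
    by (rule nn_integral_cmult) measurable
  also have "(\<integral>\<^sup>+s\<in>{0<..<1}. (\<integral>\<^sup>+t\<in>{s<..<1}. ennreal (F t) \<partial>lborel)\<^sup>2 * ennreal (W s / (1 - s) ^ 4) \<partial>lborel)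
      \<le> ennreal (4 * A2) * ?N"
    by (rule Hardy_tail) (use F in auto)
  also note c2
  also have "2 * (ennreal M2 * ?N) * ennreal (W 0) + 2 * (ennreal (8 * Cd * A1) * (ennreal (9 / 4) * (ennreal (4 * A2) * ?N)))
      = (2 * ennreal M2 * ennreal (W 0) + 2 * ennreal (8 * Cd * A1) * ennreal (9 / 4) * ennreal (4 * A2)) * ?N"
    by (simp only: distrib_left distrib_right mult_ac)
  \<comment> \<open>144 is the product of 2 from squaring a sum, 8 from
    \<open>Hardy_profile\<close>, 9/4 from the kernel and 4 from \<open>Hardy_tail\<close>.\<close>
  also have "2 * ennreal M2 * ennreal (W 0) + 2 * ennreal (8 * Cd * A1) * ennreal (9 / 4) * ennreal (4 * A2)
      = ennreal (2 * M2 * W 0 + 144 * Cd * A1 * A2)"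
    using M_nonneg W_nonneg[of 0] Cd(2) A1(2) A2(2)
    by (simp add: ennreal_mult[symmetric] ennreal_plus[symmetric] ennreal_numeral[symmetric]
        del: ennreal_plus ennreal_numeral)
  finally show ?thesis
    by (simp add: mult_left_mono mult_right_mono add_mono)
qed

text \<open>Meant for \<open>b = norm (f 0)\<close> and \<open>\<phi>\<close> the norm of the
  derivative on the radius. Squaring the sum costs a factor 2: the constant is integrated against
  the weight of mass \<open>M1\<close>, and the primitive goes through
  \<open>Hardy_primitive\<close>.\<close>

lemma weighted_growth_estimate:
  assumes [measurable]: "F \<in> borel_measurable borel" "\<phi> \<in> borel_measurable borel"
    and F: "\<And>t. 0 \<le> F t" and \<phi>: "\<And>t. 0 \<le> \<phi> t" and b: "0 \<le> b"
    and le: "\<And>r. 0 < r \<Longrightarrow> r < 1 \<Longrightarrow> ennreal (F r) \<le> ennreal b + (\<integral>\<^sup>+s\<in>{0<..<r}. ennreal (\<phi> s) \<partial>lborel)"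
  shows "(\<integral>\<^sup>+s\<in>{0<..<1}. ennreal ((F s)\<^sup>2 * (W s / (1 - s)\<^sup>2)) \<partial>lborel)
    \<le> ennreal (2 * M1) * ennreal (b\<^sup>2) + ennreal (8 * A1) * (\<integral>\<^sup>+s\<in>{0<..<1}. ennreal ((\<phi> s)\<^sup>2 * W s) \<partial>lborel)"
proof -
  have "(\<integral>\<^sup>+s\<in>{0<..<1}. ennreal ((F s)\<^sup>2 * (W s / (1 - s)\<^sup>2)) \<partial>lborel)
    \<le> (\<integral>\<^sup>+r. 2 * ennreal (b\<^sup>2) * (ennreal (W r / (1 - r)\<^sup>2) * indicator {0<..<1} r)
        + 2 * ((\<integral>\<^sup>+s\<in>{0<..<r}. ennreal (\<phi> s) \<partial>lborel)\<^sup>2 * ennreal (W r / (1 - r)\<^sup>2) * indicator {0<..<1} r) \<partial>lborel)"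
  proof (intro nn_integral_mono)
    fix r :: real
    let ?I = "\<integral>\<^sup>+s\<in>{0<..<r}. ennreal (\<phi> s) \<partial>lborel"
    show "ennreal ((F r)\<^sup>2 * (W r / (1 - r)\<^sup>2)) * indicator {0<..<1} r
      \<le> 2 * ennreal (b\<^sup>2) * (ennreal (W r / (1 - r)\<^sup>2) * indicator {0<..<1} r)
        + 2 * (?I\<^sup>2 * ennreal (W r / (1 - r)\<^sup>2) * indicator {0<..<1} r)"
    proof (cases "r \<in> {0<..<1}")
      case True
      have "ennreal ((F r)\<^sup>2) = (ennreal (F r))\<^sup>2"
        using F by (simp add: ennreal_power)
      also have "\<dots> \<le> (ennreal b + ?I)\<^sup>2"
        using True by (intro power_mono le) auto
      also have "\<dots> \<le> 2 * (ennreal b)\<^sup>2 + 2 * ?I\<^sup>2"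
        by (rule ennreal_sum_squared_le)
      also have "(ennreal b)\<^sup>2 = ennreal (b\<^sup>2)"
        using b by (simp add: ennreal_power)
      finally have "ennreal ((F r)\<^sup>2) * ennreal (W r / (1 - r)\<^sup>2) \<le> (2 * ennreal (b\<^sup>2) + 2 * ?I\<^sup>2) * ennreal (W r / (1 - r)\<^sup>2)"
        by (intro mult_right_mono) auto
      moreover have "ennreal ((F r)\<^sup>2 * (W r / (1 - r)\<^sup>2)) = ennreal ((F r)\<^sup>2) * ennreal (W r / (1 - r)\<^sup>2)"
        using W_nonneg[of r] by (intro ennreal_mult) auto
      ultimately show ?thesis
        using True by (simp add: distrib_right mult.assoc)
    qed simp
  qed
  also have "\<dots> = 2 * ennreal (b\<^sup>2) * ennreal M1
      + 2 * (\<integral>\<^sup>+r\<in>{0<..<1}. (\<integral>\<^sup>+s\<in>{0<..<r}. ennreal (\<phi> s) \<partial>lborel)\<^sup>2 * ennreal (W r / (1 - r)\<^sup>2) \<partial>lborel)"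
    by (simp add: nn_integral_add nn_integral_cmult M1)
  also have "(\<integral>\<^sup>+r\<in>{0<..<1}. (\<integral>\<^sup>+s\<in>{0<..<r}. ennreal (\<phi> s) \<partial>lborel)\<^sup>2 * ennreal (W r / (1 - r)\<^sup>2) \<partial>lborel)
      \<le> ennreal (4 * A1) * (\<integral>\<^sup>+s\<in>{0<..<1}. ennreal ((\<phi> s)\<^sup>2 * W s) \<partial>lborel)"
    by (rule Hardy_primitive) (use \<phi> in auto)
  also have "2 * ennreal (b\<^sup>2) * ennreal M1 = ennreal (2 * M1) * ennreal (b\<^sup>2)"
    using M_nonneg by (simp add: ennreal_mult mult_ac)
  also have "2 * (ennreal (4 * A1) * (\<integral>\<^sup>+s\<in>{0<..<1}. ennreal ((\<phi> s)\<^sup>2 * W s) \<partial>lborel))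
      = ennreal (8 * A1) * (\<integral>\<^sup>+s\<in>{0<..<1}. ennreal ((\<phi> s)\<^sup>2 * W s) \<partial>lborel)"
    using A1(2) by (simp add: mult.assoc[symmetric] ennreal_mult[symmetric] ennreal_numeral[symmetric] del: ennreal_numeral)
  finally show ?thesis
    by (simp add: mult_left_mono add_left_mono)
qed

text \<open>Unfolding \<open>W\<close> as a tail of \<open>w\<close> and exchanging the integrals
  leaves, for each \<open>r\<close>, an unweighted integral over the radius of the disc of size
  \<open>r\<close>, the form to which the Fejer-Riesz inequality applies.\<close>

lemma integral_profile_swap:
  assumes [measurable]: "\<phi> \<in> borel_measurable borel"
  shows "(\<integral>\<^sup>+t\<in>{0<..<1}. ennreal ((\<phi> t)\<^sup>2 * W t) \<partial>lborel)
    = (\<integral>\<^sup>+r\<in>{0<..<1}. ennreal (w r) * (\<integral>\<^sup>+t\<in>{0<..<r}. ennreal ((\<phi> t)\<^sup>2) \<partial>lborel) \<partial>lborel)"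
proof -
  have "(\<integral>\<^sup>+t\<in>{0<..<1}. ennreal ((\<phi> t)\<^sup>2 * W t) \<partial>lborel)
      = (\<integral>\<^sup>+t. (\<integral>\<^sup>+r. (ennreal ((\<phi> t)\<^sup>2) * indicator {0<..<1} t) * (ennreal (w r) * indicator {t<..<1} r) \<partial>lborel) \<partial>lborel)"
  proof (intro nn_integral_cong)
    fix t :: real
    show "ennreal ((\<phi> t)\<^sup>2 * W t) * indicator {0<..<1} t
        = (\<integral>\<^sup>+r. (ennreal ((\<phi> t)\<^sup>2) * indicator {0<..<1} t) * (ennreal (w r) * indicator {t<..<1} r) \<partial>lborel)"
      by (cases "t \<in> {0<..<1}") (simp_all add: nn_integral_cmult W_eq ennreal_mult W_nonneg)
  qed
  also have "\<dots> = (\<integral>\<^sup>+r. (\<integral>\<^sup>+t. (ennreal ((\<phi> t)\<^sup>2) * indicator {0<..<1} t) * (ennreal (w r) * indicator {t<..<1} r) \<partial>lborel) \<partial>lborel)"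
    by (rule lborel_pair.Fubini') measurable
  also have "\<dots> = (\<integral>\<^sup>+r. (\<integral>\<^sup>+t. (ennreal (w r) * indicator {0<..<1} r) * (ennreal ((\<phi> t)\<^sup>2) * indicator {0<..<r} t) \<partial>lborel) \<partial>lborel)"
    by (intro nn_integral_cong) (auto simp: indicator_def mult.commute)
  also have "\<dots> = (\<integral>\<^sup>+r\<in>{0<..<1}. ennreal (w r) * (\<integral>\<^sup>+t\<in>{0<..<r}. ennreal ((\<phi> t)\<^sup>2) \<partial>lborel) \<partial>lborel)"
    by (intro nn_integral_cong, subst nn_integral_cmult) (auto simp: indicator_def)
  finally show ?thesis .
qed

end

subsection \<open>Dirichlet norms\<close>

text \<open>An instance of Minkowski's integral inequality, obtained by Cauchy-Schwarz with the
  weight \<open>1 / (F t * g t)\<close>, where \<open>g t\<close> dominates the square mean of the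
  kernel over the circle. The second Cauchy-Schwarz factor is \<open>B\<close>; the first,
  integrated over the circle, is at most \<open>2 * pi * B\<close>.\<close>

lemma circle_mean_le:
  fixes F :: "real \<Rightarrow> real"
  assumes [measurable]: "F \<in> borel_measurable borel" and F: "\<And>t. 0 \<le> F t" and r: "0 < r" "r < 1"
  shows "(\<integral>\<^sup>+\<theta>\<in>{0<..<2*pi}. (\<integral>\<^sup>+t\<in>{0<..<1}. ennreal (F t / (norm (1 - of_real t * (of_real r * cis \<theta>)))\<^sup>2) \<partial>lborel)\<^sup>2 \<partial>lborel)
    \<le> ennreal (2 * pi) * (\<integral>\<^sup>+t\<in>{0<..<1}. ennreal (F t * (1 - t * r) powr (- 3 / 2)) \<partial>lborel)\<^sup>2"
proof -
  have [measurable]: "cis \<in> borel_measurable borel"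
    by (intro borel_measurable_continuous_onI continuous_intros)
  \<comment> \<open>Restricting to the points where \<open>F\<close> is positive keeps the
    Cauchy-Schwarz weight finite and positive; elsewhere the integrand vanishes.\<close>
  define S where "S = {t. 0 < t \<and> t < 1 \<and> 0 < F t}"
  have [measurable]: "S \<in> sets borel" unfolding S_def by measurable
  define k where "k = (\<lambda>\<theta> t. 1 / (norm (1 - of_real (t * r) * cis \<theta>))\<^sup>2)"
  define g where "g = (\<lambda>t. (1 - t * r) powr (- 3 / 2))"
  have [measurable]: "g \<in> borel_measurable borel" unfolding g_def by measurable
  have [measurable]: "(\<lambda>x. k (f x) (h x)) \<in> borel_measurable M"
    if [measurable]: "f \<in> borel_measurable M" "h \<in> borel_measurable M" for f h and M :: "'b measure"
    unfolding k_def by measurable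
  have tr: "0 \<le> t * r" "t * r < 1" if "t \<in> S" for t
  proof -
    have "0 < t" "t < 1" using that by (auto simp: S_def)
    then have "t * r \<le> r" using r by (simp add: mult_left_le_one_le)
    then show "t * r < 1" using r(2) by (rule le_less_trans)
    show "0 \<le> t * r" using \<open>0 < t\<close> r by simp
  qed
  have gpos: "0 < g t" if "t \<in> S" for t
    using tr[OF that] by (simp add: g_def)
  have g2: "(g t)\<^sup>2 = 1 / (1 - t * r) ^ 3" if "t \<in> S" for t
  proof -
    have "(g t)\<^sup>2 = (1 - t * r) powr (- 3)"
      using tr[OF that] by (simp add: g_def powr_power)
    also have "\<dots> = 1 / (1 - t * r) ^ 3"
      using tr[OF that] by (simp add: powr_minus powr_numeral divide_inverse)
    finally show ?thesis .
  qed
  define B where "B = (\<integral>\<^sup>+t\<in>S. ennreal (F t * g t) \<partial>lborel)"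
  have pt: "(\<integral>\<^sup>+t\<in>{0<..<1}. ennreal (F t / (norm (1 - of_real t * (of_real r * cis \<theta>)))\<^sup>2) \<partial>lborel)\<^sup>2
      \<le> (\<integral>\<^sup>+t\<in>S. ennreal (F t / g t) * ennreal ((k \<theta> t)\<^sup>2) \<partial>lborel) * B" for \<theta>
  proof -
    have eq: "(\<integral>\<^sup>+t\<in>{0<..<1}. ennreal (F t / (norm (1 - of_real t * (of_real r * cis \<theta>)))\<^sup>2) \<partial>lborel)
        = (\<integral>\<^sup>+t\<in>S. ennreal (F t * k \<theta> t) \<partial>lborel)"
    proof (intro nn_integral_cong)
      fix t
      have "F t = 0" if "t \<notin> S" "0 < t" "t < 1"
        using that F[of t] by (auto simp: S_def)
      then show "ennreal (F t / (norm (1 - of_real t * (of_real r * cis \<theta>)))\<^sup>2) * indicator {0<..<1} t = ennreal (F t * k \<theta> t) * indicator S t"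
        by (cases "t \<in> S") (auto simp: k_def mult.assoc S_def indicator_def)
    qed
    have "(\<integral>\<^sup>+t\<in>S. ennreal (F t * k \<theta> t) \<partial>lborel)\<^sup>2 \<le> (\<integral>\<^sup>+t\<in>S. ennreal ((F t * k \<theta> t)\<^sup>2 * (1 / (F t * g t))) \<partial>lborel) * (\<integral>\<^sup>+t\<in>S. ennreal (1 / (1 / (F t * g t))) \<partial>lborel)"
      by (rule nn_integral_Cauchy_Schwarz)
         (use F gpos in \<open>auto simp: k_def S_def intro!: mult_nonneg_nonneg divide_pos_pos mult_pos_pos\<close>)
    also have "(\<integral>\<^sup>+t\<in>S. ennreal ((F t * k \<theta> t)\<^sup>2 * (1 / (F t * g t))) \<partial>lborel) = (\<integral>\<^sup>+t\<in>S. ennreal (F t / g t) * ennreal ((k \<theta> t)\<^sup>2) \<partial>lborel)"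
    proof (intro nn_integral_cong)
      fix t
      show "ennreal ((F t * k \<theta> t)\<^sup>2 * (1 / (F t * g t))) * indicator S t = ennreal (F t / g t) * ennreal ((k \<theta> t)\<^sup>2) * indicator S t"
      proof (cases "t \<in> S")
        case True
        then have "0 < F t" "0 < g t" using gpos by (auto simp: S_def)
        then have "(F t * k \<theta> t)\<^sup>2 * (1 / (F t * g t)) = F t / g t * (k \<theta> t)\<^sup>2"
          by (simp add: power2_eq_square)
        then show ?thesis
          using \<open>0 < F t\<close> \<open>0 < g t\<close> by (simp add: ennreal_mult[symmetric])
      qed simp
    qed
    finally show ?thesis unfolding eq by (simp add: B_def)
  qed
  have "(\<integral>\<^sup>+\<theta>\<in>{0<..<2*pi}. (\<integral>\<^sup>+t\<in>{0<..<1}. ennreal (F t / (norm (1 - of_real t * (of_real r * cis \<theta>)))\<^sup>2) \<partial>lborel)\<^sup>2 \<partial>lborel)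
      \<le> (\<integral>\<^sup>+\<theta>. B * (\<integral>\<^sup>+t. (ennreal (F t / g t) * indicator S t) * (ennreal ((k \<theta> t)\<^sup>2) * indicator {0<..<2*pi} \<theta>) \<partial>lborel) \<partial>lborel)"
  proof (intro nn_integral_mono)
    fix \<theta> :: real
    show "(\<integral>\<^sup>+t\<in>{0<..<1}. ennreal (F t / (norm (1 - of_real t * (of_real r * cis \<theta>)))\<^sup>2) \<partial>lborel)\<^sup>2 * indicator {0<..<2*pi} \<theta>
      \<le> B * (\<integral>\<^sup>+t. (ennreal (F t / g t) * indicator S t) * (ennreal ((k \<theta> t)\<^sup>2) * indicator {0<..<2*pi} \<theta>) \<partial>lborel)"
      using pt[of \<theta>] by (cases "\<theta> \<in> {0<..<2*pi}") (auto simp: mult_ac)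
  qed
  also have "\<dots> = B * (\<integral>\<^sup>+\<theta>. (\<integral>\<^sup>+t. (ennreal (F t / g t) * indicator S t) * (ennreal ((k \<theta> t)\<^sup>2) * indicator {0<..<2*pi} \<theta>) \<partial>lborel) \<partial>lborel)"
    by (rule nn_integral_cmult) measurable
  also have "(\<integral>\<^sup>+\<theta>. (\<integral>\<^sup>+t. (ennreal (F t / g t) * indicator S t) * (ennreal ((k \<theta> t)\<^sup>2) * indicator {0<..<2*pi} \<theta>) \<partial>lborel) \<partial>lborel)
      = (\<integral>\<^sup>+t. (\<integral>\<^sup>+\<theta>. (ennreal (F t / g t) * indicator S t) * (ennreal ((k \<theta> t)\<^sup>2) * indicator {0<..<2*pi} \<theta>) \<partial>lborel) \<partial>lborel)"
    by (rule lborel_pair.Fubini') measurable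
  also have "\<dots> \<le> (\<integral>\<^sup>+t. ennreal (2 * pi) * (ennreal (F t * g t) * indicator S t) \<partial>lborel)"
  proof (intro nn_integral_mono)
    fix t
    show "(\<integral>\<^sup>+\<theta>. (ennreal (F t / g t) * indicator S t) * (ennreal ((k \<theta> t)\<^sup>2) * indicator {0<..<2*pi} \<theta>) \<partial>lborel)
        \<le> ennreal (2 * pi) * (ennreal (F t * g t) * indicator S t)"
    proof (cases "t \<in> S")
      case True
      then have pos: "0 < F t" "0 < g t" using gpos by (auto simp: S_def)
      have "(\<integral>\<^sup>+\<theta>\<in>{0<..<2*pi}. ennreal ((k \<theta> t)\<^sup>2) \<partial>lborel) \<le> ennreal (2 * pi / (1 - t * r) ^ 3)"
        using nn_integral_Poisson_kernel_squared_le[OF tr[OF True]]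
        by (simp add: k_def power_divide del: of_real_mult flip: power_mult)
      also have "2 * pi / (1 - t * r) ^ 3 = 2 * pi * (g t)\<^sup>2"
        using g2[OF True] by simp
      finally have "ennreal (F t / g t) * (\<integral>\<^sup>+\<theta>\<in>{0<..<2*pi}. ennreal ((k \<theta> t)\<^sup>2) \<partial>lborel) \<le> ennreal (F t / g t) * ennreal (2 * pi * (g t)\<^sup>2)"
        by (intro mult_left_mono) auto
      also have "\<dots> = ennreal (F t / g t * (2 * pi * (g t)\<^sup>2))"
        using pos by (intro ennreal_mult[symmetric]) auto
      also have "F t / g t * (2 * pi * (g t)\<^sup>2) = 2 * pi * (F t * g t)"
        using pos by (simp add: power2_eq_square)
      also have "ennreal \<dots> = ennreal (2 * pi) * ennreal (F t * g t)"
        using pos by (intro ennreal_mult) auto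
      finally show ?thesis
        using True by (simp add: nn_integral_cmult)
    qed simp
  qed
  also have "\<dots> = ennreal (2 * pi) * B"
    unfolding B_def by (rule nn_integral_cmult) measurable
  finally have *: "(\<integral>\<^sup>+\<theta>\<in>{0<..<2*pi}. (\<integral>\<^sup>+t\<in>{0<..<1}. ennreal (F t / (norm (1 - of_real t * (of_real r * cis \<theta>)))\<^sup>2) \<partial>lborel)\<^sup>2 \<partial>lborel)
      \<le> B * (ennreal (2 * pi) * B)"
    by (simp add: mult_left_mono)
  have "B \<le> (\<integral>\<^sup>+t\<in>{0<..<1}. ennreal (F t * g t) \<partial>lborel)"
    unfolding B_def by (intro nn_set_integral_set_mono) (auto simp: S_def)
  then have "ennreal (2 * pi) * B\<^sup>2 \<le> ennreal (2 * pi) * (\<integral>\<^sup>+t\<in>{0<..<1}. ennreal (F t * g t) \<partial>lborel)\<^sup>2"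
    by (intro mult_left_mono power_mono) auto
  with * show ?thesis
    unfolding g_def by (simp add: power2_eq_square mult_ac)
qed

text \<open>\<open>v\<close> need not be Borel, nor \<open>g\<close> measurable off the disc. So
  \<open>v\<close> is first replaced almost everywhere by \<open>w (norm z)\<close> and
  \<open>g\<close> is cut off; only then is the completed measure exchanged for the Borel one, where
  polar coordinates are available.\<close>

lemma nn_integral_area_measure_polar:
  fixes g :: "complex \<Rightarrow> complex"
  assumes [measurable]: "w \<in> borel_measurable borel"
    and v: "AE z in lborel. z \<in> ball 0 1 \<longrightarrow> v z = w (norm z)"
    and g: "continuous_on (ball 0 1) g"
  shows "(\<integral>\<^sup>+z\<in>ball 0 1. ennreal ((norm (g z))\<^sup>2 * v z) \<partial>area_measure)
    = ennreal (1 / pi) * (\<integral>\<^sup>+r\<in>{0<..<1}. ennreal r * ennreal (w r) *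
        (\<integral>\<^sup>+\<theta>\<in>{0<..<2*pi}. ennreal ((norm (g (of_real r * cis \<theta>)))\<^sup>2) \<partial>lborel) \<partial>lborel)"
proof -
  have [measurable]: "cis \<in> borel_measurable borel"
    by (intro borel_measurable_continuous_onI continuous_intros)
  define gi where "gi = (\<lambda>z. indicator (ball 0 1) z *\<^sub>R g z)"
  have [measurable]: "gi \<in> borel_measurable borel"
    unfolding gi_def using g by (intro borel_measurable_continuous_on_indicator) auto
  define h where "h = (\<lambda>z. ennreal ((norm (gi z))\<^sup>2) * ennreal (w (norm z)))"
  have h[measurable]: "h \<in> borel_measurable borel" unfolding h_def by measurable
  have "AE z in lebesgue. z \<in> ball 0 1 \<longrightarrow> v z = w (norm z)"
    using v by (rule AE_completion)
  then have "AE z in area_measure. z \<in> ball 0 1 \<longrightarrow> v z = w (norm z)"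
    unfolding area_measure_def by (subst AE_density) auto
  then have "(\<integral>\<^sup>+z\<in>ball 0 1. ennreal ((norm (g z))\<^sup>2 * v z) \<partial>area_measure) = (\<integral>\<^sup>+z. h z \<partial>area_measure)"
  proof (intro nn_integral_cong_AE, eventually_elim)
    case (elim z)
    then show ?case
      by (auto simp: h_def gi_def indicator_def ennreal_mult')
  qed
  also have "\<dots> = (\<integral>\<^sup>+z. ennreal (1 / pi) * h z \<partial>lebesgue)"
    unfolding area_measure_def by (intro nn_integral_density) (auto intro: measurable_completion)
  also have "\<dots> = (\<integral>\<^sup>+z. ennreal (1 / pi) * h z \<partial>lborel)"
    by (rule nn_integral_completion)
  also have "\<dots> = ennreal (1 / pi) * (\<integral>\<^sup>+z. h z \<partial>lborel)"
    by (rule nn_integral_cmult) measurable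
  also have "(\<integral>\<^sup>+z. h z \<partial>lborel) = (\<integral>\<^sup>+r. ennreal r * (\<integral>\<^sup>+\<theta>\<in>{0<..<2*pi}. h (of_real r * cis \<theta>) \<partial>lborel) \<partial>lborel)"
    by (rule nn_integral_polar) measurable
  also have "\<dots> = (\<integral>\<^sup>+r\<in>{0<..<1}. ennreal r * ennreal (w r) *
        (\<integral>\<^sup>+\<theta>\<in>{0<..<2*pi}. ennreal ((norm (g (of_real r * cis \<theta>)))\<^sup>2) \<partial>lborel) \<partial>lborel)"
  proof (intro nn_integral_cong)
    fix r :: real
    consider "r \<le> 0" | "1 \<le> r" | "0 < r" "r < 1" by linarith
    then show "ennreal r * (\<integral>\<^sup>+\<theta>\<in>{0<..<2*pi}. h (of_real r * cis \<theta>) \<partial>lborel) = ennreal r * ennreal (w r) *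
        (\<integral>\<^sup>+\<theta>\<in>{0<..<2*pi}. ennreal ((norm (g (of_real r * cis \<theta>)))\<^sup>2) \<partial>lborel) * indicator {0<..<1} r"
    proof cases
      case 1
      then show ?thesis by (simp add: ennreal_neg)
    next
      case 2
      then have "h (of_real r * cis \<theta>) = 0" for \<theta>
        by (simp add: h_def gi_def norm_mult)
      with 2 show ?thesis by simp
    next
      case 3
      then have hr: "h (of_real r * cis \<theta>) = ennreal (w r) * ennreal ((norm (gi (of_real r * cis \<theta>)))\<^sup>2)"
        and gr: "gi (of_real r * cis \<theta>) = g (of_real r * cis \<theta>)" for \<theta>
        by (simp_all add: h_def gi_def norm_mult mult.commute)
      have "(\<integral>\<^sup>+\<theta>\<in>{0<..<2*pi}. h (of_real r * cis \<theta>) \<partial>lborel)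
          = (\<integral>\<^sup>+\<theta>. ennreal (w r) * (ennreal ((norm (gi (of_real r * cis \<theta>)))\<^sup>2) * indicator {0<..<2*pi} \<theta>) \<partial>lborel)"
        by (simp add: hr mult.assoc)
      also have "\<dots> = ennreal (w r) * (\<integral>\<^sup>+\<theta>\<in>{0<..<2*pi}. ennreal ((norm (gi (of_real r * cis \<theta>)))\<^sup>2) \<partial>lborel)"
        by (rule nn_integral_cmult) measurable
      finally show ?thesis using 3 by (simp add: gr mult.assoc)
    qed
  qed
  finally show ?thesis .
qed

lemma norm_radial_growth:
  assumes f: "f holomorphic_on ball 0 1" and r: "0 < r" "r < 1"
  shows "ennreal (norm (f (of_real r))) \<le> ennreal (norm (f 0)) + (\<integral>\<^sup>+t\<in>{0<..<r}. ennreal (norm (deriv f (of_real t))) \<partial>lborel)"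
proof -
  have c: "continuous_on {0..r} (\<lambda>t. deriv f (of_real t))"
    by (rule continuous_on_compose2[OF holomorphic_on_imp_continuous_on[OF holomorphic_deriv[OF f open_ball]]])
       (use r in \<open>auto intro!: continuous_intros\<close>)
  then have cn: "continuous_on {0..r} (\<lambda>t. norm (deriv f (of_real t)))"
    by (intro continuous_intros)
  have "((\<lambda>t. deriv f (of_real t)) has_integral (f (of_real r) - f (of_real 0))) {0..r}"
  proof (rule fundamental_theorem_of_calculus)
    fix t assume t: "t \<in> {0..r}"
    have "(f has_field_derivative deriv f (of_real t)) (at (of_real t))"
      by (rule holomorphic_derivI[OF f open_ball]) (use t r in auto)
    from field_vector_diff_chain_at[OF has_vector_derivative_of_real[OF DERIV_ident] this]
    show "((\<lambda>t. f (of_real t)) has_vector_derivative deriv f (of_real t)) (at t within {0..r})"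
      by (auto simp: o_def intro: has_vector_derivative_at_within)
  qed (use r in auto)
  then have "f (of_real r) - f 0 = integral {0..r} (\<lambda>t. deriv f (of_real t))"
    by (simp add: integral_unique)
  also have "norm \<dots> \<le> integral {0..r} (\<lambda>t. norm (deriv f (of_real t)))"
    by (rule integral_norm_bound_integral) (use c cn in \<open>auto intro: integrable_continuous_real\<close>)
  finally have "norm (f (of_real r)) \<le> norm (f 0) + integral {0..r} (\<lambda>t. norm (deriv f (of_real t)))"
    using norm_triangle_ineq2[of "f (of_real r)" "f 0"] by linarith
  then have "ennreal (norm (f (of_real r))) \<le> ennreal (norm (f 0) + integral {0..r} (\<lambda>t. norm (deriv f (of_real t))))"
    by (rule ennreal_leI)
  also have "\<dots> = ennreal (norm (f 0)) + ennreal (integral {0..r} (\<lambda>t. norm (deriv f (of_real t))))"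
    using cn by (intro ennreal_plus integral_nonneg) (auto intro: integrable_continuous_real)
  also have "ennreal (integral {0..r} (\<lambda>t. norm (deriv f (of_real t)))) = (\<integral>\<^sup>+t\<in>{0<..<r}. ennreal (norm (deriv f (of_real t))) \<partial>lborel)"
    by (rule nn_integral_Ioo_continuous[symmetric]) (use cn in auto)
  finally show ?thesis .
qed

context Muckenhoupt_weight begin

text \<open>The constant \<open>r / 2\<close> of the Fejer-Riesz inequality contains exactly the
  Jacobian \<open>r\<close> of the area integral, so nothing is lost near the origin. The other
  half, together with the normalization of the area measure, gives \<open>pi / 2\<close>.\<close>

lemma radial_derivative_le_energy:
  assumes f: "f holomorphic_on ball 0 1" and v: "AE z in lborel. z \<in> ball 0 1 \<longrightarrow> v z = w (norm z)"
  shows "(\<integral>\<^sup>+t\<in>{0<..<1}. ennreal ((indicator {0<..<1} t * norm (deriv f (of_real t)))\<^sup>2 * W t) \<partial>lborel)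
    \<le> ennreal (pi / 2) * (\<integral>\<^sup>+z\<in>ball 0 1. ennreal ((norm (deriv f z))\<^sup>2 * v z) \<partial>area_measure)"
proof -
  have f': "deriv f holomorphic_on ball 0 1"
    using f by (rule holomorphic_deriv) simp
  then have f'c: "continuous_on (ball 0 1) (deriv f)"
    by (rule holomorphic_on_imp_continuous_on)
  define \<phi> where "\<phi> = (\<lambda>t. indicator {0<..<1} t * norm (deriv f (of_real t)))"
  have "continuous_on {0<..<1} (\<lambda>t. norm (deriv f (of_real t)))"
    by (intro continuous_on_norm continuous_on_compose2[OF f'c]) (auto intro!: continuous_intros)
  then have [measurable]: "\<phi> \<in> borel_measurable borel"
    using borel_measurable_continuous_on_indicator[of "{0<..<1}" "\<lambda>t. norm (deriv f (of_real t))"]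
    by (simp add: \<phi>_def)
  let ?J = "\<lambda>r. \<integral>\<^sup>+\<theta>\<in>{0<..<2*pi}. ennreal ((norm (deriv f (of_real r * cis \<theta>)))\<^sup>2) \<partial>lborel"
  have "(\<integral>\<^sup>+t\<in>{0<..<1}. ennreal ((\<phi> t)\<^sup>2 * W t) \<partial>lborel)
      = (\<integral>\<^sup>+r\<in>{0<..<1}. ennreal (w r) * (\<integral>\<^sup>+t\<in>{0<..<r}. ennreal ((\<phi> t)\<^sup>2) \<partial>lborel) \<partial>lborel)"
    by (rule integral_profile_swap) measurable
  also have "\<dots> \<le> (\<integral>\<^sup>+r. ennreal (1 / 2) * (ennreal r * ennreal (w r) * ?J r * indicator {0<..<1} r) \<partial>lborel)"
  proof (intro nn_integral_mono)
    fix r :: real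
    show "ennreal (w r) * (\<integral>\<^sup>+t\<in>{0<..<r}. ennreal ((\<phi> t)\<^sup>2) \<partial>lborel) * indicator {0<..<1} r
      \<le> ennreal (1 / 2) * (ennreal r * ennreal (w r) * ?J r * indicator {0<..<1} r)"
    proof (cases "r \<in> {0<..<1}")
      case True
      then have r: "0 < r" "r < 1" by auto
      have "(\<integral>\<^sup>+t\<in>{0<..<r}. ennreal ((\<phi> t)\<^sup>2) \<partial>lborel) = (\<integral>\<^sup>+t\<in>{0<..<r}. ennreal ((norm (deriv f (of_real t)))\<^sup>2) \<partial>lborel)"
        by (intro nn_integral_cong) (use r in \<open>auto simp: \<phi>_def indicator_def\<close>)
      also have "\<dots> \<le> ennreal (r / 2) * ?J r"
        by (rule Fejer_Riesz[OF f' r])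
      also have "ennreal (r / 2) = ennreal (1 / 2) * ennreal r"
        using r by (subst ennreal_mult[symmetric]) auto
      finally have "ennreal (w r) * (\<integral>\<^sup>+t\<in>{0<..<r}. ennreal ((\<phi> t)\<^sup>2) \<partial>lborel) \<le> ennreal (w r) * (ennreal (1 / 2) * ennreal r * ?J r)"
        by (intro mult_left_mono) auto
      then show ?thesis using True by (simp add: mult_ac)
    qed simp
  qed
  also have "\<dots> = ennreal (1 / 2) * (\<integral>\<^sup>+r\<in>{0<..<1}. ennreal r * ennreal (w r) * ?J r \<partial>lborel)"
  proof (rule nn_integral_cmult)
    have [measurable]: "cis \<in> borel_measurable borel"
      by (intro borel_measurable_continuous_onI continuous_intros)
    define gi where "gi = (\<lambda>z. indicator (ball 0 1) z *\<^sub>R deriv f z)"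
    have [measurable]: "gi \<in> borel_measurable borel"
      unfolding gi_def using f'c by (intro borel_measurable_continuous_on_indicator) auto
    \<comment> \<open>Measurability in \<open>r\<close> is proved through the cut-off
      \<open>gi\<close>, since \<open>deriv f\<close> is known to be continuous on the disc only;
      for \<open>r\<close> inside the unit interval both integrands coincide.\<close>
    have "(\<lambda>r. ennreal r * ennreal (w r) * ?J r * indicator {0<..<1} r)
        = (\<lambda>r. ennreal r * ennreal (w r) * (\<integral>\<^sup>+\<theta>\<in>{0<..<2*pi}. ennreal ((norm (gi (of_real r * cis \<theta>)))\<^sup>2) \<partial>lborel) * indicator {0<..<1} r)"
      by (auto simp: gi_def norm_mult indicator_def fun_eq_iff)
    also have "\<dots> \<in> borel_measurable lborel" by measurable
    finally show "(\<lambda>r. ennreal r * ennreal (w r) * ?J r * indicator {0<..<1} r) \<in> borel_measurable lborel" .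
  qed
  also have "(\<integral>\<^sup>+r\<in>{0<..<1}. ennreal r * ennreal (w r) * ?J r \<partial>lborel)
      = ennreal pi * (\<integral>\<^sup>+z\<in>ball 0 1. ennreal ((norm (deriv f z))\<^sup>2 * v z) \<partial>area_measure)"
    unfolding nn_integral_area_measure_polar[OF w_meas v f'c]
    by (simp add: mult.assoc[symmetric] ennreal_mult[symmetric])
  also have "ennreal (1 / 2) * (ennreal pi * (\<integral>\<^sup>+z\<in>ball 0 1. ennreal ((norm (deriv f z))\<^sup>2 * v z) \<partial>area_measure))
      = ennreal (pi / 2) * (\<integral>\<^sup>+z\<in>ball 0 1. ennreal ((norm (deriv f z))\<^sup>2 * v z) \<partial>area_measure)"
  proof -
    have "ennreal (1 / 2) * ennreal pi = ennreal (pi / 2)"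
      by (subst ennreal_mult[symmetric]) auto
    then show ?thesis by (simp only: mult.assoc[symmetric])
  qed
  finally show ?thesis by (simp only: \<phi>_def)
qed

text \<open>Only the norm of \<open>k\<close> enters, which is why \<open>k\<close> may be
  \<open>f\<close> or its modulus on the radius. In \<open>C\<close> the second factor bounds the
  weighted norm \<open>N\<close> of \<open>F\<close> by the Dirichlet norm of \<open>f\<close>,
  where \<open>4 * pi * A1\<close> is \<open>8 * A1\<close> times the \<open>pi / 2\<close> of the
  energy estimate. The first factor bounds the transform by \<open>N\<close>: \<open>M2\<close> for
  the value at 0, and the bracket for the derivative, with 2 from \<open>1 / pi\<close> times
  \<open>2 * pi\<close>.\<close>

lemma hilbert_transform_bounded:
  assumes f: "f holomorphic_on ball 0 1" and v: "AE z in lborel. z \<in> ball 0 1 \<longrightarrow> v z = w (norm z)"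
    and fin: "dirichlet_norm_sq v f < \<infinity>"
    and k: "set_borel_measurable borel {0..<1} k"
    and kf: "\<And>t. 0 \<le> t \<Longrightarrow> t < 1 \<Longrightarrow> norm (k t) = norm (f (of_real t))"
  defines "C \<equiv> (M2 + 2 * (2 * M2 * W 0 + 144 * Cd * A1 * A2)) * (2 * M1 + 4 * pi * A1)"
  shows "set_integrable lborel {0..<1} k" "hilbert_transform k holomorphic_on ball 0 1"
    "dirichlet_norm_sq v (hilbert_transform k) \<le> ennreal C * dirichlet_norm_sq v f"
proof -
  define K where "K = (\<lambda>t. indicator {0..<1} t *\<^sub>R k t)"
  define F where "F = (\<lambda>t. norm (K t))"
  have K[measurable]: "K \<in> borel_measurable borel"
    using k by (simp add: K_def set_borel_measurable_def)
  have F_meas[measurable]: "F \<in> borel_measurable borel" unfolding F_def by measurable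
  have F: "0 \<le> F t" for t by (simp add: F_def)
  have Fk: "F t = norm (f (of_real t))" if "0 < t" "t < 1" for t
    using that kf[of t] by (simp add: F_def K_def)
  define E where "E = (\<integral>\<^sup>+z\<in>ball 0 1. ennreal ((norm (deriv f z))\<^sup>2 * v z) \<partial>area_measure)"
  define \<phi> where "\<phi> = (\<lambda>t. indicator {0<..<1} t * norm (deriv f (of_real t)))"
  have f'c: "continuous_on (ball 0 1) (deriv f)"
    using f by (intro holomorphic_on_imp_continuous_on holomorphic_deriv) auto
  have "continuous_on {0<..<1} (\<lambda>t. norm (deriv f (of_real t)))"
    by (intro continuous_on_norm continuous_on_compose2[OF f'c]) (auto intro!: continuous_intros)
  then have [measurable]: "\<phi> \<in> borel_measurable borel"
    using borel_measurable_continuous_on_indicator[of "{0<..<1}" "\<lambda>t. norm (deriv f (of_real t))"]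
    by (simp add: \<phi>_def)
  have \<phi>_nonneg: "0 \<le> \<phi> t" for t by (simp add: \<phi>_def)
  define N where "N = (\<integral>\<^sup>+s\<in>{0<..<1}. ennreal ((F s)\<^sup>2 * (W s / (1 - s)\<^sup>2)) \<partial>lborel)"
  have "N \<le> ennreal (2 * M1) * ennreal ((norm (f 0))\<^sup>2) + ennreal (8 * A1) * (\<integral>\<^sup>+s\<in>{0<..<1}. ennreal ((\<phi> s)\<^sup>2 * W s) \<partial>lborel)"
    unfolding N_def
  proof (rule weighted_growth_estimate)
    fix r :: real assume r: "0 < r" "r < 1"
    have "(\<integral>\<^sup>+t\<in>{0<..<r}. ennreal (norm (deriv f (of_real t))) \<partial>lborel) = (\<integral>\<^sup>+s\<in>{0<..<r}. ennreal (\<phi> s) \<partial>lborel)"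
      by (intro nn_integral_cong) (use r in \<open>auto simp: \<phi>_def indicator_def\<close>)
    with norm_radial_growth[OF f r] show "ennreal (F r) \<le> ennreal (norm (f 0)) + (\<integral>\<^sup>+s\<in>{0<..<r}. ennreal (\<phi> s) \<partial>lborel)"
      by (simp add: Fk r)
  qed (use F \<phi>_nonneg in auto)
  also have "(\<integral>\<^sup>+s\<in>{0<..<1}. ennreal ((\<phi> s)\<^sup>2 * W s) \<partial>lborel) \<le> ennreal (pi / 2) * E"
    unfolding \<phi>_def E_def by (rule radial_derivative_le_energy[OF f v])
  also have "ennreal (2 * M1) * ennreal ((norm (f 0))\<^sup>2) + ennreal (8 * A1) * (ennreal (pi / 2) * E)
      \<le> ennreal (2 * M1 + 4 * pi * A1) * ennreal ((norm (f 0))\<^sup>2) + ennreal (2 * M1 + 4 * pi * A1) * E"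
  proof (intro add_mono mult_right_mono)
    have "ennreal (8 * A1) * (ennreal (pi / 2) * E) = ennreal (4 * pi * A1) * E"
      using A1(2) by (simp add: mult.assoc[symmetric] ennreal_mult[symmetric]) (simp add: mult_ac)
    also have "\<dots> \<le> ennreal (2 * M1 + 4 * pi * A1) * E"
      using M_nonneg by (intro mult_right_mono ennreal_leI) auto
    finally show "ennreal (8 * A1) * (ennreal (pi / 2) * E) \<le> ennreal (2 * M1 + 4 * pi * A1) * E" .
  qed (use A1(2) in \<open>auto intro!: ennreal_leI\<close>)
  also have "\<dots> = ennreal (2 * M1 + 4 * pi * A1) * dirichlet_norm_sq v f"
    by (simp add: dirichlet_norm_sq_def E_def distrib_left)
  finally have N: "N \<le> ennreal (2 * M1 + 4 * pi * A1) * dirichlet_norm_sq v f"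
    by (simp add: mult_left_mono add_left_mono)
  also have "\<dots> < \<infinity>" using fin by (simp add: ennreal_mult_less_top)
  finally have Nfin: "N < \<infinity>" .
  have c2: "(\<integral>\<^sup>+t\<in>{0<..<1}. ennreal (F t) \<partial>lborel)\<^sup>2 \<le> ennreal M2 * N"
    unfolding N_def by (rule integral_squared_le) (use F in auto)
  also have "\<dots> < \<infinity>" using Nfin by (simp add: ennreal_mult_less_top)
  finally have cfin: "(\<integral>\<^sup>+t\<in>{0<..<1}. ennreal (F t) \<partial>lborel) < \<infinity>"
    by (auto simp: power2_eq_square ennreal_mult_less_top)
  \<comment> \<open>\<open>F\<close> vanishes outside the half-open interval, and the point 0 is
    null, so integrals over the line and over the open interval agree.\<close>
  have total: "(\<integral>\<^sup>+t. ennreal (F t * q t) \<partial>lborel) = (\<integral>\<^sup>+t\<in>{0<..<1}. ennreal (F t * q t) \<partial>lborel)" for q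
    by (intro nn_integral_cong_AE eventually_mono[OF AE_lborel_singleton[of 0]])
       (auto simp: F_def K_def indicator_def)
  have "integrable lborel K"
    by (rule integrableI_bounded) (use cfin total[of "\<lambda>_. 1"] in \<open>auto simp: F_def\<close>)
  then show int: "set_integrable lborel {0..<1} k"
    by (simp add: set_integrable_def K_def)
  let ?T = "hilbert_transform k"
  note dT = has_field_derivative_hilbert_transform[OF int]
  show T: "?T holomorphic_on ball 0 1"
    unfolding holomorphic_on_open[OF open_ball]
  proof
    fix z :: complex assume "z \<in> ball 0 1"
    then have "norm z < 1" by simp
    from dT(1)[OF this] show "\<exists>f'. (?T has_field_derivative f') (at z)" by blast
  qed
  have T0: "ennreal (norm (?T 0)) \<le> (\<integral>\<^sup>+t\<in>{0<..<1}. ennreal (F t) \<partial>lborel)"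
  proof -
    have "?T 0 = (\<integral>t. K t \<partial>lborel)"
      by (simp add: hilbert_transform_def set_lebesgue_integral_def K_def)
    also have "ennreal (norm \<dots>) \<le> (\<integral>\<^sup>+t. ennreal (norm (K t)) \<partial>lborel)"
      by (rule integral_norm_bound_ennreal) fact
    finally show ?thesis using total[of "\<lambda>_. 1"] by (simp add: F_def)
  qed
  have T': "ennreal (norm (deriv ?T z)) \<le> (\<integral>\<^sup>+t\<in>{0<..<1}. ennreal (F t / (norm (1 - of_real t * z))\<^sup>2) \<partial>lborel)"
    if z: "norm z < 1" for z
  proof -
    have "deriv ?T z = (\<integral>t. indicator {0..<1} t *\<^sub>R (k t * (of_real t / (1 - of_real t * z)\<^sup>2)) \<partial>lborel)"
      using DERIV_imp_deriv[OF dT(1)[OF z]] by (simp add: set_lebesgue_integral_def)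
    also have "ennreal (norm \<dots>) \<le> (\<integral>\<^sup>+t. ennreal (norm (indicator {0..<1} t *\<^sub>R (k t * (of_real t / (1 - of_real t * z)\<^sup>2)))) \<partial>lborel)"
      by (rule integral_norm_bound_ennreal) (use dT(2)[OF z] in \<open>simp add: set_integrable_def\<close>)
    also have "\<dots> \<le> (\<integral>\<^sup>+t. ennreal (F t * (1 / (norm (1 - of_real t * z))\<^sup>2)) \<partial>lborel)"
      by (intro nn_integral_mono ennreal_leI)
         (auto simp: F_def K_def indicator_def norm_mult norm_divide norm_power intro!: divide_right_mono mult_left_le)
    also have "\<dots> = (\<integral>\<^sup>+t\<in>{0<..<1}. ennreal (F t * (1 / (norm (1 - of_real t * z))\<^sup>2)) \<partial>lborel)"
      by (rule total)
    finally show ?thesis by simp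
  qed
  have T'c: "continuous_on (ball 0 1) (deriv ?T)"
    using T by (intro holomorphic_on_imp_continuous_on holomorphic_deriv) auto
  let ?G = "\<lambda>r. \<integral>\<^sup>+t\<in>{0<..<1}. ennreal (F t * (1 - t * r) powr (- 3 / 2)) \<partial>lborel"
  define Q where "Q = 2 * M2 * W 0 + 144 * Cd * A1 * A2"
  have Q: "0 \<le> Q"
    using M_nonneg W_nonneg[of 0] Cd(2) A1(2) A2(2) by (simp add: Q_def)
  have "(\<integral>\<^sup>+z\<in>ball 0 1. ennreal ((norm (deriv ?T z))\<^sup>2 * v z) \<partial>area_measure)
    = ennreal (1 / pi) * (\<integral>\<^sup>+r\<in>{0<..<1}. ennreal r * ennreal (w r) *
        (\<integral>\<^sup>+\<theta>\<in>{0<..<2*pi}. ennreal ((norm (deriv ?T (of_real r * cis \<theta>)))\<^sup>2) \<partial>lborel) \<partial>lborel)"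
    by (rule nn_integral_area_measure_polar[OF w_meas v T'c])
  also have "\<dots> \<le> ennreal (1 / pi) * (\<integral>\<^sup>+r. ennreal (2 * pi) * ((?G r)\<^sup>2 * ennreal (w r) * indicator {0<..<1} r) \<partial>lborel)"
  proof (intro mult_left_mono nn_integral_mono)
    fix r :: real
    show "ennreal r * ennreal (w r) * (\<integral>\<^sup>+\<theta>\<in>{0<..<2*pi}. ennreal ((norm (deriv ?T (of_real r * cis \<theta>)))\<^sup>2) \<partial>lborel) * indicator {0<..<1} r
      \<le> ennreal (2 * pi) * ((?G r)\<^sup>2 * ennreal (w r) * indicator {0<..<1} r)"
    proof (cases "r \<in> {0<..<1}")
      case True
      then have r: "0 < r" "r < 1" by auto
      have "(\<integral>\<^sup>+\<theta>\<in>{0<..<2*pi}. ennreal ((norm (deriv ?T (of_real r * cis \<theta>)))\<^sup>2) \<partial>lborel)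
          \<le> (\<integral>\<^sup>+\<theta>\<in>{0<..<2*pi}. (\<integral>\<^sup>+t\<in>{0<..<1}. ennreal (F t / (norm (1 - of_real t * (of_real r * cis \<theta>)))\<^sup>2) \<partial>lborel)\<^sup>2 \<partial>lborel)"
      proof (intro nn_integral_mono mult_right_mono)
        fix \<theta>
        have "ennreal ((norm (deriv ?T (of_real r * cis \<theta>)))\<^sup>2) = (ennreal (norm (deriv ?T (of_real r * cis \<theta>))))\<^sup>2"
          by (simp add: ennreal_power)
        also have "\<dots> \<le> (\<integral>\<^sup>+t\<in>{0<..<1}. ennreal (F t / (norm (1 - of_real t * (of_real r * cis \<theta>)))\<^sup>2) \<partial>lborel)\<^sup>2"
          by (intro power_mono T') (use r in \<open>auto simp: norm_mult\<close>)
        finally show "ennreal ((norm (deriv ?T (of_real r * cis \<theta>)))\<^sup>2)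
          \<le> (\<integral>\<^sup>+t\<in>{0<..<1}. ennreal (F t / (norm (1 - of_real t * (of_real r * cis \<theta>)))\<^sup>2) \<partial>lborel)\<^sup>2" .
      qed simp
      also have "\<dots> \<le> ennreal (2 * pi) * (?G r)\<^sup>2"
        by (rule circle_mean_le) (use F r in auto)
      \<comment> \<open>In this direction the polar Jacobian \<open>r\<close> is simply bounded by
        1.\<close>
      finally have "ennreal r * ennreal (w r) * (\<integral>\<^sup>+\<theta>\<in>{0<..<2*pi}. ennreal ((norm (deriv ?T (of_real r * cis \<theta>)))\<^sup>2) \<partial>lborel)
          \<le> 1 * ennreal (w r) * (ennreal (2 * pi) * (?G r)\<^sup>2)"
        using r by (intro mult_mono) auto
      then show ?thesis using True by (simp add: mult_ac)
    qed simp
  qed simp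
  also have "(\<integral>\<^sup>+r. ennreal (2 * pi) * ((?G r)\<^sup>2 * ennreal (w r) * indicator {0<..<1} r) \<partial>lborel)
      = ennreal (2 * pi) * (\<integral>\<^sup>+r\<in>{0<..<1}. (?G r)\<^sup>2 * ennreal (w r) \<partial>lborel)"
    by (rule nn_integral_cmult) measurable
  also have "(\<integral>\<^sup>+r\<in>{0<..<1}. (?G r)\<^sup>2 * ennreal (w r) \<partial>lborel) \<le> ennreal Q * N"
    unfolding Q_def N_def by (rule weighted_kernel_estimate) (use F Nfin in \<open>auto simp: N_def\<close>)
  also have "ennreal (1 / pi) * (ennreal (2 * pi) * (ennreal Q * N)) = ennreal (2 * Q) * N"
    using Q by (simp add: mult.assoc[symmetric] ennreal_mult[symmetric])
  finally have E': "(\<integral>\<^sup>+z\<in>ball 0 1. ennreal ((norm (deriv ?T z))\<^sup>2 * v z) \<partial>area_measure) \<le> ennreal (2 * Q) * N"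
    by (simp add: mult_left_mono)
  have "ennreal ((norm (?T 0))\<^sup>2) = (ennreal (norm (?T 0)))\<^sup>2"
    by (simp add: ennreal_power)
  also have "\<dots> \<le> (\<integral>\<^sup>+t\<in>{0<..<1}. ennreal (F t) \<partial>lborel)\<^sup>2"
    by (intro power_mono T0) simp
  also note c2
  finally have "dirichlet_norm_sq v ?T \<le> ennreal M2 * N + ennreal (2 * Q) * N"
    unfolding dirichlet_norm_sq_def by (rule add_mono[OF _ E'])
  also have "\<dots> = ennreal (M2 + 2 * Q) * N"
    using M_nonneg Q by (simp add: distrib_right ennreal_plus)
  also have "\<dots> \<le> ennreal (M2 + 2 * Q) * (ennreal (2 * M1 + 4 * pi * A1) * dirichlet_norm_sq v f)"
    by (intro mult_left_mono N) simp
  also have "\<dots> = ennreal C * dirichlet_norm_sq v f"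
    unfolding C_def Q_def[symmetric] using M_nonneg Q A1(2) by (simp add: mult.assoc[symmetric] ennreal_mult)
  finally show "dirichlet_norm_sq v ?T \<le> ennreal C * dirichlet_norm_sq v f" .
qed

end

section \<open>From the hypotheses on the weight to data on the radius\<close>

lemma ennreal_sqrt_power2: "(ennreal_sqrt x)\<^sup>2 = x"
  by (cases x) (simp_all add: ennreal_sqrt_def ennreal_power power2_eq_square ennreal_mult_top flip: ennreal_mult)

text \<open>The square root is inverted by squaring at every extended value, infinity included, so
  the bound also covers products with an infinite factor.\<close>

lemma product_bounded_of_SUP_sqrt:
  assumes "(SUP r\<in>I. ennreal_sqrt (f r) * ennreal_sqrt (g r)) < \<infinity>"
  obtains A :: real where "0 \<le> A" "\<And>r. r \<in> I \<Longrightarrow> f r * g r \<le> ennreal A"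
proof -
  obtain B where B: "0 \<le> B" "(SUP r\<in>I. ennreal_sqrt (f r) * ennreal_sqrt (g r)) = ennreal B"
    using assms by (cases "SUP r\<in>I. ennreal_sqrt (f r) * ennreal_sqrt (g r)") auto
  have "f r * g r \<le> ennreal (B\<^sup>2)" if "r \<in> I" for r
  proof -
    have "f r * g r = (ennreal_sqrt (f r) * ennreal_sqrt (g r))\<^sup>2"
      by (simp add: power_mult_distrib ennreal_sqrt_power2)
    also have "\<dots> \<le> (ennreal B)\<^sup>2"
      unfolding B(2)[symmetric] by (intro power_mono SUP_upper that) simp
    finally show ?thesis using B by (simp add: ennreal_power)
  qed
  then show ?thesis by (intro that[of "B\<^sup>2"]) auto
qed

text \<open>The delicate point is the finiteness of the tail at 0. Integrability over the disc says
  nothing about \<open>w\<close> near the origin, where the Jacobian \<open>r\<close> may absorb a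
  singularity; the doubling condition provides what is missing.\<close>

lemma doubling_weight_profile:
  assumes v: "v \<in> doubling_weights"
  obtains w W :: "real \<Rightarrow> real" and Cd :: real where
    "w \<in> borel_measurable borel" "\<And>r. 0 \<le> w r"
    "AE r in lborel. 0 < r \<and> r < 1 \<longrightarrow> 0 < w r"
    "AE z in lborel. z \<in> ball 0 1 \<longrightarrow> v z = w (norm z)"
    "W \<in> borel_measurable borel" "\<And>r. 0 \<le> W r" "continuous_on {0..<1} W"
    "\<And>r. 0 \<le> r \<Longrightarrow> r < 1 \<Longrightarrow> (\<integral>\<^sup>+s\<in>{r<..<1}. ennreal (w s) \<partial>lborel) = ennreal (W r)"
    "\<And>r. 0 \<le> r \<Longrightarrow> r < 1 \<Longrightarrow> weight_tail v r = ennreal (W r)"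
    "\<And>r. 0 < r \<Longrightarrow> r < 1 \<Longrightarrow> W r \<le> Cd * W ((1 + r) / 2)" "0 \<le> Cd"
proof -
  have wr: "weight v" "radial v"
    and sup: "(SUP r\<in>{0<..<1}. weight_tail v r / weight_tail v ((1 + r) / 2)) < \<infinity>"
    using v by (auto simp: doubling_weights_def)
  obtain w where w[measurable]: "w \<in> borel_measurable borel" and w0: "\<And>r. 0 \<le> w r"
    and wpos: "AE r in lborel. 0 < r \<and> r < 1 \<longrightarrow> w r > 0 \<and> v (of_real r) = w r"
    and wv: "AE z in lborel. z \<in> ball 0 1 \<longrightarrow> v z = w (norm z)"
    by (rule radial_weight_profile[OF wr]) blast
  define T where "T = (\<lambda>r. \<integral>\<^sup>+s\<in>{r<..<1}. ennreal (w s) \<partial>lborel)"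
  have [measurable]: "T \<in> borel_measurable borel" unfolding T_def by measurable
  have tail: "weight_tail v r = T r" if "0 \<le> r" for r
    unfolding weight_tail_def T_def nn_integral_completion
    by (intro nn_integral_cong_AE eventually_mono[OF wpos]) (use that in \<open>auto simp: indicator_def\<close>)
  have Tpos: "0 < T r" if "0 \<le> r" "r < 1" for r
    unfolding T_def using that
    by (intro nn_integral_Ioo_pos) (auto intro!: eventually_mono[OF wpos])
  have Tmono: "T s \<le> T r" if "r \<le> s" for r s
    unfolding T_def by (intro nn_set_integral_set_mono) (use that in auto)
  \<comment> \<open>For \<open>r\<close> above 1/2 the polar factor \<open>2 * pi * r\<close> is at
    least 1, so integrability over the disc controls this tail.\<close>
  have Thalf: "T (1/2) < \<infinity>"
  proof -
    have "integrable area_measure (\<lambda>z. indicator (ball 0 1) z *\<^sub>R v z)"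
      using wr by (simp add: weight_def set_integrable_def)
    then have "(\<integral>\<^sup>+z. ennreal (norm (indicator (ball 0 1) z *\<^sub>R v z)) \<partial>area_measure) < \<infinity>"
      by (simp add: integrable_iff_bounded)
    moreover have "(\<integral>\<^sup>+z\<in>ball 0 1. ennreal ((norm (1::complex))\<^sup>2 * v z) \<partial>area_measure)
        \<le> (\<integral>\<^sup>+z. ennreal (norm (indicator (ball 0 1) z *\<^sub>R v z)) \<partial>area_measure)"
      by (intro nn_integral_mono) (auto simp: indicator_def intro!: ennreal_leI)
    ultimately have "(\<integral>\<^sup>+z\<in>ball 0 1. ennreal ((norm (1::complex))\<^sup>2 * v z) \<partial>area_measure) < \<infinity>"
      by (rule le_less_trans[rotated])
    then have "ennreal (1 / pi) * (\<integral>\<^sup>+r\<in>{0<..<1}. ennreal r * ennreal (w r) *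
        (\<integral>\<^sup>+\<theta>\<in>{0<..<2*pi}. ennreal ((norm (1::complex))\<^sup>2) \<partial>lborel) \<partial>lborel) < \<infinity>"
      by (subst (asm) nn_integral_area_measure_polar[OF w wv, of "\<lambda>_. 1"]) auto
    then have fin: "(\<integral>\<^sup>+r\<in>{0<..<1}. ennreal r * ennreal (w r) * ennreal (2 * pi) \<partial>lborel) < \<infinity>"
      by (auto simp: ennreal_mult_less_top nn_integral_cmult_indicator)
    have "T (1/2) \<le> (\<integral>\<^sup>+r\<in>{0<..<1}. ennreal r * ennreal (w r) * ennreal (2 * pi) \<partial>lborel)"
      unfolding T_def
    proof (intro nn_integral_mono)
      fix r :: real
      show "ennreal (w r) * indicator {1/2<..<1} r \<le> ennreal r * ennreal (w r) * ennreal (2 * pi) * indicator {0<..<1} r"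
      proof (cases "r \<in> {1/2<..<1}")
        case True
        have "1 * w r \<le> (r * (2 * pi)) * w r"
        proof (intro mult_right_mono w0)
          have "(1/2) * 2 \<le> r * (2 * pi)"
            using True pi_ge_two by (intro mult_mono) auto
          then show "1 \<le> r * (2 * pi)" by simp
        qed
        then have "ennreal (w r) \<le> ennreal (r * w r * (2 * pi))"
          by (intro ennreal_leI) (simp add: mult_ac)
        then show ?thesis
          using True w0[of r] by (simp add: ennreal_mult)
      qed simp
    qed
    with fin show ?thesis by (rule le_less_trans[rotated])
  qed
  obtain Cd where Cd: "0 \<le> Cd" "(SUP r\<in>{0<..<1}. weight_tail v r / weight_tail v ((1 + r) / 2)) = ennreal Cd"
    using sup by (cases "SUP r\<in>{0<..<1}. weight_tail v r / weight_tail v ((1 + r) / 2)") auto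
  have doubling: "T r \<le> ennreal Cd * T ((1 + r) / 2)" if r: "0 < r" "r < 1" for r
  proof -
    let ?m = "(1 + r) / 2"
    \<comment> \<open>Clearing the extended quotient requires a denominator that is neither 0 nor
      infinite. The midpoint \<open>?m\<close> lies above 1/2, where finiteness is already
      known.\<close>
    have "T ?m \<le> T (1/2)" using r by (intro Tmono) auto
    with Thalf have m: "0 < T ?m" "T ?m < \<infinity>"
      using r by (auto intro!: Tpos)
    have "T r / T ?m \<le> ennreal Cd"
      unfolding Cd(2)[symmetric] using r by (intro SUP_upper2[of r]) (auto simp: tail)
    then have "T r / T ?m * T ?m \<le> ennreal Cd * T ?m"
      by (rule mult_right_mono) simp
    also have "T r / T ?m * T ?m = T r"
      using m by (simp add: ennreal_divide_times ennreal_mult_divide_eq)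
    finally show ?thesis .
  qed
  \<comment> \<open>For every positive \<open>s\<close> the midpoint of \<open>s\<close> and 1
    exceeds 1/2, so doubling bounds all tails by one constant; letting \<open>s\<close> tend to 0
    bounds the full integral.\<close>
  have "(\<integral>\<^sup>+s\<in>{0<..<1}. ennreal (w s) \<partial>lborel) \<le> ennreal Cd * T (1/2)"
  proof (rule nn_integral_Ioo_le_left)
    fix s :: real assume "0 < s" "s < 1"
    then have "T s \<le> ennreal Cd * T ((1 + s) / 2)" by (rule doubling)
    also have "\<dots> \<le> ennreal Cd * T (1/2)"
      using \<open>0 < s\<close> by (intro mult_left_mono Tmono) auto
    finally show "(\<integral>\<^sup>+s\<in>{s<..<1}. ennreal (w s) \<partial>lborel) \<le> ennreal Cd * T (1/2)"
      by (simp add: T_def)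
  qed measurable
  also have "\<dots> < \<infinity>" using Thalf by (simp add: ennreal_mult_less_top)
  finally have T0: "T 0 < \<infinity>" by (simp add: T_def)
  define W where "W = (\<lambda>r. enn2real (T r))"
  have TW: "T r = ennreal (W r)" if "0 \<le> r" for r
    using le_less_trans[OF Tmono[OF that] T0] by (simp add: W_def)
  have "set_integrable lborel {0..1} w"
    unfolding set_integrable_def
  proof (rule integrableI_bounded)
    have "(\<integral>\<^sup>+x. ennreal (norm (indicator {0..1} x *\<^sub>R w x)) \<partial>lborel) = (\<integral>\<^sup>+x\<in>{0..1}. ennreal (w x) \<partial>lborel)"
      by (intro nn_integral_cong) (auto simp: indicator_def w0)
    also have "\<dots> = T 0" unfolding T_def nn_integral_Icc_Ioo ..
    finally show "(\<integral>\<^sup>+x. ennreal (norm (indicator {0..1} x *\<^sub>R w x)) \<partial>lborel) < \<infinity>"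
      using T0 by simp
  qed measurable
  then have wint: "w integrable_on {0..1}"
    by (rule set_borel_integral_eq_integral)
  have W_int: "W r = integral {r..1} w" if r: "r \<in> {0..<1}" for r
  proof -
    have i: "w integrable_on {r..1}"
      by (rule integrable_subinterval_real[OF wint]) (use r in auto)
    have "T r = ennreal (integral {r..1} w)"
      unfolding T_def nn_integral_Icc_Ioo[symmetric]
      by (rule nn_integral_has_integral_lebesgue') (use i w0 in auto)
    then show ?thesis
      using integral_nonneg[OF i] w0 by (simp add: W_def)
  qed
  have "continuous_on {0..<1} (\<lambda>r. integral {r..1} w)"
    by (rule continuous_on_subset[OF indefinite_integral_continuous_1'[OF wint]]) auto
  then have Wc: "continuous_on {0..<1} W"
    by (rule continuous_on_eq) (rule W_int[symmetric])
  have Wd: "W r \<le> Cd * W ((1 + r) / 2)" if r: "0 < r" "r < 1" for r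
  proof -
    have "ennreal (W r) \<le> ennreal Cd * ennreal (W ((1 + r) / 2))"
      using doubling[OF r] r by (simp add: TW)
    then have "ennreal (W r) \<le> ennreal (Cd * W ((1 + r) / 2))"
      using Cd(1) by (simp add: ennreal_mult W_def)
    then show ?thesis
      using Cd(1) by (subst (asm) ennreal_le_iff) (simp_all add: W_def)
  qed
  have wpos': "AE r in lborel. 0 < r \<and> r < 1 \<longrightarrow> 0 < w r"
    using wpos by (rule eventually_mono) auto
  have W_eq: "(\<integral>\<^sup>+s\<in>{r<..<1}. ennreal (w s) \<partial>lborel) = ennreal (W r)" if "0 \<le> r" for r
    using TW[OF that] by (simp only: T_def)
  have tail_eq: "weight_tail v r = ennreal (W r)" if "0 \<le> r" for r
    using TW[OF that] tail[OF that] by simp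
  have [measurable]: "W \<in> borel_measurable borel" unfolding W_def by measurable
  have W0: "0 \<le> W r" for r by (simp add: W_def)
  show ?thesis
    by (rule that[of w W Cd]) (use w0 wpos' wv W0 Wc W_eq tail_eq Wd Cd(1) in auto)
qed

text \<open>The definition asks for a strictly positive constant while \<open>C\<close> may be 0,
  hence \<open>sqrt (C + 1)\<close>.\<close>

lemma bounded_on_dirichletI:
  assumes T: "\<And>f. f \<in> dirichlet_space v \<Longrightarrow> T f holomorphic_on ball 0 1"
    and le: "\<And>f. f \<in> dirichlet_space v \<Longrightarrow> dirichlet_norm_sq v (T f) \<le> ennreal C * dirichlet_norm_sq v f"
    and C: "0 \<le> C"
  shows "bounded_on_dirichlet v T"
  unfolding bounded_on_dirichlet_def
proof (intro exI[of _ "sqrt (C + 1)"] conjI ballI)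
  fix f assume f: "f \<in> dirichlet_space v"
  then have fin: "dirichlet_norm_sq v f < \<infinity>" by (simp add: dirichlet_space_def)
  have Cfin: "ennreal C * dirichlet_norm_sq v f < \<infinity>"
    using fin by (simp add: ennreal_mult_less_top)
  with le[OF f] T[OF f] show "T f \<in> dirichlet_space v"
    by (auto simp: dirichlet_space_def intro: le_less_trans)
  have "enn2real (dirichlet_norm_sq v (T f)) \<le> enn2real (ennreal C * dirichlet_norm_sq v f)"
    using le[OF f] Cfin by (intro enn2real_mono) auto
  also have "\<dots> = C * enn2real (dirichlet_norm_sq v f)"
    using C by (simp add: enn2real_mult)
  also have "\<dots> \<le> (C + 1) * enn2real (dirichlet_norm_sq v f)"
    by (intro mult_right_mono) auto
  finally show "dirichlet_norm v (T f) \<le> sqrt (C + 1) * dirichlet_norm v f"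
    unfolding dirichlet_norm_def real_sqrt_mult[symmetric] by (rule real_sqrt_le_mono)
qed (use C in auto)

theorem corollary4:
  fixes v :: "complex \<Rightarrow> real"
  assumes "v \<in> doubling_weights"
    and "(SUP r\<in>{0<..<1::real}.
           ennreal_sqrt (\<integral>\<^sup>+s\<in>{r<..<1}. weight_tail v s / ennreal ((1 - s)^2) \<partial>lebesgue) *
           ennreal_sqrt (\<integral>\<^sup>+s\<in>{0<..<r}. 1 / weight_tail v s \<partial>lebesgue)) < \<infinity>"
    and "(SUP r\<in>{0<..<1::real}.
           ennreal_sqrt (\<integral>\<^sup>+s\<in>{0<..<r}. weight_tail v s / ennreal ((1 - s)^4) \<partial>lebesgue) *
           ennreal_sqrt (\<integral>\<^sup>+s\<in>{r<..<1}. ennreal ((1 - s)^2) / weight_tail v s \<partial>lebesgue)) < \<infinity>"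
  shows "(\<forall>f\<in>dirichlet_space v. hilbert_op_defined f \<and> sublinear_hilbert_op_defined f) \<and>
    bounded_on_dirichlet v hilbert_op \<and>
    bounded_on_dirichlet v sublinear_hilbert_op"
proof -
  obtain w W Cd where w: "w \<in> borel_measurable borel" "\<And>r. 0 \<le> w r"
      "AE r in lborel. 0 < r \<and> r < 1 \<longrightarrow> 0 < w r"
    and wv: "AE z in lborel. z \<in> ball 0 1 \<longrightarrow> v z = w (norm z)"
    and W: "W \<in> borel_measurable borel" "\<And>r. 0 \<le> W r" "continuous_on {0..<1} W"
      "\<And>r. 0 \<le> r \<Longrightarrow> r < 1 \<Longrightarrow> (\<integral>\<^sup>+s\<in>{r<..<1}. ennreal (w s) \<partial>lborel) = ennreal (W r)"
    and tail: "\<And>r. 0 \<le> r \<Longrightarrow> r < 1 \<Longrightarrow> weight_tail v r = ennreal (W r)"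
    and Cd: "\<And>r. 0 < r \<Longrightarrow> r < 1 \<Longrightarrow> W r \<le> Cd * W ((1 + r) / 2)" "0 \<le> Cd"
    by (rule doubling_weight_profile[OF assms(1)]) blast
  have Wpos: "0 < W r" if "0 \<le> r" "r < 1" for r
  proof -
    have "0 < (\<integral>\<^sup>+s\<in>{r<..<1}. ennreal (w s) \<partial>lborel)"
      by (rule nn_integral_Ioo_pos) (use w that in \<open>auto elim!: eventually_mono\<close>)
    then show ?thesis using that by (simp add: W)
  qed
  \<comment> \<open>Extended quotients of tails are real quotients because \<open>W\<close> is
    positive on the half-open unit interval. The general exponent \<open>n\<close> is useful:
    \<open>n = 0\<close> in the second identity covers \<open>1 / weight_tail v s\<close>.\<close>
  have conv: "(\<integral>\<^sup>+s\<in>{a<..<b}. weight_tail v s / ennreal ((1 - s) ^ n) \<partial>lebesgue)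
        = (\<integral>\<^sup>+s\<in>{a<..<b}. ennreal (W s / (1 - s) ^ n) \<partial>lborel)"
      "(\<integral>\<^sup>+s\<in>{a<..<b}. ennreal ((1 - s) ^ n) / weight_tail v s \<partial>lebesgue)
        = (\<integral>\<^sup>+s\<in>{a<..<b}. ennreal ((1 - s) ^ n / W s) \<partial>lborel)"
    if "0 \<le> a" "b \<le> 1" for a b n
    unfolding nn_integral_completion using that
    by (auto intro!: nn_integral_cong simp: indicator_def tail divide_ennreal Wpos less_imp_le)
  obtain A1 where hA1: "0 \<le> A1" "\<And>r. r \<in> {0<..<1} \<Longrightarrow>
      (\<integral>\<^sup>+s\<in>{r<..<1}. weight_tail v s / ennreal ((1 - s)^2) \<partial>lebesgue) *
      (\<integral>\<^sup>+s\<in>{0<..<r}. 1 / weight_tail v s \<partial>lebesgue) \<le> ennreal A1"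
    by (rule product_bounded_of_SUP_sqrt[OF assms(2)]) blast
  obtain A2 where hA2: "0 \<le> A2" "\<And>r. r \<in> {0<..<1} \<Longrightarrow>
      (\<integral>\<^sup>+s\<in>{0<..<r}. weight_tail v s / ennreal ((1 - s)^4) \<partial>lebesgue) *
      (\<integral>\<^sup>+s\<in>{r<..<1}. ennreal ((1 - s)^2) / weight_tail v s \<partial>lebesgue) \<le> ennreal A2"
    by (rule product_bounded_of_SUP_sqrt[OF assms(3)]) blast
  interpret Muckenhoupt_weight w W A1 A2 Cd
  proof
    fix r :: real assume r: "0 < r" "r < 1"
    show "(\<integral>\<^sup>+s\<in>{r<..<1}. ennreal (W s / (1 - s)\<^sup>2) \<partial>lborel) * (\<integral>\<^sup>+s\<in>{0<..<r}. ennreal (1 / W s) \<partial>lborel) \<le> ennreal A1"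
      using hA1(2)[of r] conv(1)[of r 1 2] conv(2)[of 0 r 0] r by simp
    show "(\<integral>\<^sup>+s\<in>{0<..<r}. ennreal (W s / (1 - s) ^ 4) \<partial>lborel) * (\<integral>\<^sup>+s\<in>{r<..<1}. ennreal ((1 - s)\<^sup>2 / W s) \<partial>lborel) \<le> ennreal A2"
      using hA2(2)[of r] conv(1)[of 0 r 4] conv(2)[of r 1 2] r by simp
  qed (use w W Cd hA1(1) hA2(1) in auto)
  define C where "C = (M2 + 2 * (2 * M2 * W 0 + 144 * Cd * A1 * A2)) * (2 * M1 + 4 * pi * A1)"
  have C: "0 \<le> C"
    using M_nonneg W_nonneg[of 0] Cd(2) hA1(1) hA2(1) by (simp add: C_def)
  have op: "hilbert_op f = hilbert_transform (\<lambda>t. f (of_real t))"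
    "sublinear_hilbert_op f = hilbert_transform (\<lambda>t. of_real (norm (f (of_real t))))" for f
    by (simp_all add: fun_eq_iff hilbert_op_def sublinear_hilbert_op_def hilbert_transform_def)
  have meas: "set_borel_measurable borel {0..<1} (\<lambda>t. f (of_real t))"
      "set_borel_measurable borel {0..<1} (\<lambda>t. complex_of_real (norm (f (of_real t))))"
    if "f \<in> dirichlet_space v" for f
  proof -
    have "continuous_on (ball 0 1) f"
      using that by (auto simp: dirichlet_space_def intro: holomorphic_on_imp_continuous_on)
    then have "continuous_on {0..<1} (\<lambda>t. f (of_real t))"
      by (rule continuous_on_compose2) (auto intro!: continuous_intros)
    then show "set_borel_measurable borel {0..<1} (\<lambda>t. f (of_real t))"
      "set_borel_measurable borel {0..<1} (\<lambda>t. complex_of_real (norm (f (of_real t))))"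
      unfolding set_borel_measurable_def
      by (intro borel_measurable_continuous_on_indicator continuous_intros; simp)+
  qed
  have f: "f holomorphic_on ball 0 1" "dirichlet_norm_sq v f < \<infinity>" if "f \<in> dirichlet_space v" for f
    using that by (auto simp: dirichlet_space_def)
  note H = hilbert_transform_bounded[OF f(1) wv f(2) meas(1), folded C_def]
  note S = hilbert_transform_bounded[OF f(1) wv f(2) meas(2), folded C_def]
  have "hilbert_op_defined f \<and> sublinear_hilbert_op_defined f" if "f \<in> dirichlet_space v" for f
    unfolding hilbert_op_defined_def sublinear_hilbert_op_defined_def
    using H(1)[OF that that that] S(1)[OF that that that]
    by (auto intro!: set_integrable_hilbert_kernel)
  moreover have "bounded_on_dirichlet v hilbert_op"
    by (rule bounded_on_dirichletI[OF _ _ C]; unfold op) (rule H(2,3); simp)+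
  moreover have "bounded_on_dirichlet v sublinear_hilbert_op"
    by (rule bounded_on_dirichletI[OF _ _ C]; unfold op) (rule S(2,3); simp)+
  ultimately show ?thesis by blast
qed

end
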